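(* Let $(\mathfrak g,[-,-]_{\mathfrak g},(-,-)^{\mathfrak g})$ be a quadratic Lie algebra, let $M$ be a smooth manifold with a good open cover $\{U_i\}$, and let $A_c=(\theta_i;\phi_{ij},\tau_{ij})$ be a transitive Lie data over $\{U_i\}$, i.e. an object over $M$ of the $(2,1)$-sheaf of transitive Lie algebroids with connections. (i) There exists a lift of $A_c$ to an object $C_c$ over $M$ of the $(2,1)$-sheaf of transitive Courant algebroids with connections if and only if $p_1(A_c)=0$, where $p_1(A_c)$ is the first Pontryagin class of $A_c$. (ii) If a lift exists, then the space of lifts up to isomorphisms forms a torsor of the group $\Omega^3_{cl}(M)$ of closed 3-forms on $M$.
   Context: A quadratic Lie algebra is a Lie algebra with a nondegenerate ad-invariant symmetric bilinear form. Brackets and pairings of $\mathfrak g$-valued forms are combined with the wedge product; for $\theta\in\Omega^1(U,\mathfrak g)$ and a vector field $X$, $(\theta,\theta(X))^{\mathfrak g}$ is the 1-form $Y\mapsto(\theta(Y),\theta(X))^{\mathfrak g}$; $\mathrm{cs}_3(\theta)=(\theta,d\theta)^{\mathfrak g}+\tfrac13(\theta,[\theta,\theta]_{\mathfrak g})^{\mathfrak g}$. Transitive Lie data over $\{U_i\}$: $\theta_i\in\Omega^1(U_i,\mathfrak g)$, $\tau_{ij}:U_{ij}\to\mathrm{Aut}(\mathfrak g)$ (Lie algebra automorphisms) and $\phi_{ij}\in\Omega^1(U_{ij},\mathfrak g)$ with $\phi_{ij}([X,Y])=X(\phi_{ij}(Y))-Y(\phi_{ij}(X))+[\phi_{ij}(X),\phi_{ij}(Y)]_{\mathfrak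 g}$, $\tau_{ij}(X(b))=X(\tau_{ij}(b))+[\phi_{ij}(X),\tau_{ij}(b)]_{\mathfrak g}$ for vector fields $X,Y$ and $\mathfrak g$-valued functions $b$, $\theta_i-\tau_{ij}\theta_j=\phi_{ij}$ on $U_{ij}$, and $\phi_{ij}+\tau_{ij}\phi_{jk}=\phi_{ik}$, $\tau_{ij}\tau_{jk}=\tau_{ik}$ on $U_{ijk}$. The forms $R_i=d\theta_i+\tfrac12[\theta_i,\theta_i]_{\mathfrak g}$ satisfy $R_i=\tau_{ij}R_j$ and glue to the curvature $R$ of $A_c$, a 2-form with values in the Lie algebra bundle glued from the $U_i\times\mathfrak g$ by the $\tau_{ij}$. The first Pontryagin class is defined through the curvature by $p_1(A_c):=(R,R)^{\mathfrak g}$ (given by $(R_i,R_i)^{\mathfrak g}$ on $U_i$), and $p_1(A_c)=0$ means that $(R,R)^{\mathfrak g}=dH$ for some $H\in\Omega^3(M)$. Standard transitive Courant algebroid on a manifold $U$: $\mathbb T_{\mathfrak g}U=TU\oplus(U\times\mathfrak g)\oplus T^*U$ with anchor the projection to $TU$, pairing $\langle X+a+\xi,Y+b+\eta\rangle^T=\tfrac12(\xi(Y)+\eta(X))+(a,b)^{\mathfrak g}$, and bracket $[\![X+a+\xi,Y+b+\eta]\!]^T_S=[X,Y]+X(b)-Y(a)+[a,b]_{\mathfrak g}+L_X\eta-\iota_Yd\xi+\mathcal P(a,b)$, $\mathcal P(a,b)(Y)=2(b,Y(a))^{\mathfrak g}$. An automorphism of it is a matrix $\Lambda=\begin{pmatrix}1&0&0\\\phi&\tau&0\\\beta&-2\phi^\star\tau&1\end{pmatrix}$,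 written $(\phi,\tau,\beta)$, with $\tau$ an orthogonal automorphism of the bundle of quadratic Lie algebras $U\times\mathfrak g$, $\phi:TU\to U\times\mathfrak g$ and $\beta:TU\to T^*U$ bundle maps, $\phi^\star(a)(X)=(a,\phi(X))^{\mathfrak g}$, satisfying $\tfrac12(\beta(X)(Y)+\beta(Y)(X))+(\phi(X),\phi(Y))^{\mathfrak g}=0$; $\tau(X(b))-X(\tau(b))-[\phi(X),\tau(b)]_{\mathfrak g}=0$; $d\phi+\tfrac12[\phi,\phi]_{\mathfrak g}=0$; $L_X(\beta(Y))-\iota_Yd(\beta(X))-\beta([X,Y])+\mathcal P(\phi(X),\phi(Y))=0$. Local groupoid over $U$: objects are $(\mathbb T_{\mathfrak g}U,\theta,B)$ with $\theta\in\Omega^1(U,\mathfrak g)$, $B\in\Omega^2(U)$; a 1-morphism from $(\tilde\theta,\tilde B)$ to $(\theta,B)$ is an automorphism $(\phi,\tau,\beta)$ of the standard transitive Courant algebroid such that $\theta(X)=\tau\tilde\theta(X)+\phi(X)$, $\iota_X(\tilde B-B)=\beta(X)+(\theta,\theta(X))^{\mathfrak g}-(\tilde\theta,\tilde\theta(X))^{\mathfrak g}-2\phi^\star\tau(\tilde\theta(X))$, and $\mathrm{cs}_3(\tilde\theta)-\mathrm{cs}_3(\theta)=d(\tilde B-B)$; composition is matrix multiplication. Objects over $M$ of the $(2,1)$-sheaf of transitive Courant algebroids with connections are transitive Courant data over open covers: $C_c=(\theta_i,B_i;\phi_{ij},\tau_{ij},\beta_{ij})$, i.e. objects $(\theta_i,B_i)$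 on $U_i$ with 1-morphisms $\Lambda_{ij}=(\phi_{ij},\tau_{ij},\beta_{ij})$ from $(\theta_j,B_j)|_{U_{ij}}$ to $(\theta_i,B_i)|_{U_{ij}}$ such that $\Lambda_{ij}\Lambda_{jk}=\Lambda_{ik}$ on $U_{ijk}$. A 1-morphism (over a common refinement of covers) from $(\tilde\theta_i,\tilde B_i;\tilde\Lambda_{ij})$ to $(\theta_i,B_i;\Lambda_{ij})$ is a collection of 1-morphisms $\Lambda_i:(\tilde\theta_i,\tilde B_i)\to(\theta_i,B_i)$ with $\Lambda_{ij}\Lambda_j=\Lambda_i\tilde\Lambda_{ij}$. The projection from Courant data to Lie data forgets $B_i$ and $\beta_{ij}$ (and $\beta_i$ on morphisms). A lift of $A_c$ is an object projecting to $A_c$; lifts up to isomorphisms are the isomorphism classes in the fibre category of the projection over $A_c$. The action of $h\in\Omega^3_{cl}(M)$: choose $B^h_i\in\Omega^2(U_i)$ with $h|_{U_i}=dB^h_i$ and set $h\cdot[(\theta_i,B_i;\phi_{ij},\tau_{ij},\beta_{ij})]=[(\theta_i,B_i+B^h_i;\phi_{ij},\tau_{ij},\beta_{ij}+B^h_j-B^h_i)]$, a 2-form $\omega$ being regarded as the map $X\mapsto\iota_X\omega$.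
   Formalization: The automorphisms τ_ij of the transitive Lie data are assumed orthogonal for the pairing on g (automorphisms of the quadratic Lie algebra); with mere Lie algebra automorphisms (R_i,R_i) need not glue and (i) fails, e.g. g=R over the circle with θ=φ=0 and one τ_ij=2. *)

theory Defs
  imports
    "HOL-Analysis.Analysis"
    "HOL-Library.Function_Algebras"
    "HOL-Combinatorics.Permutations"
    "HOL-Algebra.Group_Action"
begin

section \<open>Smooth manifolds\<close>

text \<open>Model spaces and Lie algebras are finite-dimensional real vector spaces, given as types of
  class \<open>banach\<close> with a finite spanning set. Completeness and the choice of the norm are no
  restriction in finite dimension; unlike class \<open>euclidean_space\<close>, dimension 0 is allowed.\<close>

definition fin_dim :: "'a::real_vector itself \<Rightarrow> bool" where
  "fin_dim _ \<longleftrightarrow> (\<exists>S::'a set. finite S \<and> span S = UNIV)"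

primrec Ck_on :: "nat \<Rightarrow> 'a::real_normed_vector set \<Rightarrow> ('a \<Rightarrow> 'b::real_normed_vector) \<Rightarrow> bool" where
  "Ck_on 0 S f \<longleftrightarrow> continuous_on S f"
| "Ck_on (Suc k) S f \<longleftrightarrow> (\<forall>x\<in>S. f differentiable (at x)) \<and>
     (\<forall>v. Ck_on k S (\<lambda>x. frechet_derivative f (at x) v))"

text \<open>Only used for open \<open>S\<close> in a finite-dimensional space.\<close>

definition smooth_on :: "'a::real_normed_vector set \<Rightarrow> ('a \<Rightarrow> 'b::real_normed_vector) \<Rightarrow> bool" where
  "smooth_on S f \<longleftrightarrow> (\<forall>k. Ck_on k S f)"

text \<open>A chart is a pair of its domain and its coordinate map.\<close>

type_synonym ('m, 'e) chart = "'m set \<times> ('m \<Rightarrow> 'e)"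

definition chart_inv :: "('m, 'e) chart \<Rightarrow> 'e \<Rightarrow> 'm" where
  "chart_inv c = inv_into (fst c) (snd c)"

definition is_chart :: "('m::topological_space, 'e::topological_space) chart \<Rightarrow> bool" where
  "is_chart c \<longleftrightarrow> open (fst c) \<and> open (snd c ` fst c) \<and>
     homeomorphism (fst c) (snd c ` fst c) (snd c) (chart_inv c)"

definition transition :: "('m, 'e) chart \<Rightarrow> ('m, 'e) chart \<Rightarrow> 'e \<Rightarrow> 'e" where
  "transition c c' = snd c' \<circ> chart_inv c"

definition compatible :: "('m, 'e::real_normed_vector) chart \<Rightarrow> ('m, 'e) chart \<Rightarrow> bool" where
  "compatible c c' \<longleftrightarrow>
     smooth_on (snd c ` (fst c \<inter> fst c')) (transition c c') \<and>
     smooth_on (snd c' ` (fst c \<inter> fst c')) (transition c' c)"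

text \<open>The manifold is the whole type \<open>'m\<close>, equipped with a (not necessarily maximal) smooth atlas.\<close>

definition smooth_manifold ::
    "('m::{t2_space,second_countable_topology}, 'e::banach) chart set \<Rightarrow> bool" where
  "smooth_manifold \<A> \<longleftrightarrow> fin_dim TYPE('e) \<and> (\<forall>c\<in>\<A>. is_chart c) \<and>
     (\<forall>c\<in>\<A>. \<forall>c'\<in>\<A>. compatible c c') \<and> (\<Union>c\<in>\<A>. fst c) = UNIV"

definition charts_at :: "('m, 'e) chart set \<Rightarrow> 'm \<Rightarrow> ('m, 'e) chart set" where
  "charts_at \<A> p = {c\<in>\<A>. p \<in> fst c}"

definition chart_at :: "('m, 'e) chart set \<Rightarrow> 'm \<Rightarrow> ('m, 'e) chart" where
  "chart_at \<A> p = (SOME c. c \<in> charts_at \<A> p)"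

definition smooth_map ::
    "('m, 'e::real_normed_vector) chart set \<Rightarrow> 'm set \<Rightarrow> ('m \<Rightarrow> 'b::real_normed_vector) \<Rightarrow> bool" where
  "smooth_map \<A> W f \<longleftrightarrow> (\<forall>c\<in>\<A>. smooth_on (snd c ` (fst c \<inter> W)) (f \<circ> chart_inv c))"

definition open_cover :: "'i set \<Rightarrow> ('i \<Rightarrow> 'm::topological_space set) \<Rightarrow> bool" where
  "open_cover I U \<longleftrightarrow> (\<forall>i\<in>I. open (U i)) \<and> (\<Union>i\<in>I. U i) = UNIV"

text \<open>All nonempty finite intersections are diffeomorphic to the model space, i.e. they are the
  domain of a compatible chart onto it.\<close>

definition good_cover ::
    "('m::topological_space, 'e::real_normed_vector) chart set \<Rightarrow> 'i set \<Rightarrow> ('i \<Rightarrow> 'm set) \<Rightarrow> bool" where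
  "good_cover \<A> I U \<longleftrightarrow> open_cover I U \<and>
     (\<forall>J. J \<subseteq> I \<and> finite J \<and> J \<noteq> {} \<and> (\<Inter>j\<in>J. U j) \<noteq> {} \<longrightarrow>
        (\<exists>\<psi>. is_chart (\<Inter>j\<in>J. U j, \<psi>) \<and> \<psi> ` (\<Inter>j\<in>J. U j) = UNIV \<and>
             (\<forall>c\<in>\<A>. compatible c (\<Inter>j\<in>J. U j, \<psi>))))"

section \<open>Tangent vectors and vector fields\<close>

text \<open>A tangent vector at \<open>p\<close> is the family of its coordinate vectors in the charts around \<open>p\<close>,
  related by the derivatives of the coordinate changes (and 0 at all other charts).\<close>

type_synonym ('m, 'e) tvec = "('m, 'e) chart \<Rightarrow> 'e"

definition tangent_space ::
    "('m, 'e::real_normed_vector) chart set \<Rightarrow> 'm \<Rightarrow> ('m, 'e) tvec set" where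
  "tangent_space \<A> p = {v.
     (\<forall>c\<in>charts_at \<A> p. \<forall>c'\<in>charts_at \<A> p.
        v c' = frechet_derivative (transition c c') (at (snd c p)) (v c)) \<and>
     (\<forall>c. c \<notin> charts_at \<A> p \<longrightarrow> v c = 0)}"

text \<open>The tangent vector at \<open>p\<close> with coordinate vector \<open>e\<close> in the chart \<open>c\<close>.\<close>

definition tangent_of ::
    "('m, 'e::real_normed_vector) chart set \<Rightarrow> 'm \<Rightarrow> ('m, 'e) chart \<Rightarrow> 'e \<Rightarrow> ('m, 'e) tvec" where
  "tangent_of \<A> p c e =
     (\<lambda>c'. if c' \<in> charts_at \<A> p then frechet_derivative (transition c c') (at (snd c p)) e else 0)"

definition vfields ::
    "('m, 'e::real_normed_vector) chart set \<Rightarrow> 'm set \<Rightarrow> ('m \<Rightarrow> ('m, 'e) tvec) set" where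
  "vfields \<A> W = {X. (\<forall>p\<in>W. X p \<in> tangent_space \<A> p) \<and>
     (\<forall>c\<in>\<A>. smooth_on (snd c ` (fst c \<inter> W)) (\<lambda>x. X (chart_inv c x) c))}"

text \<open>\<open>vderiv \<A> p v f\<close> is the derivative \<open>v(f)\<close> of a vector-valued function \<open>f\<close> along a tangent
  vector \<open>v\<close> at \<open>p\<close>; it can be computed in any chart around \<open>p\<close>.\<close>

definition vderiv ::
    "('m, 'e::real_normed_vector) chart set \<Rightarrow> 'm \<Rightarrow> ('m, 'e) tvec \<Rightarrow>
     ('m \<Rightarrow> 'b::real_normed_vector) \<Rightarrow> 'b" where
  "vderiv \<A> p v f = (let c = chart_at \<A> p in
     frechet_derivative (f \<circ> chart_inv c) (at (snd c p)) (v c))"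

definition vf_bracket ::
    "('m, 'e::real_normed_vector) chart set \<Rightarrow> ('m \<Rightarrow> ('m, 'e) tvec) \<Rightarrow> ('m \<Rightarrow> ('m, 'e) tvec) \<Rightarrow>
     'm \<Rightarrow> ('m, 'e) tvec" where
  "vf_bracket \<A> X Y p = (\<lambda>c. if c \<in> charts_at \<A> p then
     frechet_derivative (\<lambda>x. Y (chart_inv c x) c) (at (snd c p)) (X p c) -
     frechet_derivative (\<lambda>x. X (chart_inv c x) c) (at (snd c p)) (Y p c) else 0)"

section \<open>Covariant tensor fields and differential forms\<close>

text \<open>A \<open>k\<close>-tensor field takes a point and a list of \<open>k\<close> tangent vectors there. A bundle map
  \<open>\<phi> : TW \<rightarrow> W \<times> \<gg>\<close> is the same as a \<open>\<gg>\<close>-valued 1-tensor \<open>\<phi> p [v]\<close>, a bundle map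
  \<open>\<beta> : TW \<rightarrow> T\<^sup>*W\<close> is the same as a real 2-tensor with \<open>\<beta> p [v, w]\<close> for \<open>\<beta>(v)(w)\<close>. With this
  convention a 2-form \<open>\<omega>\<close> is, as a tensor, equal to the bundle map \<open>X \<mapsto> \<iota>\<^sub>X \<omega>\<close>.\<close>

type_synonym ('m, 'e, 'b) tensor = "'m \<Rightarrow> ('m, 'e) tvec list \<Rightarrow> 'b"

definition components ::
    "('m, 'e::real_normed_vector) chart set \<Rightarrow> ('m, 'e) chart \<Rightarrow> ('m, 'e, 'b) tensor \<Rightarrow>
     'e \<Rightarrow> 'e list \<Rightarrow> 'b" where
  "components \<A> c \<omega> x es =
     \<omega> (chart_inv c x) (map (tangent_of \<A> (chart_inv c x) c) es)"

text \<open>Smooth \<open>k\<close>-tensor fields on the open set \<open>W\<close>, extended by 0 to all other arguments, so that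
  equality of tensor fields is equality of functions.\<close>

definition tensors ::
    "('m, 'e::real_normed_vector) chart set \<Rightarrow> nat \<Rightarrow> 'm set \<Rightarrow>
     ('m, 'e, 'b::real_normed_vector) tensor set" where
  "tensors \<A> k W = {\<omega>.
     (\<forall>c\<in>\<A>. \<forall>x\<in>snd c ` (fst c \<inter> W). \<forall>es. length es = k \<longrightarrow>
        (\<forall>i<k. linear (\<lambda>e. components \<A> c \<omega> x (es[i := e])))) \<and>
     (\<forall>c\<in>\<A>. \<forall>es. length es = k \<longrightarrow>
        smooth_on (snd c ` (fst c \<inter> W)) (\<lambda>x. components \<A> c \<omega> x es)) \<and>
     (\<forall>p vs. \<not> (p \<in> W \<and> length vs = k \<and> set vs \<subseteq> tangent_space \<A> p) \<longrightarrow> \<omega> p vs = 0)}"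

definition forms ::
    "('m, 'e::real_normed_vector) chart set \<Rightarrow> nat \<Rightarrow> 'm set \<Rightarrow>
     ('m, 'e, 'b::real_normed_vector) tensor set" where
  "forms \<A> k W = {\<omega> \<in> tensors \<A> k W. \<forall>p vs. \<not> distinct vs \<longrightarrow> \<omega> p vs = 0}"

definition res :: "'m set \<Rightarrow> ('m, 'e, 'b::zero) tensor \<Rightarrow> ('m, 'e, 'b) tensor" where
  "res W \<omega> = (\<lambda>p vs. if p \<in> W then \<omega> p vs else 0)"

text \<open>In local coordinates
  \<open>(d\<omega>)(v\<^sub>0,\<dots>,v\<^sub>k) = \<Sum>\<^sub>i (-1)\<^sup>i D\<omega>(v\<^sub>i)(v\<^sub>0,\<dots>,v\<^sub>k)\<close> with \<open>v\<^sub>i\<close> omitted from the last list; so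
  \<open>d\<theta>(X,Y) = X(\<theta>(Y)) - Y(\<theta>(X)) - \<theta>([X,Y])\<close>. If \<open>\<omega>\<close> is a form on \<open>W\<close>, then \<open>ext_d \<A> \<omega>\<close> is only
  meaningful at points of \<open>W\<close>.\<close>

definition ext_d ::
    "('m, 'e::real_normed_vector) chart set \<Rightarrow> ('m, 'e, 'b::real_normed_vector) tensor \<Rightarrow>
     ('m, 'e, 'b) tensor" where
  "ext_d \<A> \<omega> p vs = (if set vs \<subseteq> tangent_space \<A> p then
     let c = chart_at \<A> p in
       \<Sum>i<length vs. (-1) ^ i *\<^sub>R
         frechet_derivative
           (\<lambda>x. components \<A> c \<omega> x (map (\<lambda>v. v c) (take i vs @ drop (Suc i) vs)))
           (at (snd c p)) ((vs ! i) c)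
     else 0)"

text \<open>Wedge product of a \<open>k\<close>-form and an \<open>l\<close>-form, combined with a bilinear map \<open>b\<close> of the values,
  normalised so that \<open>(\<alpha> \<and> \<beta>)(X,Y) = b (\<alpha>(X)) (\<beta>(Y)) - b (\<alpha>(Y)) (\<beta>(X))\<close> for 1-forms.\<close>

definition wedge ::
    "('b \<Rightarrow> 'c \<Rightarrow> 'd::real_vector) \<Rightarrow> nat \<Rightarrow> nat \<Rightarrow> ('m, 'e, 'b) tensor \<Rightarrow> ('m, 'e, 'c) tensor \<Rightarrow>
     ('m, 'e, 'd) tensor" where
  "wedge b k l \<alpha> \<beta> p vs = (if length vs = k + l then
     (1 / (fact k * fact l)) *\<^sub>R
       (\<Sum>\<sigma> | \<sigma> permutes {..<k + l}. of_int (sign \<sigma>) *\<^sub>R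
          b (\<alpha> p (map (\<lambda>i. vs ! \<sigma> i) [0..<k])) (\<beta> p (map (\<lambda>i. vs ! \<sigma> i) [k..<k + l])))
     else 0)"

definition contract ::
    "('m \<Rightarrow> ('m, 'e) tvec) \<Rightarrow> ('m, 'e, 'b) tensor \<Rightarrow> ('m, 'e, 'b) tensor" where
  "contract X \<omega> = (\<lambda>p vs. \<omega> p (X p # vs))"

text \<open>Lie derivative of differential forms, by Cartan's formula.\<close>

definition lie_deriv ::
    "('m, 'e::real_normed_vector) chart set \<Rightarrow> ('m \<Rightarrow> ('m, 'e) tvec) \<Rightarrow>
     ('m, 'e, 'b::real_normed_vector) tensor \<Rightarrow> ('m, 'e, 'b) tensor" where
  "lie_deriv \<A> X \<omega> = ext_d \<A> (contract X \<omega>) + contract X (ext_d \<A> \<omega>)"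

section \<open>Quadratic Lie algebras\<close>

definition quadratic_lie_algebra ::
    "('g::banach \<Rightarrow> 'g \<Rightarrow> 'g) \<Rightarrow> ('g \<Rightarrow> 'g \<Rightarrow> real) \<Rightarrow> bool" where
  "quadratic_lie_algebra br pr \<longleftrightarrow> fin_dim TYPE('g) \<and>
     bilinear br \<and> (\<forall>x. br x x = 0) \<and>
     (\<forall>x y z. br x (br y z) + br y (br z x) + br z (br x y) = 0) \<and>
     bilinear pr \<and> (\<forall>x y. pr x y = pr y x) \<and>
     (\<forall>x y z. pr (br x y) z + pr y (br x z) = 0) \<and>
     (\<forall>x. (\<forall>y. pr x y = 0) \<longrightarrow> x = 0)"

text \<open>Automorphisms of the quadratic Lie algebra, i.e. orthogonal Lie algebra automorphisms. Without
  orthogonality the forms \<open>(R\<^sub>i, R\<^sub>i)\<close> of transitive Lie data would not agree on overlaps.\<close>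

definition quad_aut ::
    "('g::real_vector \<Rightarrow> 'g \<Rightarrow> 'g) \<Rightarrow> ('g \<Rightarrow> 'g \<Rightarrow> real) \<Rightarrow> ('g \<Rightarrow> 'g) \<Rightarrow> bool" where
  "quad_aut br pr t \<longleftrightarrow> linear t \<and> bij t \<and> (\<forall>x y. t (br x y) = br (t x) (t y)) \<and>
     (\<forall>x y. pr (t x) (t y) = pr x y)"

definition aut_field ::
    "('m, 'e::real_normed_vector) chart set \<Rightarrow> ('g::real_normed_vector \<Rightarrow> 'g \<Rightarrow> 'g) \<Rightarrow>
     ('g \<Rightarrow> 'g \<Rightarrow> real) \<Rightarrow> 'm set \<Rightarrow> ('m \<Rightarrow> 'g \<Rightarrow> 'g) \<Rightarrow> bool" where
  "aut_field \<A> br pr W \<tau> \<longleftrightarrow>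
     (\<forall>p\<in>W. quad_aut br pr (\<tau> p)) \<and> (\<forall>a. smooth_map \<A> W (\<lambda>p. \<tau> p a))"

text \<open>\<open>\<tau>(X(b)) - X(\<tau>(b)) - [\<phi>(X), \<tau>(b)] = 0\<close> on \<open>W\<close>.\<close>

definition connection_compat ::
    "('m, 'e::real_normed_vector) chart set \<Rightarrow> ('g::real_normed_vector \<Rightarrow> 'g \<Rightarrow> 'g) \<Rightarrow> 'm set \<Rightarrow>
     ('m, 'e, 'g) tensor \<Rightarrow> ('m \<Rightarrow> 'g \<Rightarrow> 'g) \<Rightarrow> bool" where
  "connection_compat \<A> br W \<phi> \<tau> \<longleftrightarrow>
     (\<forall>X\<in>vfields \<A> W. \<forall>b. smooth_map \<A> W b \<longrightarrow> (\<forall>p\<in>W.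
        \<tau> p (vderiv \<A> p (X p) b) - vderiv \<A> p (X p) (\<lambda>q. \<tau> q (b q)) -
        br (\<phi> p [X p]) (\<tau> p (b p)) = 0))"

section \<open>Transitive Lie data\<close>

record ('i, 'm, 'e, 'g) lie_data =
  idx :: "'i set"
  cov :: "'i \<Rightarrow> 'm set"
  conn :: "'i \<Rightarrow> ('m, 'e, 'g) tensor"  \<comment> \<open>\<open>\<theta>\<^sub>i\<close>\<close>
  phi :: "'i \<Rightarrow> 'i \<Rightarrow> ('m, 'e, 'g) tensor"
  tau :: "'i \<Rightarrow> 'i \<Rightarrow> 'm \<Rightarrow> 'g \<Rightarrow> 'g"

definition is_lie_data ::
    "('m::topological_space, 'e::real_normed_vector) chart set \<Rightarrow>
     ('g::real_normed_vector \<Rightarrow> 'g \<Rightarrow> 'g) \<Rightarrow> ('g \<Rightarrow> 'g \<Rightarrow> real) \<Rightarrow>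
     ('i, 'm, 'e, 'g) lie_data \<Rightarrow> bool" where
  "is_lie_data \<A> br pr A \<longleftrightarrow>
     open_cover (idx A) (cov A) \<and>
     (\<forall>i\<in>idx A. conn A i \<in> forms \<A> 1 (cov A i)) \<and>
     (\<forall>i\<in>idx A. \<forall>j\<in>idx A. let W = cov A i \<inter> cov A j in
        phi A i j \<in> forms \<A> 1 W \<and>
        aut_field \<A> br pr W (tau A i j) \<and>
        (\<forall>X\<in>vfields \<A> W. \<forall>Y\<in>vfields \<A> W. \<forall>p\<in>W.
           phi A i j p [vf_bracket \<A> X Y p] =
             vderiv \<A> p (X p) (\<lambda>q. phi A i j q [Y q]) - vderiv \<A> p (Y p) (\<lambda>q. phi A i j q [X q]) +
             br (phi A i j p [X p]) (phi A i j p [Y p])) \<and>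
        connection_compat \<A> br W (phi A i j) (tau A i j) \<and>
        (\<forall>p\<in>W. \<forall>v\<in>tangent_space \<A> p.
           conn A i p [v] - tau A i j p (conn A j p [v]) = phi A i j p [v])) \<and>
     (\<forall>i\<in>idx A. \<forall>j\<in>idx A. \<forall>k\<in>idx A. \<forall>p \<in> cov A i \<inter> cov A j \<inter> cov A k.
        (\<forall>v\<in>tangent_space \<A> p.
           phi A i j p [v] + tau A i j p (phi A j k p [v]) = phi A i k p [v]) \<and>
        tau A i j p \<circ> tau A j k p = tau A i k p)"

definition curvature ::
    "('m, 'e::real_normed_vector) chart set \<Rightarrow> ('g::real_normed_vector \<Rightarrow> 'g \<Rightarrow> 'g) \<Rightarrow>
     ('m, 'e, 'g) tensor \<Rightarrow> ('m, 'e, 'g) tensor" where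
  "curvature \<A> br \<theta> = (\<lambda>p vs. ext_d \<A> \<theta> p vs + (1/2) *\<^sub>R wedge br 1 1 \<theta> \<theta> p vs)"

text \<open>The 4-form \<open>(R, R)\<close> glued from the forms \<open>(R\<^sub>i, R\<^sub>i)\<close>, which agree on overlaps.\<close>

definition first_pontryagin ::
    "('m, 'e::real_normed_vector) chart set \<Rightarrow> ('g::real_normed_vector \<Rightarrow> 'g \<Rightarrow> 'g) \<Rightarrow>
     ('g \<Rightarrow> 'g \<Rightarrow> real) \<Rightarrow> ('i, 'm, 'e, 'g) lie_data \<Rightarrow> ('m, 'e, real) tensor" where
  "first_pontryagin \<A> br pr A p = (let i = SOME i. i \<in> idx A \<and> p \<in> cov A i; R = curvature \<A> br (conn A i)
     in wedge pr 2 2 R R p)"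

definition p1_vanishes ::
    "('m, 'e::real_normed_vector) chart set \<Rightarrow> ('g::real_normed_vector \<Rightarrow> 'g \<Rightarrow> 'g) \<Rightarrow>
     ('g \<Rightarrow> 'g \<Rightarrow> real) \<Rightarrow> ('i, 'm, 'e, 'g) lie_data \<Rightarrow> bool" where
  "p1_vanishes \<A> br pr A \<longleftrightarrow> (\<exists>H\<in>forms \<A> 3 UNIV. first_pontryagin \<A> br pr A = ext_d \<A> H)"

section \<open>Automorphisms of the standard transitive Courant algebroid\<close>

text \<open>The triple \<open>(\<phi>, \<tau>, \<beta>)\<close> stands for the matrix with rows \<open>(1, 0, 0)\<close>, \<open>(\<phi>, \<tau>, 0)\<close>,
  \<open>(\<beta>, -2 \<phi>\<^sup>\<star>\<tau>, 1)\<close>.\<close>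

type_synonym ('m, 'e, 'g) courant_mat =
  "('m, 'e, 'g) tensor \<times> ('m \<Rightarrow> 'g \<Rightarrow> 'g) \<times> ('m, 'e, real) tensor"

text \<open>The action of the matrix on the fibre at \<open>p\<close>. Multiplication of matrices is expressed as
  composition of these maps.\<close>

fun mat_apply ::
    "('g \<Rightarrow> 'g \<Rightarrow> real) \<Rightarrow> ('m, 'e, 'g::real_vector) courant_mat \<Rightarrow> 'm \<Rightarrow>
     ('m, 'e) tvec \<times> 'g \<times> (('m, 'e) tvec \<Rightarrow> real) \<Rightarrow>
     ('m, 'e) tvec \<times> 'g \<times> (('m, 'e) tvec \<Rightarrow> real)" where
  "mat_apply pr (\<phi>, \<tau>, \<beta>) p (v, a, \<xi>) =
     (v, \<phi> p [v] + \<tau> p a, \<lambda>w. \<beta> p [v, w] - 2 * pr (\<tau> p a) (\<phi> p [w]) + \<xi> w)"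

text \<open>\<open>\<P>(a,b)(Y) = 2 (b, Y(a))\<close>\<close>

definition P_form ::
    "('m, 'e::real_normed_vector) chart set \<Rightarrow> ('g::real_normed_vector \<Rightarrow> 'g \<Rightarrow> real) \<Rightarrow>
     ('m \<Rightarrow> 'g) \<Rightarrow> ('m \<Rightarrow> 'g) \<Rightarrow> 'm \<Rightarrow> ('m, 'e) tvec \<Rightarrow> real" where
  "P_form \<A> pr a b p v = 2 * pr (b p) (vderiv \<A> p v a)"

fun courant_aut ::
    "('m, 'e::real_normed_vector) chart set \<Rightarrow> ('g::real_normed_vector \<Rightarrow> 'g \<Rightarrow> 'g) \<Rightarrow>
     ('g \<Rightarrow> 'g \<Rightarrow> real) \<Rightarrow> 'm set \<Rightarrow> ('m, 'e, 'g) courant_mat \<Rightarrow> bool" where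
  "courant_aut \<A> br pr W (\<phi>, \<tau>, \<beta>) \<longleftrightarrow>
     \<phi> \<in> tensors \<A> 1 W \<and> \<beta> \<in> tensors \<A> 2 W \<and> aut_field \<A> br pr W \<tau> \<and>
     (\<forall>p\<in>W. \<forall>v\<in>tangent_space \<A> p. \<forall>w\<in>tangent_space \<A> p.
        (1/2) * (\<beta> p [v, w] + \<beta> p [w, v]) + pr (\<phi> p [v]) (\<phi> p [w]) = 0) \<and>
     connection_compat \<A> br W \<phi> \<tau> \<and>
     (\<forall>p\<in>W. \<forall>v\<in>tangent_space \<A> p. \<forall>w\<in>tangent_space \<A> p.
        ext_d \<A> \<phi> p [v, w] + (1/2) *\<^sub>R wedge br 1 1 \<phi> \<phi> p [v, w] = 0) \<and>
     (\<forall>X\<in>vfields \<A> W. \<forall>Y\<in>vfields \<A> W. \<forall>p\<in>W. \<forall>w\<in>tangent_space \<A> p.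
        lie_deriv \<A> X (contract Y \<beta>) p [w] - contract Y (ext_d \<A> (contract X \<beta>)) p [w] -
        contract (vf_bracket \<A> X Y) \<beta> p [w] +
        P_form \<A> pr (\<lambda>q. \<phi> q [X q]) (\<lambda>q. \<phi> q [Y q]) p w = 0)"

section \<open>Transitive Courant data\<close>

definition cs3 ::
    "('m, 'e::real_normed_vector) chart set \<Rightarrow> ('g::real_normed_vector \<Rightarrow> 'g \<Rightarrow> 'g) \<Rightarrow>
     ('g \<Rightarrow> 'g \<Rightarrow> real) \<Rightarrow> ('m, 'e, 'g) tensor \<Rightarrow> ('m, 'e, real) tensor" where
  "cs3 \<A> br pr \<theta> = (\<lambda>p vs. wedge pr 1 2 \<theta> (ext_d \<A> \<theta>) p vs +
     (1/3) * wedge pr 1 2 \<theta> (wedge br 1 1 \<theta> \<theta>) p vs)"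

text \<open>\<open>\<Lambda>\<close> is a 1-morphism from \<open>(\<theta>', B')\<close> to \<open>(\<theta>, B)\<close> in the local groupoid over \<open>W\<close>.\<close>

fun local_mor ::
    "('m, 'e::real_normed_vector) chart set \<Rightarrow> ('g::real_normed_vector \<Rightarrow> 'g \<Rightarrow> 'g) \<Rightarrow>
     ('g \<Rightarrow> 'g \<Rightarrow> real) \<Rightarrow> 'm set \<Rightarrow>
     ('m, 'e, 'g) tensor \<times> ('m, 'e, real) tensor \<Rightarrow> ('m, 'e, 'g) courant_mat \<Rightarrow>
     ('m, 'e, 'g) tensor \<times> ('m, 'e, real) tensor \<Rightarrow> bool" where
  "local_mor \<A> br pr W (\<theta>', B') (\<phi>, \<tau>, \<beta>) (\<theta>, B) \<longleftrightarrow>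
     courant_aut \<A> br pr W (\<phi>, \<tau>, \<beta>) \<and>
     (\<forall>p\<in>W. \<forall>v\<in>tangent_space \<A> p. \<theta> p [v] = \<tau> p (\<theta>' p [v]) + \<phi> p [v]) \<and>
     (\<forall>p\<in>W. \<forall>v\<in>tangent_space \<A> p. \<forall>w\<in>tangent_space \<A> p.
        (B' - B) p [v, w] =
          \<beta> p [v, w] + pr (\<theta> p [w]) (\<theta> p [v]) - pr (\<theta>' p [w]) (\<theta>' p [v]) -
          2 * pr (\<tau> p (\<theta>' p [v])) (\<phi> p [w])) \<and>
     (\<forall>p\<in>W. (cs3 \<A> br pr \<theta>' - cs3 \<A> br pr \<theta>) p = ext_d \<A> (B' - B) p)"

record ('i, 'm, 'e, 'g) courant_data = "('i, 'm, 'e, 'g) lie_data" +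
  bfield :: "'i \<Rightarrow> ('m, 'e, real) tensor"
  beta :: "'i \<Rightarrow> 'i \<Rightarrow> ('m, 'e, real) tensor"

definition trans_mat ::
    "('i, 'm, 'e, 'g) courant_data \<Rightarrow> 'i \<Rightarrow> 'i \<Rightarrow> ('m, 'e, 'g) courant_mat" where
  "trans_mat C i j = (phi C i j, tau C i j, beta C i j)"

definition is_courant_data ::
    "('m::topological_space, 'e::real_normed_vector) chart set \<Rightarrow>
     ('g::real_normed_vector \<Rightarrow> 'g \<Rightarrow> 'g) \<Rightarrow> ('g \<Rightarrow> 'g \<Rightarrow> real) \<Rightarrow>
     ('i, 'm, 'e, 'g) courant_data \<Rightarrow> bool" where
  "is_courant_data \<A> br pr C \<longleftrightarrow>
     open_cover (idx C) (cov C) \<and>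
     (\<forall>i\<in>idx C. conn C i \<in> forms \<A> 1 (cov C i) \<and> bfield C i \<in> forms \<A> 2 (cov C i)) \<and>
     (\<forall>i\<in>idx C. \<forall>j\<in>idx C. let W = cov C i \<inter> cov C j in
        local_mor \<A> br pr W (res W (conn C j), res W (bfield C j)) (trans_mat C i j)
          (res W (conn C i), res W (bfield C i))) \<and>
     (\<forall>i\<in>idx C. \<forall>j\<in>idx C. \<forall>k\<in>idx C. \<forall>p \<in> cov C i \<inter> cov C j \<inter> cov C k.
        mat_apply pr (trans_mat C i j) p \<circ> mat_apply pr (trans_mat C j k) p =
        mat_apply pr (trans_mat C i k) p)"

text \<open>1-morphisms between Courant data over the same cover.\<close>

definition courant_data_mor ::
    "('m, 'e::real_normed_vector) chart set \<Rightarrow>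
     ('g::real_normed_vector \<Rightarrow> 'g \<Rightarrow> 'g) \<Rightarrow> ('g \<Rightarrow> 'g \<Rightarrow> real) \<Rightarrow>
     ('i, 'm, 'e, 'g) courant_data \<Rightarrow> ('i \<Rightarrow> ('m, 'e, 'g) courant_mat) \<Rightarrow>
     ('i, 'm, 'e, 'g) courant_data \<Rightarrow> bool" where
  "courant_data_mor \<A> br pr C' L C \<longleftrightarrow>
     idx C' = idx C \<and> (\<forall>i\<in>idx C. cov C' i = cov C i) \<and>
     (\<forall>i\<in>idx C. local_mor \<A> br pr (cov C i) (conn C' i, bfield C' i) (L i) (conn C i, bfield C i)) \<and>
     (\<forall>i\<in>idx C. \<forall>j\<in>idx C. \<forall>p \<in> cov C i \<inter> cov C j.
        mat_apply pr (trans_mat C i j) p \<circ> mat_apply pr (L j) p =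
        mat_apply pr (L i) p \<circ> mat_apply pr (trans_mat C' i j) p)"

text \<open>Restriction of Courant data to a refinement \<open>V a \<subseteq> cov C (\<rho> a)\<close>, \<open>a \<in> K\<close>, of its cover.\<close>

definition refine_data ::
    "'k set \<Rightarrow> ('k \<Rightarrow> 'm set) \<Rightarrow> ('k \<Rightarrow> 'i) \<Rightarrow> ('i, 'm, 'e, 'g::zero) courant_data \<Rightarrow>
     ('k, 'm, 'e, 'g) courant_data" where
  "refine_data K V \<rho> C = \<lparr>idx = K, cov = V,
     conn = (\<lambda>a. res (V a) (conn C (\<rho> a))),
     phi = (\<lambda>a b. res (V a \<inter> V b) (phi C (\<rho> a) (\<rho> b))),
     tau = (\<lambda>a b. tau C (\<rho> a) (\<rho> b)),
     bfield = (\<lambda>a. res (V a) (bfield C (\<rho> a))),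
     beta = (\<lambda>a b. res (V a \<inter> V b) (beta C (\<rho> a) (\<rho> b)))\<rparr>"

section \<open>Lifts\<close>

definition lifts ::
    "('m::topological_space, 'e::real_normed_vector) chart set \<Rightarrow>
     ('g::real_normed_vector \<Rightarrow> 'g \<Rightarrow> 'g) \<Rightarrow> ('g \<Rightarrow> 'g \<Rightarrow> real) \<Rightarrow>
     ('i, 'm, 'e, 'g) lie_data \<Rightarrow> ('i, 'm, 'e, 'g) courant_data set" where
  "lifts \<A> br pr A = {C. is_courant_data \<A> br pr C \<and> lie_data.truncate C = A}"

text \<open>Isomorphism in the fibre category over the common Lie data of \<open>C'\<close> and \<open>C\<close>: a 1-morphism
  over some refinement of the cover (all 1-morphisms are invertible) that projects to the identity,
  \<open>\<phi>\<^sub>a = 0\<close> and \<open>\<tau>\<^sub>a = id\<close>. The members of a refinement can always be indexed by pairs of an index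
  \<open>\<rho> a\<close> and an open set, whence the type of \<open>K\<close>.\<close>

definition fibre_iso ::
    "('m::topological_space, 'e::real_normed_vector) chart set \<Rightarrow>
     ('g::real_normed_vector \<Rightarrow> 'g \<Rightarrow> 'g) \<Rightarrow> ('g \<Rightarrow> 'g \<Rightarrow> real) \<Rightarrow>
     ('i, 'm, 'e, 'g) courant_data \<Rightarrow> ('i, 'm, 'e, 'g) courant_data \<Rightarrow> bool" where
  "fibre_iso \<A> br pr C' C \<longleftrightarrow>
     (\<exists>(K :: ('i \<times> 'm set) set) V \<rho> L.
        open_cover K V \<and> (\<forall>a\<in>K. \<rho> a \<in> idx C \<and> V a \<subseteq> cov C (\<rho> a)) \<and>
        courant_data_mor \<A> br pr (refine_data K V \<rho> C') L (refine_data K V \<rho> C) \<and>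
        (\<forall>a\<in>K. \<forall>p\<in>V a. (\<forall>v\<in>tangent_space \<A> p. fst (L a) p [v] = 0) \<and> fst (snd (L a)) p = id))"

definition iso_rel ::
    "('m::topological_space, 'e::real_normed_vector) chart set \<Rightarrow>
     ('g::real_normed_vector \<Rightarrow> 'g \<Rightarrow> 'g) \<Rightarrow> ('g \<Rightarrow> 'g \<Rightarrow> real) \<Rightarrow>
     ('i, 'm, 'e, 'g) lie_data \<Rightarrow> ('i, 'm, 'e, 'g) courant_data rel" where
  "iso_rel \<A> br pr A =
     {(C', C). C' \<in> lifts \<A> br pr A \<and> C \<in> lifts \<A> br pr A \<and> fibre_iso \<A> br pr C' C}"

definition lift_classes ::
    "('m::topological_space, 'e::real_normed_vector) chart set \<Rightarrow>
     ('g::real_normed_vector \<Rightarrow> 'g \<Rightarrow> 'g) \<Rightarrow> ('g \<Rightarrow> 'g \<Rightarrow> real) \<Rightarrow>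
     ('i, 'm, 'e, 'g) lie_data \<Rightarrow> ('i, 'm, 'e, 'g) courant_data set set" where
  "lift_classes \<A> br pr A = lifts \<A> br pr A // iso_rel \<A> br pr A"

section \<open>The action of closed 3-forms\<close>

definition closed_3_forms ::
    "('m, 'e::real_normed_vector) chart set \<Rightarrow> ('m, 'e, real) tensor monoid" where
  "closed_3_forms \<A> =
     \<lparr>carrier = {h \<in> forms \<A> 3 UNIV. ext_d \<A> h = 0}, mult = (+), one = 0\<rparr>"

definition shift ::
    "('i \<Rightarrow> ('m, 'e, real) tensor) \<Rightarrow> ('i, 'm, 'e, 'g) courant_data \<Rightarrow>
     ('i, 'm, 'e, 'g) courant_data" where
  "shift b C = C\<lparr>bfield := (\<lambda>i. bfield C i + b i),
     beta := (\<lambda>i j. beta C i j + res (cov C i \<inter> cov C j) (b j - b i))\<rparr>"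

text \<open>The action collects the lifts isomorphic to \<open>shift b C\<close> for all representatives \<open>C\<close> of the
  class and all primitives \<open>b\<close> of \<open>h\<close>. That the result is again a single isomorphism class (required
  by \<open>torsor\<close> below) therefore expresses that primitives exist and that the choices do not matter.\<close>

definition act ::
    "('m::topological_space, 'e::real_normed_vector) chart set \<Rightarrow>
     ('g::real_normed_vector \<Rightarrow> 'g \<Rightarrow> 'g) \<Rightarrow> ('g \<Rightarrow> 'g \<Rightarrow> real) \<Rightarrow>
     ('i, 'm, 'e, 'g) lie_data \<Rightarrow> ('m, 'e, real) tensor \<Rightarrow>
     ('i, 'm, 'e, 'g) courant_data set \<Rightarrow> ('i, 'm, 'e, 'g) courant_data set" where
  "act \<A> br pr A h = restrict (\<lambda>\<C>. {C'. \<exists>C\<in>\<C>. \<exists>b.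
       (\<forall>i\<in>idx A. b i \<in> forms \<A> 2 (cov A i) \<and> (\<forall>p\<in>cov A i. ext_d \<A> (b i) p = h p)) \<and>
       (shift b C, C') \<in> iso_rel \<A> br pr A})
     (lift_classes \<A> br pr A)"

definition torsor :: "('a, 'r) monoid_scheme \<Rightarrow> 's set \<Rightarrow> ('a \<Rightarrow> 's \<Rightarrow> 's) \<Rightarrow> bool" where
  "torsor G E f \<longleftrightarrow> group_action G E f \<and> E \<noteq> {} \<and>
     (\<forall>x\<in>E. \<forall>y\<in>E. \<exists>!g. g \<in> carrier G \<and> f g x = y)"

end

theory Submission
  imports Defs
begin

text \<open>The component \<open>\<beta>\<close> of a 1-morphism is determined by the other components and the 2-forms at both
  ends, so a lift of the Lie data amounts to 2-forms \<open>B\<^sub>i\<close> for which the forms \<open>cs\<^sub>3(\<theta>\<^sub>i) - dB\<^sub>i\<close> agree on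
  overlaps; that the resulting \<open>\<beta>\<^sub>i\<^sub>j\<close> satisfies the bracket axiom of a Courant automorphism is the
  transformation law of the Chern-Simons form under gauge transformations. The glued 3-form \<open>H\<close>
  satisfies \<open>dH = (R, R)\<close> because \<open>d cs\<^sub>3(\<theta>) = (R, R)\<close>. Conversely, if \<open>dH = (R, R)\<close>, then the forms
  \<open>cs\<^sub>3(\<theta>\<^sub>i) - H\<close> are closed, and the Poincare lemma on the members of the good cover provides the \<open>B\<^sub>i\<close>.
  An isomorphism of lifts over the identity of the Lie data exists if and only if the differences
  \<open>B'\<^sub>i - B\<^sub>i\<close> are closed, that is, if and only if both lifts have the same \<open>H\<close>. So the classes of lifts
  correspond to the solutions of \<open>dH = (R, R)\<close>, and a closed 3-form \<open>h\<close> acts by \<open>H \<mapsto> H - h\<close>.\<close>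

section \<open>Calculus in finite-dimensional spaces\<close>

text \<open>The formula that determines \<beta> has a hidden shape: if \<open>E(\<theta>, B)\<close>
  is the matrix of the triple \<open>(\<theta>, id, - B - (\<theta>, \<theta>))\<close>, then the
  matrix of a 1-morphism from \<open>(\<theta>', B')\<close> to \<open>(\<theta>, B)\<close> with
  given \<tau> is \<open>E(\<theta>, B) (0, \<tau>, 0) E(\<theta>', B')\<^sup>-\<^sup>1\<close>.
  This is why the cocycle condition for the matrices puts no constraint on the 2-forms. The obstacle
  is the bracket axiom, which speaks of arbitrary vector fields: their derivatives have to cancel
  before it becomes a pointwise identity between the values and first derivatives of \<theta>',
  \<phi> and \<open>B' - B\<close>. Orthogonality of \<tau> then allows the Chern-Simons forms of
  \<theta> and \<theta>' to be compared in one copy of the Lie algebra. The good cover is used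
  twice: for the primitives \<open>B\<^sub>i\<close>, and for coordinate vector fields on the
  overlaps that turn the conditions on \<phi> and \<tau> into pointwise ones.\<close>

abbreviation fderiv :: "('a::real_normed_vector \<Rightarrow> 'b::real_normed_vector) \<Rightarrow> 'a \<Rightarrow> 'a \<Rightarrow> 'b" where
  "fderiv f x \<equiv> frechet_derivative f (at x)"

lemma has_fderiv: "f differentiable (at x) \<Longrightarrow> (f has_derivative fderiv f x) (at x)"
  using frechet_derivative_works by blast

lemma fderiv_eq: "(f has_derivative f') (at x) \<Longrightarrow> fderiv f x v = f' v"
  using frechet_derivative_at by metis

lemma fderiv_cong_open:
  assumes "open S" "x \<in> S" "\<And>y. y \<in> S \<Longrightarrow> f y = g y"
  shows "fderiv f x = fderiv g x"
proof -
  have "(f has_derivative f') (at x) \<longleftrightarrow> (g has_derivative f') (at x)" for f'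
    using assms has_derivative_transform_within_open[of f f' x UNIV S g]
      has_derivative_transform_within_open[of g f' x UNIV S f] by auto
  then show ?thesis unfolding frechet_derivative_def by simp
qed

lemma differentiable_cong_open:
  assumes "open S" "x \<in> S" "\<And>y. y \<in> S \<Longrightarrow> f y = g y"
  shows "f differentiable (at x) \<longleftrightarrow> g differentiable (at x)"
  unfolding differentiable_def
  using assms has_derivative_transform_within_open[of f _ x UNIV S g]
      has_derivative_transform_within_open[of g _ x UNIV S f] by auto

text \<open>Induction on the set. The bound for \<open>B\<close> makes \<open>span B\<close> closed,
  because the coefficients of a convergent sequence are Cauchy; hence a new independent vector
  \<open>a\<close> keeps a positive distance from \<open>span B\<close>, and that distance controls
  its coefficient.\<close>

lemma independent_coefficients_bounded:
  fixes B :: "'a::real_normed_vector set"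
  assumes "finite B" "independent B"
  shows "\<exists>C. \<forall>u. \<forall>b\<in>B. \<bar>u b\<bar> \<le> C * norm (\<Sum>b\<in>B. u b *\<^sub>R b)"
  using assms
proof (induction B rule: finite_induct)
  case empty
  then show ?case by simp
next
  case (insert a B)
  have ind: "independent B" and aB: "a \<notin> span B"
    using insert.prems insert.hyps by (simp_all add: independent_insert)
  obtain C0 where C0: "\<And>u b. b \<in> B \<Longrightarrow> \<bar>u b\<bar> \<le> C0 * norm (\<Sum>b\<in>B. u b *\<^sub>R b)"
    using insert.IH[OF ind] by blast
  \<comment> \<open>For empty \<open>B\<close> the induction hypothesis says nothing about the sign
    of \<open>C0\<close>.\<close>
  define C where "C = max C0 0"
  have C: "\<bar>u b\<bar> \<le> C * norm (\<Sum>b\<in>B. u b *\<^sub>R b)" if "b \<in> B" for u b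
    by (rule order_trans[OF C0[OF that]]) (auto simp: C_def intro!: mult_right_mono)
  have C_nonneg: "C \<ge> 0" by (simp add: C_def)
  have "closed (span B)"
    unfolding closed_sequential_limits
  proof (intro allI impI, elim conjE)
    fix s l assume s: "\<forall>n. s n \<in> span B" and sl: "s \<longlonglongrightarrow> l"
    define u where "u n = representation B (s n)" for n
    have rep: "(\<Sum>b\<in>B. u n b *\<^sub>R b) = s n" for n
      unfolding u_def using s ind insert.hyps by (intro real_vector.sum_representation_eq) auto
    have "Cauchy (\<lambda>n. u n b)" if b: "b \<in> B" for b
    proof (rule metric_CauchyI)
      fix e :: real assume e: "e > 0"
      have "Cauchy s" using sl LIMSEQ_imp_Cauchy by blast
      then obtain M where M: "\<And>m n. m \<ge> M \<Longrightarrow> n \<ge> M \<Longrightarrow> dist (s m) (s n) < e / (C + 1)"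
        using metric_CauchyD[of s "e / (C+1)"] e C_nonneg by (metis add_nonneg_pos divide_pos_pos zero_less_one)
      have "dist (u m b) (u n b) < e" if "m \<ge> M" "n \<ge> M" for m n
      proof -
        have "\<bar>u m b - u n b\<bar> \<le> C * norm (\<Sum>b\<in>B. (u m b - u n b) *\<^sub>R b)"
          using C[OF b, of "\<lambda>b. u m b - u n b"] by simp
        also have "(\<Sum>b\<in>B. (u m b - u n b) *\<^sub>R b) = s m - s n"
          by (simp add: scaleR_left_diff_distrib sum_subtractf rep)
        also have "C * norm (s m - s n) \<le> C * (e / (C + 1))"
          using M[OF that] C_nonneg by (intro mult_left_mono) (auto simp: dist_norm)
        also have "\<dots> < e" using e C_nonneg by (simp add: field_simps)
        finally show ?thesis by (simp add: dist_norm)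
      qed
      then show "\<exists>M. \<forall>m\<ge>M. \<forall>n\<ge>M. dist (u m b) (u n b) < e" by blast
    qed
    then have "\<exists>r. (\<lambda>n. u n b) \<longlonglongrightarrow> r" if "b \<in> B" for b
      using that Cauchy_convergent convergent_def by blast
    then obtain r where r: "\<And>b. b \<in> B \<Longrightarrow> (\<lambda>n. u n b) \<longlonglongrightarrow> r b" by metis
    have "(\<lambda>n. \<Sum>b\<in>B. u n b *\<^sub>R b) \<longlonglongrightarrow> (\<Sum>b\<in>B. r b *\<^sub>R b)"
      by (intro tendsto_sum tendsto_scaleR r tendsto_const)
    then have "s \<longlonglongrightarrow> (\<Sum>b\<in>B. r b *\<^sub>R b)" by (simp add: rep)
    then have "l = (\<Sum>b\<in>B. r b *\<^sub>R b)" using sl LIMSEQ_unique by blast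
    then show "l \<in> span B" by (simp add: span_base span_scale span_sum)
  qed
  then have "open (- span B)" by (simp add: open_Compl)
  with aB obtain e where e: "e > 0" "ball a e \<subseteq> - span B"
    by (metis ComplI open_contains_ball_eq)
  have far: "norm (a + s) \<ge> e" if "s \<in> span B" for s
  proof (rule ccontr)
    assume "\<not> norm (a + s) \<ge> e"
    then have "- s \<in> ball a e" by (simp add: dist_norm)
    then show False using e that span_neg by blast
  qed
  \<comment> \<open>The summand \<open>1 / e\<close> serves the coefficient of \<open>a\<close>. The
    other one serves the remaining coefficients through their partial sum \<open>s\<close>, whose
    norm exceeds that of the full sum by at most \<open>\<bar>u a\<bar> * norm a\<close>.\<close>
  have "\<bar>u b\<bar> \<le> (1 / e + C * (1 + norm a / e)) * norm (\<Sum>b\<in>insert a B. u b *\<^sub>R b)"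
    if b: "b \<in> insert a B" for u b
  proof -
    define s where "s = (\<Sum>b\<in>B. u b *\<^sub>R b)"
    define N where "N = norm (\<Sum>b\<in>insert a B. u b *\<^sub>R b)"
    have N: "N = norm (u a *\<^sub>R a + s)" using insert.hyps by (simp add: N_def s_def)
    have s_span: "s \<in> span B" by (simp add: s_def span_base span_scale span_sum)
    have ua: "\<bar>u a\<bar> * e \<le> N"
    proof (cases "u a = 0")
      case True then show ?thesis by (simp add: N)
    next
      case False
      have "u a *\<^sub>R a + s = u a *\<^sub>R (a + (1 / u a) *\<^sub>R s)" using False by (simp add: algebra_simps)
      then have "N = \<bar>u a\<bar> * norm (a + (1 / u a) *\<^sub>R s)" by (simp add: N)
      moreover have "e \<le> norm (a + (1 / u a) *\<^sub>R s)" by (intro far span_scale s_span)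
      ultimately show ?thesis by (simp add: mult_left_mono)
    qed
    then have ua': "\<bar>u a\<bar> \<le> N / e" using e by (simp add: field_simps)
    have "norm s \<le> N + \<bar>u a\<bar> * norm a"
      unfolding N using norm_triangle_ineq4[of "u a *\<^sub>R a + s" "u a *\<^sub>R a"] by simp
    also have "\<dots> \<le> N + N / e * norm a" using mult_right_mono[OF ua', of "norm a"] by simp
    finally have sN: "norm s \<le> N * (1 + norm a / e)" by (simp add: field_simps)
    have N0: "N \<ge> 0" by (simp add: N)
    show ?thesis
    proof (cases "b = a")
      case True
      have "N / e \<le> (1 / e + C * (1 + norm a / e)) * N"
        using C_nonneg e N0 by (simp add: algebra_simps)
      then show ?thesis using True ua' unfolding N_def[symmetric] by simp
    next
      case False
      then have "\<bar>u b\<bar> \<le> C * norm s" using C[of b u] b by (simp add: s_def)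
      also have "\<dots> \<le> C * (N * (1 + norm a / e))" using sN C_nonneg by (rule mult_left_mono)
      also have "\<dots> \<le> (1 / e + C * (1 + norm a / e)) * N"
        using e N0 by (simp add: algebra_simps)
      finally show ?thesis unfolding N_def .
    qed
  qed
  then show ?case by blast
qed

text \<open>The workhorse for families of multilinear maps: expanding an argument in a basis with
  bounded coordinate functionals reduces claims about moving arguments to finitely many fixed
  ones.\<close>

lemma fin_dim_coordinates:
  assumes "fin_dim TYPE('a::real_normed_vector)"
  obtains B :: "'a::real_normed_vector set" and r :: "'a::real_normed_vector \<Rightarrow> 'a \<Rightarrow> real"
  where "finite B" "\<And>b. b \<in> B \<Longrightarrow> bounded_linear (r b)" "\<And>v. (\<Sum>b\<in>B. r b v *\<^sub>R b) = v"
proof -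
  obtain S :: "'a set" where S: "finite S" "span S = UNIV" using assms unfolding fin_dim_def by blast
  obtain B where B: "B \<subseteq> S" "independent B" "S \<subseteq> span B"
    using maximal_independent_subset[of S] by blast
  have fB: "finite B" using B S finite_subset by blast
  have sB: "span B = UNIV" using B S by (metis span_minimal subspace_span top.extremum_uniqueI)
  define r where "r b v = representation B v b" for b v
  have sum: "(\<Sum>b\<in>B. r b v *\<^sub>R b) = v" for v
    unfolding r_def using B sB fB by (intro real_vector.sum_representation_eq) auto
  obtain C where C: "\<And>u b. b \<in> B \<Longrightarrow> \<bar>u b\<bar> \<le> C * norm (\<Sum>b\<in>B. u b *\<^sub>R b)"
    using independent_coefficients_bounded[OF fB B(2)] by blast
  have "bounded_linear (r b)" if b: "b \<in> B" for b
  proof (rule bounded_linear_intro)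
    show "r b (x + y) = r b x + r b y" for x y
      unfolding r_def using B sB by (simp add: real_vector.representation_add)
    show "r b (c *\<^sub>R x) = c *\<^sub>R r b x" for c x
      unfolding r_def using B sB by (simp add: real_vector.representation_scale)
    show "norm (r b x) \<le> norm x * C" for x
      using C[OF b, of "\<lambda>b. r b x"] by (simp add: sum mult.commute)
  qed
  then show thesis using that fB sum by blast
qed

lemma fin_dim_linear_bounded:
  fixes f :: "'a::real_normed_vector \<Rightarrow> 'b::real_normed_vector"
  assumes "fin_dim TYPE('a)" "linear f"
  shows "bounded_linear f"
proof -
  obtain B :: "'a set" and r where B: "finite B" "\<And>b. b \<in> B \<Longrightarrow> bounded_linear (r b)"
      "\<And>v. (\<Sum>b\<in>B. r b v *\<^sub>R b) = v"
    using fin_dim_coordinates[OF assms(1)] by blast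
  have "(\<Sum>b\<in>B. r b v *\<^sub>R f b) = f v" for v
    using arg_cong[OF B(3)[of v], of f] assms(2) by (simp add: linear_sum linear_cmul)
  moreover have "bounded_linear (\<lambda>v. \<Sum>b\<in>B. r b v *\<^sub>R f b)"
  proof (rule bounded_linear_sum)
    fix b assume "b \<in> B"
    show "bounded_linear (\<lambda>v. r b v *\<^sub>R f b)"
      by (rule bounded_linear_compose[OF bounded_linear_scaleR_left B(2)[OF \<open>b \<in> B\<close>]])
  qed
  ultimately show ?thesis by simp
qed

lemma fin_dim_bilinear_bounded:
  fixes f :: "'a::real_normed_vector \<Rightarrow> 'b::real_normed_vector \<Rightarrow> 'c::real_normed_vector"
  assumes "fin_dim TYPE('a)" "fin_dim TYPE('b)" "bilinear f"
  shows "bounded_bilinear f"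
proof -
  obtain B :: "'a set" and r where B: "finite B" "\<And>b. b \<in> B \<Longrightarrow> bounded_linear (r b)"
      "\<And>v. (\<Sum>b\<in>B. r b v *\<^sub>R b) = v"
    using fin_dim_coordinates[OF assms(1)] by blast
  have lin: "bounded_linear (f b)" for b
    by (rule fin_dim_linear_bounded[OF assms(2)]) (use assms(3) in \<open>simp add: bilinear_def\<close>)
  have linl: "linear (\<lambda>v. f v w)" for w using assms(3) by (simp add: bilinear_def)
  have f: "f v w = (\<Sum>b\<in>B. r b v *\<^sub>R f b w)" for v w
    using arg_cong[OF B(3)[of v], of "\<lambda>v. f v w"] by (simp add: linear_sum[OF linl] linear_cmul[OF linl])
  show ?thesis
  proof
    show "f (a + a') b = f a b + f a' b" "f (r *\<^sub>R a) b = r *\<^sub>R f a b"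
      "f a (b + b') = f a b + f a b'" "f a (r *\<^sub>R b) = r *\<^sub>R f a b" for a a' b b' r
      using assms(3) by (simp_all add: bilinear_ladd bilinear_lmul bilinear_radd bilinear_rmul)
    have "\<exists>K. \<forall>v w. norm (r b v *\<^sub>R f b w) \<le> norm v * norm w * K" if b: "b \<in> B" for b
    proof -
      obtain K1 where K1: "\<And>v. norm (r b v) \<le> norm v * K1" using bounded_linear.bounded[OF B(2)[OF b]] by blast
      obtain K2 where K2: "\<And>v. norm (f b v) \<le> norm v * K2" using bounded_linear.bounded[OF lin] by blast
      have "norm (r b v) * norm (f b w) \<le> (norm v * K1) * (norm w * K2)" for v w
        by (rule mult_mono[OF K1 K2]) (use order_trans[OF norm_ge_zero K1] in auto)
      then have "norm (r b v *\<^sub>R f b w) \<le> norm v * norm w * (K1 * K2)" for v w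
        by (simp add: mult_ac)
      then show ?thesis by blast
    qed
    then obtain K where K: "\<And>b v w. b \<in> B \<Longrightarrow> norm (r b v *\<^sub>R f b w) \<le> norm v * norm w * K b" by metis
    have "norm (f v w) \<le> norm v * norm w * (\<Sum>b\<in>B. K b)" for v w
      unfolding f[of v w] sum_distrib_left by (rule order_trans[OF norm_sum]) (intro sum_mono K)
    then show "\<exists>K. \<forall>a b. norm (f a b) \<le> norm a * norm b * K" by blast
  qed
qed

subsection \<open>Smooth functions\<close>

lemma Ck_on_mono: "Ck_on (Suc k) S f \<Longrightarrow> Ck_on k S f"
proof (induction k arbitrary: f)
  case 0
  then show ?case
    by (auto intro!: continuous_at_imp_continuous_on differentiable_imp_continuous_within)
next
  case (Suc k)
  have "Ck_on k S (\<lambda>x. fderiv f x v)" for v using Suc by simp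
  then show ?case using Suc.prems by simp
qed

lemma Ck_on_cong:
  assumes "open S" "\<And>x. x \<in> S \<Longrightarrow> f x = g x"
  shows "Ck_on k S f \<longleftrightarrow> Ck_on k S g"
  using assms(2)
proof (induction k arbitrary: f g)
  case 0
  then show ?case by (simp cong: continuous_on_cong)
next
  case (Suc k)
  have "Ck_on k S (\<lambda>x. fderiv f x v) \<longleftrightarrow> Ck_on k S (\<lambda>x. fderiv g x v)" for v
    using Suc assms(1) by (intro Suc.IH) (simp add: fderiv_cong_open[of S _ f g])
  moreover have "f differentiable (at x) \<longleftrightarrow> g differentiable (at x)" if "x \<in> S" for x
    using differentiable_cong_open[OF assms(1) that, of f g] Suc.prems by blast
  ultimately show ?case by simp
qed

lemma Ck_on_congI:
  assumes "open S" "Ck_on k S g" "\<And>x. x \<in> S \<Longrightarrow> f x = g x"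
  shows "Ck_on k S f"
  using Ck_on_cong[of S f g k] assms by blast

lemma Ck_on_SucI:
  assumes "open S" "\<And>x. x \<in> S \<Longrightarrow> (f has_derivative f' x) (at x)" "\<And>v. Ck_on k S (\<lambda>x. f' x v)"
  shows "Ck_on (Suc k) S f"
proof -
  have "Ck_on k S (\<lambda>x. fderiv f x v)" for v
    by (rule Ck_on_congI[OF assms(1,3)]) (rule fderiv_eq[OF assms(2)])
  then show ?thesis using assms(2) by (auto simp: differentiable_def)
qed

lemma Ck_on_subset: "Ck_on k S f \<Longrightarrow> T \<subseteq> S \<Longrightarrow> Ck_on k T f"
  by (induction k arbitrary: f) (auto intro: continuous_on_subset)

lemma Ck_on_local:
  assumes "\<And>x. x \<in> S \<Longrightarrow> \<exists>T. open T \<and> x \<in> T \<and> Ck_on k T f"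
  shows "Ck_on k S f"
  using assms
proof (induction k arbitrary: f)
  case 0
  have "continuous (at x) f" if "x \<in> S" for x
  proof -
    have "\<exists>T. open T \<and> x \<in> T \<and> continuous_on T f" using 0 that by simp
    then obtain T where "open T" "x \<in> T" "continuous_on T f" by blast
    then show ?thesis by (simp add: continuous_on_eq_continuous_at)
  qed
  then show ?case by (simp add: continuous_at_imp_continuous_on)
next
  case (Suc k)
  have "f differentiable (at x)" if "x \<in> S" for x
    using Suc.prems[OF that] by auto
  moreover have "Ck_on k S (\<lambda>x. fderiv f x v)" for v
  proof (rule Suc.IH)
    fix x assume "x \<in> S"
    from Suc.prems[OF this] show "\<exists>T. open T \<and> x \<in> T \<and> Ck_on k T (\<lambda>x. fderiv f x v)" by auto
  qed
  ultimately show ?case by simp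
qed

lemma Ck_on_const: "Ck_on k S (\<lambda>x. c)"
  by (induction k arbitrary: c) auto

lemma Ck_on_bounded_linear:
  assumes "bounded_linear l" "open S" "Ck_on k S f"
  shows "Ck_on k S (\<lambda>x. l (f x))"
  using assms(3)
proof (induction k arbitrary: f)
  case 0
  then show ?case using assms(1) by (simp add: linear_continuous_on_compose bounded_linear.continuous_on)
next
  case (Suc k)
  have der: "((\<lambda>x. l (f x)) has_derivative (\<lambda>v. l (fderiv f x v))) (at x)" if "x \<in> S" for x
    using Suc.prems that bounded_linear.has_derivative[OF assms(1) has_fderiv] by auto
  have "Ck_on k S (\<lambda>x. l (fderiv f x v))" for v using Suc by simp
  with der show ?case by (rule Ck_on_SucI[OF assms(2)])
qed

lemma Ck_on_add:
  assumes "open S" "Ck_on k S f" "Ck_on k S g"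
  shows "Ck_on k S (\<lambda>x. f x + g x)"
  using assms(2,3)
proof (induction k arbitrary: f g)
  case 0
  then show ?case by (simp add: continuous_on_add)
next
  case (Suc k)
  have der: "((\<lambda>x. f x + g x) has_derivative (\<lambda>v. fderiv f x v + fderiv g x v)) (at x)" if "x \<in> S" for x
    using Suc.prems that by (intro has_derivative_add has_fderiv) auto
  have "Ck_on k S (\<lambda>x. fderiv f x v + fderiv g x v)" for v using Suc by simp
  with der show ?case by (rule Ck_on_SucI[OF assms(1)])
qed

lemma Ck_on_sum:
  assumes "open S" "\<And>i. i \<in> I \<Longrightarrow> Ck_on k S (f i)"
  shows "Ck_on k S (\<lambda>x. \<Sum>i\<in>I. f i x)"
  using assms(2)
proof (induction I rule: infinite_finite_induct)
  case (insert i I)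
  then show ?case by (simp add: Ck_on_add[OF assms(1)])
qed (simp_all add: Ck_on_const)

lemma Ck_on_bilinear:
  assumes p: "bounded_bilinear p" and "open S" "Ck_on k S f" "Ck_on k S g"
  shows "Ck_on k S (\<lambda>x. p (f x) (g x))"
  using assms(3,4)
proof (induction k arbitrary: f g)
  case 0
  then show ?case by (simp add: bounded_bilinear.continuous_on[OF p])
next
  case (Suc k)
  have der: "((\<lambda>x. p (f x) (g x)) has_derivative (\<lambda>v. p (f x) (fderiv g x v) + p (fderiv f x v) (g x))) (at x)"
    if "x \<in> S" for x
    using Suc.prems that by (intro bounded_bilinear.FDERIV[OF p] has_fderiv) auto
  have "Ck_on k S (\<lambda>x. p (f x) (fderiv g x v) + p (fderiv f x v) (g x))" for v
    using Suc.prems by (intro Ck_on_add[OF assms(2)] Suc.IH Ck_on_mono[OF Suc.prems(1)] Ck_on_mono[OF Suc.prems(2)]) auto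
  with der show ?case by (rule Ck_on_SucI[OF assms(2)])
qed

text \<open>\<open>Ck_on\<close> differentiates in fixed directions, whereas the chain rule
  evaluates the derivative of \<open>f\<close> in the direction \<open>fderiv T x v\<close>, which
  moves with \<open>x\<close>. Expanding this direction in a basis leaves a sum of products to which
  the induction hypothesis and the bound on \<open>T\<close> apply.\<close>

lemma Ck_on_compose:
  fixes T :: "'a::real_normed_vector \<Rightarrow> 'b::real_normed_vector"
  assumes fd: "fin_dim TYPE('b)" and "open S" "open S'" "T ` S \<subseteq> S'"
    and "Ck_on k S' f" "Ck_on k S T"
  shows "Ck_on k S (\<lambda>x. f (T x))"
  using assms(5,6)
proof (induction k arbitrary: f)
  case 0
  then show ?case using assms(4) by (auto intro: continuous_on_compose2)
next
  case (Suc k)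
  obtain B :: "'b set" and r where B: "finite B" "\<And>b. b \<in> B \<Longrightarrow> bounded_linear (r b)"
      "\<And>v. (\<Sum>b\<in>B. r b v *\<^sub>R b) = v"
    using fin_dim_coordinates[OF fd] by blast
  have der: "((\<lambda>x. f (T x)) has_derivative (\<lambda>v. fderiv f (T x) (fderiv T x v))) (at x)" if "x \<in> S" for x
  proof -
    have "f differentiable (at (T x))" "T differentiable (at x)"
      using Suc.prems assms(4) that by auto
    then show ?thesis by (metis has_derivative_compose has_fderiv)
  qed
  have expand: "fderiv f (T x) (fderiv T x v) = (\<Sum>b\<in>B. r b (fderiv T x v) *\<^sub>R fderiv f (T x) b)"
    if "x \<in> S" for x v
  proof -
    have lin: "linear (fderiv f (T x))"
      using Suc.prems assms(4) that by (auto intro: linear_frechet_derivative)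
    show ?thesis using arg_cong[OF B(3)[of "fderiv T x v"], of "fderiv f (T x)"] lin
      by (simp add: linear_sum[OF lin] linear_cmul[OF lin])
  qed
  have "Ck_on k S (\<lambda>x. fderiv f (T x) (fderiv T x v))" for v
  proof (rule Ck_on_congI[OF assms(2) _ expand])
    show "Ck_on k S (\<lambda>x. \<Sum>b\<in>B. r b (fderiv T x v) *\<^sub>R fderiv f (T x) b)"
    proof (intro Ck_on_sum[OF assms(2)] Ck_on_bilinear[OF bounded_bilinear_scaleR assms(2)])
      fix b assume b: "b \<in> B"
      show "Ck_on k S (\<lambda>x. r b (fderiv T x v))"
        using Suc.prems by (intro Ck_on_bounded_linear[OF B(2)[OF b] assms(2)]) auto
      show "Ck_on k S (\<lambda>x. fderiv f (T x) b)"
        using Suc.prems(1) by (intro Suc.IH Ck_on_mono[OF Suc.prems(2)]) auto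
    qed
  qed
  with der show ?case by (rule Ck_on_SucI[OF assms(2)])
qed

lemma smooth_on_iff:
  "smooth_on S f \<longleftrightarrow> (\<forall>x\<in>S. f differentiable (at x)) \<and> (\<forall>v. smooth_on S (\<lambda>x. fderiv f x v))"
proof -
  have "smooth_on S f \<longleftrightarrow> (\<forall>k. Ck_on (Suc k) S f)"
    unfolding smooth_on_def using Ck_on_mono by blast
  then show ?thesis unfolding smooth_on_def by auto
qed

lemma smooth_on_differentiable: "smooth_on S f \<Longrightarrow> x \<in> S \<Longrightarrow> f differentiable (at x)"
  using smooth_on_iff by blast

lemma smooth_on_has_derivative: "smooth_on S f \<Longrightarrow> x \<in> S \<Longrightarrow> (f has_derivative fderiv f x) (at x)"
  using smooth_on_differentiable has_fderiv by blast

lemma smooth_on_fderiv: "smooth_on S f \<Longrightarrow> smooth_on S (\<lambda>x. fderiv f x v)"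
  using smooth_on_iff by blast

lemma smooth_on_continuous: "smooth_on S f \<Longrightarrow> continuous_on S f"
  unfolding smooth_on_def using Ck_on.simps(1) by blast

lemma smooth_on_cong: "open S \<Longrightarrow> (\<And>x. x \<in> S \<Longrightarrow> f x = g x) \<Longrightarrow> smooth_on S f \<longleftrightarrow> smooth_on S g"
  unfolding smooth_on_def using Ck_on_cong by blast

lemma smooth_on_congI:
  "open S \<Longrightarrow> smooth_on S g \<Longrightarrow> (\<And>x. x \<in> S \<Longrightarrow> f x = g x) \<Longrightarrow> smooth_on S f"
  using smooth_on_cong[of S f g] by blast

lemma smooth_on_subset: "smooth_on S f \<Longrightarrow> T \<subseteq> S \<Longrightarrow> smooth_on T f"
  unfolding smooth_on_def using Ck_on_subset by blast

lemma smooth_on_local: "(\<And>x. x \<in> S \<Longrightarrow> \<exists>T. open T \<and> x \<in> T \<and> smooth_on T f) \<Longrightarrow> smooth_on S f"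
  unfolding smooth_on_def by (intro allI Ck_on_local) blast

lemma smooth_on_const: "smooth_on S (\<lambda>x. c)"
  unfolding smooth_on_def by (simp add: Ck_on_const)

lemma smooth_on_bounded_linear:
  "bounded_linear l \<Longrightarrow> open S \<Longrightarrow> smooth_on S f \<Longrightarrow> smooth_on S (\<lambda>x. l (f x))"
  unfolding smooth_on_def using Ck_on_bounded_linear by blast

lemma smooth_on_add: "open S \<Longrightarrow> smooth_on S f \<Longrightarrow> smooth_on S g \<Longrightarrow> smooth_on S (\<lambda>x. f x + g x)"
  unfolding smooth_on_def using Ck_on_add by blast

lemma smooth_on_sum: "open S \<Longrightarrow> (\<And>i. i \<in> I \<Longrightarrow> smooth_on S (f i)) \<Longrightarrow> smooth_on S (\<lambda>x. \<Sum>i\<in>I. f i x)"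
  unfolding smooth_on_def using Ck_on_sum[of S I _ f] by blast

lemma smooth_on_bilinear:
  "bounded_bilinear p \<Longrightarrow> open S \<Longrightarrow> smooth_on S f \<Longrightarrow> smooth_on S g \<Longrightarrow> smooth_on S (\<lambda>x. p (f x) (g x))"
  unfolding smooth_on_def using Ck_on_bilinear[of p S _ f g] by blast

lemma smooth_on_scaleR: "open S \<Longrightarrow> smooth_on S f \<Longrightarrow> smooth_on S (\<lambda>x. c *\<^sub>R f x)"
  using smooth_on_bounded_linear[OF bounded_linear_scaleR_right] by blast

lemma smooth_on_mult_left:
  "open S \<Longrightarrow> smooth_on S f \<Longrightarrow> smooth_on S (\<lambda>x. (c::real) * f x)"
  using smooth_on_bounded_linear[OF bounded_linear_mult_right] by blast

lemma smooth_on_minus: "open S \<Longrightarrow> smooth_on S f \<Longrightarrow> smooth_on S (\<lambda>x. - f x)"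
  using smooth_on_scaleR[of S f "-1"] by simp

lemma smooth_on_diff: "open S \<Longrightarrow> smooth_on S f \<Longrightarrow> smooth_on S g \<Longrightarrow> smooth_on S (\<lambda>x. f x - g x)"
  using smooth_on_add[of S f "\<lambda>x. - g x"] smooth_on_minus[of S g] by simp

lemma smooth_on_compose:
  fixes T :: "'a::real_normed_vector \<Rightarrow> 'b::real_normed_vector"
  shows "fin_dim TYPE('b) \<Longrightarrow> open S \<Longrightarrow> open S' \<Longrightarrow> T ` S \<subseteq> S' \<Longrightarrow> smooth_on S' f \<Longrightarrow> smooth_on S T
    \<Longrightarrow> smooth_on S (\<lambda>x. f (T x))"
  unfolding smooth_on_def using Ck_on_compose[of S S' T _ f] by blast

lemma smooth_on_linear_family:
  fixes F :: "'x::real_normed_vector \<Rightarrow> 'a::real_normed_vector \<Rightarrow> 'b::real_normed_vector"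
  assumes fd: "fin_dim TYPE('a)" and S: "open S" and lin: "\<And>x. x \<in> S \<Longrightarrow> linear (F x)"
    and F: "\<And>a. smooth_on S (\<lambda>x. F x a)" and g: "smooth_on S g"
  shows "smooth_on S (\<lambda>x. F x (g x))"
proof -
  obtain B :: "'a set" and r where B: "finite B" "\<And>b. b \<in> B \<Longrightarrow> bounded_linear (r b)"
      "\<And>v. (\<Sum>b\<in>B. r b v *\<^sub>R b) = v"
    using fin_dim_coordinates[OF fd] by blast
  have "F x (g x) = (\<Sum>b\<in>B. r b (g x) *\<^sub>R F x b)" if "x \<in> S" for x
    using arg_cong[OF B(3)[of "g x"], of "F x"] by (simp add: linear_sum[OF lin[OF that]] linear_cmul[OF lin[OF that]])
  moreover have "smooth_on S (\<lambda>x. \<Sum>b\<in>B. r b (g x) *\<^sub>R F x b)"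
  proof (rule smooth_on_sum[OF S])
    fix b assume "b \<in> B"
    then have "smooth_on S (\<lambda>x. r b (g x))" by (rule smooth_on_bounded_linear[OF B(2) S g])
    then show "smooth_on S (\<lambda>x. r b (g x) *\<^sub>R F x b)"
      by (rule smooth_on_bilinear[OF bounded_bilinear_scaleR S _ F])
  qed
  ultimately show ?thesis using smooth_on_congI[OF S, of "\<lambda>x. \<Sum>b\<in>B. r b (g x) *\<^sub>R F x b" "\<lambda>x. F x (g x)"] by blast
qed

text \<open>The product rule for evaluating a moving linear map at a moving vector. Derivatives of
  pullbacks, of contractions with vector fields and of \<tau>\<theta>' are all of this kind.\<close>

lemma has_derivative_linear_family:
  fixes F :: "'x::real_normed_vector \<Rightarrow> 'a::real_normed_vector \<Rightarrow> 'b::real_normed_vector"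
  assumes fd: "fin_dim TYPE('a)" and S: "open S" "x \<in> S" and lin: "\<And>x. x \<in> S \<Longrightarrow> linear (F x)"
    and F: "\<And>a. ((\<lambda>x. F x a) has_derivative F' a) (at x)" and g: "(g has_derivative g') (at x)"
  shows "((\<lambda>x. F x (g x)) has_derivative (\<lambda>h. F' (g x) h + F x (g' h))) (at x)"
proof -
  obtain B :: "'a set" and r where B: "finite B" "\<And>b. b \<in> B \<Longrightarrow> bounded_linear (r b)"
      "\<And>v. (\<Sum>b\<in>B. r b v *\<^sub>R b) = v"
    using fin_dim_coordinates[OF fd] by blast
  have expand: "F y v = (\<Sum>b\<in>B. r b v *\<^sub>R F y b)" if "y \<in> S" for y v
    using arg_cong[OF B(3)[of v], of "F y"] by (simp add: linear_sum[OF lin[OF that]] linear_cmul[OF lin[OF that]])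
  have "((\<lambda>x. \<Sum>b\<in>B. r b v *\<^sub>R F x b) has_derivative (\<lambda>h. \<Sum>b\<in>B. r b v *\<^sub>R F' b h)) (at x)" for v
    by (intro has_derivative_sum has_derivative_scaleR_right F)
  then have "((\<lambda>x. F x v) has_derivative (\<lambda>h. \<Sum>b\<in>B. r b v *\<^sub>R F' b h)) (at x)" for v
    by (rule has_derivative_transform_within_open[OF _ S(1) S(2)]) (simp add: expand[symmetric])
  \<comment> \<open>Differentiating the expansion shows that \<open>F'\<close> is itself determined
    by its values on the basis.\<close>
  then have F': "F' v h = (\<Sum>b\<in>B. r b v *\<^sub>R F' b h)" for v h
    using F fderiv_eq by metis
  have "((\<lambda>x. \<Sum>b\<in>B. r b (g x) *\<^sub>R F x b) has_derivative
      (\<lambda>h. \<Sum>b\<in>B. r b (g x) *\<^sub>R F' b h + r b (g' h) *\<^sub>R F x b)) (at x)"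
    using B by (intro has_derivative_sum has_derivative_scaleR F bounded_linear.has_derivative[OF _ g]) auto
  then have "((\<lambda>x. F x (g x)) has_derivative
      (\<lambda>h. \<Sum>b\<in>B. r b (g x) *\<^sub>R F' b h + r b (g' h) *\<^sub>R F x b)) (at x)"
    by (rule has_derivative_transform_within_open[OF _ S(1) S(2)]) (simp add: expand[symmetric])
  moreover have "(\<Sum>b\<in>B. r b (g x) *\<^sub>R F' b h + r b (g' h) *\<^sub>R F x b) = F' (g x) h + F x (g' h)" for h
    by (simp add: sum.distrib F'[symmetric] expand[OF S(2), symmetric])
  ultimately show ?thesis by simp
qed

subsection \<open>Symmetry of second derivatives\<close>

text \<open>The mean value inequality is applied twice: along \<open>w\<close> to the derivative of
  \<open>f\<close> in direction \<open>v\<close>, then along \<open>v\<close> to the increment of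
  \<open>f\<close> in direction \<open>w\<close>.\<close>

lemma second_difference_bound:
  fixes f :: "'a::real_normed_vector \<Rightarrow> 'b::real_normed_vector"
  assumes f: "smooth_on S f" and h: "h > 0"
    and S: "\<And>s t. s \<in> {0..h} \<Longrightarrow> t \<in> {0..h} \<Longrightarrow> x + s *\<^sub>R v + t *\<^sub>R w \<in> S"
    and e: "\<And>s t. s \<in> {0..h} \<Longrightarrow> t \<in> {0..h} \<Longrightarrow>
      norm (fderiv (\<lambda>y. fderiv f y v) (x + s *\<^sub>R v + t *\<^sub>R w) w - L) \<le> e"
  shows "norm (f (x + h *\<^sub>R v + h *\<^sub>R w) - f (x + h *\<^sub>R v) - f (x + h *\<^sub>R w) + f x - (h * h) *\<^sub>R L) \<le> h * h * e"
proof -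
  \<comment> \<open>The one-dimensional form: the derivative of \<open>g t - t *\<^sub>R M\<close>
    has norm at most \<open>c\<close>.\<close>
  have aux: "norm (g h - g 0 - h *\<^sub>R M) \<le> h * c"
    if "\<And>t. t \<in> {0..h} \<Longrightarrow> (g has_vector_derivative g' t) (at t)"
      "\<And>t. t \<in> {0..h} \<Longrightarrow> norm (g' t - M) \<le> c" for g g' :: "real \<Rightarrow> 'b" and M c
  proof -
    have "norm ((g h - h *\<^sub>R M) - (g 0 - 0 *\<^sub>R M)) \<le> c * norm (h - 0)"
    proof (rule differentiable_bound[of "{0..h}" "\<lambda>t. g t - t *\<^sub>R M" "\<lambda>t k. k *\<^sub>R (g' t - M)"])
      fix t assume t: "t \<in> {0..h}"
      have "((\<lambda>t. g t - t *\<^sub>R M) has_vector_derivative g' t - M) (at t)"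
        using that(1)[OF t] by (auto intro!: derivative_eq_intros)
      then show "((\<lambda>t. g t - t *\<^sub>R M) has_derivative (\<lambda>k. k *\<^sub>R (g' t - M))) (at t within {0..h})"
        unfolding has_vector_derivative_def by (rule has_derivative_at_withinI)
      have "norm (k *\<^sub>R (g' t - M)) \<le> c * norm k" for k
        using mult_right_mono[OF that(2)[OF t], of "\<bar>k\<bar>"] by (simp add: mult.commute)
      then show "onorm (\<lambda>k. k *\<^sub>R (g' t - M)) \<le> c" by (rule onorm_le)
    qed (use h in auto)
    then show ?thesis using h by (simp add: algebra_simps)
  qed
  have line: "((\<lambda>s. F (y + s *\<^sub>R u)) has_vector_derivative fderiv F (y + s *\<^sub>R u) u) (at s)"
    if "F differentiable (at (y + s *\<^sub>R u))" for F :: "'a \<Rightarrow> 'b" and y u s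
  proof -
    have "((\<lambda>s. y + s *\<^sub>R u) has_derivative (\<lambda>k. k *\<^sub>R u)) (at s)"
      by (auto intro!: derivative_eq_intros)
    then have "((\<lambda>s. F (y + s *\<^sub>R u)) has_derivative (\<lambda>k. fderiv F (y + s *\<^sub>R u) (k *\<^sub>R u))) (at s)"
      by (rule has_derivative_compose) (rule has_fderiv[OF that])
    then show ?thesis unfolding has_vector_derivative_def
      using linear_frechet_derivative[OF that] by (simp add: linear_cmul)
  qed
  have inner: "norm (fderiv f (x + s *\<^sub>R v + h *\<^sub>R w) v - fderiv f (x + s *\<^sub>R v) v - h *\<^sub>R L) \<le> h * e"
    if s: "s \<in> {0..h}" for s
  proof -
    have "norm (fderiv f (x + s *\<^sub>R v + h *\<^sub>R w) v - fderiv f (x + s *\<^sub>R v + 0 *\<^sub>R w) v - h *\<^sub>R L) \<le> h * e"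
    proof (rule aux)
      fix t assume t: "t \<in> {0..h}"
      show "((\<lambda>t. fderiv f (x + s *\<^sub>R v + t *\<^sub>R w) v) has_vector_derivative
          fderiv (\<lambda>y. fderiv f y v) (x + s *\<^sub>R v + t *\<^sub>R w) w) (at t)"
        by (rule line) (use S[OF s t] smooth_on_differentiable[OF smooth_on_fderiv[OF f]] in blast)
      show "norm (fderiv (\<lambda>y. fderiv f y v) (x + s *\<^sub>R v + t *\<^sub>R w) w - L) \<le> e" by (rule e[OF s t])
    qed
    then show ?thesis by simp
  qed
  have "norm ((f ((x + h *\<^sub>R w) + h *\<^sub>R v) - f (x + h *\<^sub>R v)) - (f ((x + h *\<^sub>R w) + 0 *\<^sub>R v) - f (x + 0 *\<^sub>R v)) - h *\<^sub>R (h *\<^sub>R L))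
    \<le> h * (h * e)"
  proof (rule aux)
    fix s assume s: "s \<in> {0..h}"
    have "f differentiable (at ((x + h *\<^sub>R w) + s *\<^sub>R v))" "f differentiable (at (x + s *\<^sub>R v))"
      using smooth_on_differentiable[OF f S[OF s, of h]] smooth_on_differentiable[OF f S[OF s, of 0]] h
      by (auto simp: algebra_simps)
    then show "((\<lambda>s. f ((x + h *\<^sub>R w) + s *\<^sub>R v) - f (x + s *\<^sub>R v)) has_vector_derivative
      fderiv f ((x + h *\<^sub>R w) + s *\<^sub>R v) v - fderiv f (x + s *\<^sub>R v) v) (at s)"
      by (intro has_vector_derivative_diff line)
    show "norm (fderiv f ((x + h *\<^sub>R w) + s *\<^sub>R v) v - fderiv f (x + s *\<^sub>R v) v - h *\<^sub>R L) \<le> h * e"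
      using inner[OF s] by (simp add: algebra_simps)
  qed
  then show ?thesis by (simp add: algebra_simps)
qed

text \<open>The second difference over the parallelogram with sides \<open>h v\<close> and
  \<open>h w\<close> does not change when the sides are exchanged, and \<open>h * h\<close> times
  either mixed derivative approximates it up to \<open>h * h * e\<close>. So the two derivatives
  differ by at most \<open>2 * e\<close> for every \<open>e\<close>.\<close>

lemma second_derivative_symmetric:
  fixes f :: "'a::real_normed_vector \<Rightarrow> 'b::real_normed_vector"
  assumes "open S" "smooth_on S f" "x \<in> S"
  shows "fderiv (\<lambda>y. fderiv f y v) x w = fderiv (\<lambda>y. fderiv f y w) x v"
proof -
  define L where "L = fderiv (\<lambda>y. fderiv f y v) x w"
  define L' where "L' = fderiv (\<lambda>y. fderiv f y w) x v"
  have "norm (L - L') \<le> 2 * e" if e: "e > 0" for e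
  proof -
    have cont: "continuous (at x) (\<lambda>y. fderiv (\<lambda>y. fderiv f y a) y b)" for a b
      using assms smooth_on_continuous[OF smooth_on_fderiv[OF smooth_on_fderiv[OF assms(2)]]]
      by (simp add: continuous_on_eq_continuous_at)
    obtain d1 where d1: "d1 > 0" "\<And>y. dist y x < d1 \<Longrightarrow> dist (fderiv (\<lambda>y. fderiv f y v) y w) L < e"
      using cont[of v w] e unfolding continuous_at_eps_delta L_def by blast
    obtain d2 where d2: "d2 > 0" "\<And>y. dist y x < d2 \<Longrightarrow> dist (fderiv (\<lambda>y. fderiv f y w) y v) L' < e"
      using cont[of w v] e unfolding continuous_at_eps_delta L'_def by blast
    obtain d3 where d3: "d3 > 0" "ball x d3 \<subseteq> S" using assms open_contains_ball_eq by blast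
    define d where "d = min d1 (min d2 d3)"
    \<comment> \<open>Keeps the whole parallelogram within distance \<open>d\<close> of
      \<open>x\<close>; the summand 1 makes the denominator positive even for
      \<open>v = w = 0\<close>.\<close>
    define h where "h = d / (norm v + norm w + 1) / 2"
    have d: "d > 0" using d1 d2 d3 by (simp add: d_def)
    then have h: "h > 0" by (simp add: h_def add_nonneg_pos)
    have near: "dist (x + s *\<^sub>R v + t *\<^sub>R w) x < d" if "s \<in> {0..h}" "t \<in> {0..h}" for s t
    proof -
      have "norm (s *\<^sub>R v + t *\<^sub>R w) \<le> h * norm v + h * norm w"
        using that by (intro norm_triangle_le add_mono) (auto intro: mult_right_mono)
      also have "\<dots> < h * (norm v + norm w + 1) * 2"
      proof -
        have "h * norm v \<ge> 0" "h * norm w \<ge> 0" using h by simp_all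
        then have "0 < h * norm v + (h * norm w + h * 2)" using h by linarith
        then show ?thesis by (simp add: algebra_simps)
      qed
      also have "\<dots> = d"
      proof -
        define n where "n = norm v + norm w + 1"
        have "n \<noteq> 0" using norm_ge_zero[of v] norm_ge_zero[of w] unfolding n_def by linarith
        then show ?thesis unfolding h_def n_def[symmetric] by simp
      qed
      finally show ?thesis by (simp add: dist_norm algebra_simps)
    qed
    define \<Delta> where "\<Delta> = f (x + h *\<^sub>R v + h *\<^sub>R w) - f (x + h *\<^sub>R v) - f (x + h *\<^sub>R w) + f x"
    have "norm (\<Delta> - (h * h) *\<^sub>R L) \<le> h * h * e"
      unfolding \<Delta>_def
    proof (rule second_difference_bound[OF assms(2) h])
      fix s t assume st: "s \<in> {0..h}" "t \<in> {0..h}"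
      show "x + s *\<^sub>R v + t *\<^sub>R w \<in> S" using near[OF st] d3 by (auto simp: d_def dist_commute)
      show "norm (fderiv (\<lambda>y. fderiv f y v) (x + s *\<^sub>R v + t *\<^sub>R w) w - L) \<le> e"
        using d1(2)[of "x + s *\<^sub>R v + t *\<^sub>R w"] near[OF st] by (simp add: d_def dist_norm)
    qed
    moreover have "norm (f (x + h *\<^sub>R w + h *\<^sub>R v) - f (x + h *\<^sub>R w) - f (x + h *\<^sub>R v) + f x - (h * h) *\<^sub>R L') \<le> h * h * e"
    proof (rule second_difference_bound[OF assms(2) h])
      fix s t assume st: "s \<in> {0..h}" "t \<in> {0..h}"
      have eq: "x + s *\<^sub>R w + t *\<^sub>R v = x + t *\<^sub>R v + s *\<^sub>R w" by simp
      show "x + s *\<^sub>R w + t *\<^sub>R v \<in> S" unfolding eq using near[OF st(2,1)] d3 by (auto simp: d_def dist_commute)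
      show "norm (fderiv (\<lambda>y. fderiv f y w) (x + s *\<^sub>R w + t *\<^sub>R v) v - L') \<le> e"
        unfolding eq using d2(2)[of "x + t *\<^sub>R v + s *\<^sub>R w"] near[OF st(2,1)] by (simp add: d_def dist_norm)
    qed
    then have "norm (\<Delta> - (h * h) *\<^sub>R L') \<le> h * h * e" by (simp add: \<Delta>_def algebra_simps)
    ultimately have "norm ((\<Delta> - (h * h) *\<^sub>R L') - (\<Delta> - (h * h) *\<^sub>R L)) \<le> h * h * e + h * h * e"
      by (meson add_mono norm_triangle_ineq4 order_trans add.commute)
    also have "(\<Delta> - (h * h) *\<^sub>R L') - (\<Delta> - (h * h) *\<^sub>R L) = (h * h) *\<^sub>R (L - L')" by (simp add: algebra_simps)
    finally have "(h * h) * norm (L - L') \<le> (h * h) * (2 * e)" using h by simp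
    moreover have "h * h > 0" using h by simp
    ultimately show ?thesis by (rule mult_left_le_imp_le)
  qed
  then have "norm (L - L') \<le> 0 + e" if "e > 0" for e
    using that[THEN half_gt_zero] by fastforce
  then have "norm (L - L') \<le> 0" by (rule field_le_epsilon)
  then show ?thesis by (simp add: L_def L'_def)
qed

subsection \<open>The Poincare lemma for 3-forms\<close>

text \<open>The integrals of the homotopy operator that contracts the space radially to the origin.\<close>

definition ray_int :: "nat \<Rightarrow> ('a::real_normed_vector \<Rightarrow> 'b::banach) \<Rightarrow> 'a \<Rightarrow> 'b" where
  "ray_int n g x = integral {0..1} (\<lambda>t. t ^ n *\<^sub>R g (t *\<^sub>R x))"

lemma ray_integrand_integrable:
  fixes g :: "'a::real_normed_vector \<Rightarrow> 'b::banach"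
  assumes "continuous_on UNIV g"
  shows "(\<lambda>t. t ^ n *\<^sub>R g (t *\<^sub>R x)) integrable_on {0..1::real}"
  by (intro integrable_continuous_real continuous_intros continuous_on_compose2[OF assms]) auto

text \<open>Differentiation under the integral sign. The inner derivative of
  \<open>t *\<^sub>R x\<close> contributes one more factor \<open>t\<close>, so the exponent of the
  weight rises by one.\<close>

lemma ray_int_has_derivative:
  fixes g :: "'a::banach \<Rightarrow> 'b::banach"
  assumes fd: "fin_dim TYPE('a)" and g: "smooth_on UNIV g"
  shows "(ray_int n g has_derivative (\<lambda>v. ray_int (Suc n) (\<lambda>y. fderiv g y v) x)) (at x)"
proof -
  obtain B :: "'a set" and r where B: "finite B" "\<And>b. b \<in> B \<Longrightarrow> bounded_linear (r b)"
      "\<And>v. (\<Sum>b\<in>B. r b v *\<^sub>R b) = v"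
    using fin_dim_coordinates[OF fd] by blast
  have cont: "continuous_on UNIV (\<lambda>y. fderiv g y v)" for v
    by (intro smooth_on_continuous smooth_on_fderiv g)
  have der: "(g has_derivative fderiv g y) (at y)" for y
    by (rule smooth_on_has_derivative[OF g UNIV_I])
  have lin: "linear (fderiv g y)" for y
    using der has_derivative_linear by blast
  \<comment> \<open>\<open>leibniz_rule\<close> needs the derivative as a continuous family of
    bounded linear maps. Assembling it from a basis reduces its continuity to that of finitely many
    vector-valued functions.\<close>
  define L :: "'a \<Rightarrow> real \<Rightarrow> 'a \<Rightarrow>\<^sub>L 'b" where
    "L y t = (\<Sum>b\<in>B. blinfun_scaleR_left (t ^ Suc n *\<^sub>R fderiv g (t *\<^sub>R y) b) o\<^sub>L Blinfun (r b))" for y t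
  have L: "blinfun_apply (L y t) v = t ^ Suc n *\<^sub>R fderiv g (t *\<^sub>R y) v" for y t v
  proof -
    have "blinfun_apply (L y t) v = (\<Sum>b\<in>B. r b v *\<^sub>R (t ^ Suc n *\<^sub>R fderiv g (t *\<^sub>R y) b))"
      unfolding L_def blinfun.sum_left
      by (intro sum.cong refl) (simp add: bounded_linear_Blinfun_apply[OF B(2)])
    also have "\<dots> = t ^ Suc n *\<^sub>R (\<Sum>b\<in>B. r b v *\<^sub>R fderiv g (t *\<^sub>R y) b)"
      by (simp add: scaleR_sum_right mult.commute)
    also have "(\<Sum>b\<in>B. r b v *\<^sub>R fderiv g (t *\<^sub>R y) b) = fderiv g (t *\<^sub>R y) v"
      using arg_cong[OF B(3)[of v], of "fderiv g (t *\<^sub>R y)"]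
      by (simp add: linear_sum[OF lin] linear_cmul[OF lin])
    finally show ?thesis .
  qed
  have contL: "continuous_on (UNIV \<times> cbox 0 1) (\<lambda>(y, t). L y t)"
    unfolding L_def split_beta
    by (intro continuous_intros continuous_on_compose2[OF cont]) auto
  have "((\<lambda>y. integral (cbox 0 1) (\<lambda>t. t ^ n *\<^sub>R g (t *\<^sub>R y))) has_derivative
      blinfun_apply (integral (cbox 0 1) (L x))) (at x within UNIV)"
  proof (rule leibniz_rule[OF _ _ contL])
    fix y :: 'a and t :: real
    have "((\<lambda>y. t ^ n *\<^sub>R g (t *\<^sub>R y)) has_derivative (\<lambda>v. t ^ n *\<^sub>R fderiv g (t *\<^sub>R y) (t *\<^sub>R v))) (at y)"
      by (intro has_derivative_scaleR_right has_derivative_compose[OF _ der] has_derivative_ident)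
    then show "((\<lambda>y. t ^ n *\<^sub>R g (t *\<^sub>R y)) has_derivative blinfun_apply (L y t)) (at y within UNIV)"
      by (simp add: L[abs_def] linear_cmul[OF lin] mult.commute[of t] fun_eq_iff L
          has_derivative_eq_rhs)
  qed (use ray_integrand_integrable[OF smooth_on_continuous[OF g]] in auto)
  moreover have "blinfun_apply (integral (cbox 0 1) (L x)) v = ray_int (Suc n) (\<lambda>y. fderiv g y v) x" for v
  proof -
    have "L x integrable_on cbox 0 1"
      by (rule integrable_continuous) (rule continuous_on_compose2[OF contL, of _ "\<lambda>t. (x, t)", simplified]; auto intro!: continuous_intros)
    then have "blinfun_apply (integral (cbox 0 1) (L x)) v = integral (cbox 0 1) (\<lambda>t. blinfun_apply (L x t) v)"
      by (rule blinfun_apply_integral)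
    then show ?thesis by (simp add: L ray_int_def)
  qed
  ultimately have "((\<lambda>y. ray_int n g y) has_derivative (\<lambda>v. ray_int (Suc n) (\<lambda>y. fderiv g y v) x)) (at x)"
    unfolding ray_int_def by (simp add: has_derivative_eq_rhs fun_eq_iff)
  then show ?thesis .
qed

text \<open>Derivatives of a \<open>ray_int\<close> are again of this form, so the induction runs
  over all \<open>n\<close> and \<open>g\<close> at once.\<close>

lemma smooth_on_ray_int:
  fixes g :: "'a::banach \<Rightarrow> 'b::banach"
  assumes fd: "fin_dim TYPE('a)" and g: "smooth_on UNIV g"
  shows "smooth_on UNIV (ray_int n g)"
proof -
  have "Ck_on k UNIV (ray_int n g)" for k
    using g
  proof (induction k arbitrary: n g)
    case 0
    then show ?case
      using ray_int_has_derivative[OF fd, THEN has_derivative_continuous]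
      by (auto intro!: continuous_at_imp_continuous_on)
  next
    case (Suc k)
    have "fderiv (ray_int n g) x v = ray_int (Suc n) (\<lambda>y. fderiv g y v) x" for x v
      by (rule fderiv_eq[OF ray_int_has_derivative[OF fd Suc.prems]])
    then show ?case using Suc.IH[OF smooth_on_fderiv[OF Suc.prems]]
        differentiableI[OF ray_int_has_derivative[OF fd Suc.prems]] by simp
  qed
  then show ?thesis by (simp add: smooth_on_def)
qed

text \<open>The derivative of \<open>t ^ Suc n *\<^sub>R g (t *\<^sub>R x)\<close> is integrated
  over the unit interval; the lower end contributes 0 because the exponent is positive.\<close>

lemma ray_int_eq:
  fixes g :: "'a::real_normed_vector \<Rightarrow> 'b::banach"
  assumes "smooth_on UNIV g"
  shows "real (Suc n) *\<^sub>R ray_int n g x + ray_int (Suc n) (\<lambda>y. fderiv g y x) x = g x"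
proof -
  have der: "(g has_derivative fderiv g y) (at y)" for y
    by (rule smooth_on_has_derivative[OF assms UNIV_I])
  have cont: "continuous_on UNIV (\<lambda>y. fderiv g y x)"
    by (intro smooth_on_continuous smooth_on_fderiv assms)
  let ?f = "\<lambda>t. real (Suc n) *\<^sub>R (t ^ n *\<^sub>R g (t *\<^sub>R x)) + t ^ Suc n *\<^sub>R fderiv g (t *\<^sub>R x) x"
  have "((\<lambda>t. t ^ Suc n *\<^sub>R g (t *\<^sub>R x)) has_vector_derivative ?f t) (at t within {0..1})" for t :: real
  proof -
    have "((\<lambda>t. g (t *\<^sub>R x)) has_derivative (\<lambda>k. fderiv g (t *\<^sub>R x) (k *\<^sub>R x))) (at t)"
      by (rule has_derivative_compose[OF _ der]) (auto intro!: derivative_eq_intros)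
    then have 1: "((\<lambda>t. g (t *\<^sub>R x)) has_vector_derivative fderiv g (t *\<^sub>R x) x) (at t)"
      using has_derivative_linear[OF der] by (simp add: has_vector_derivative_def linear_cmul)
    have "((\<lambda>t. t ^ Suc n) has_field_derivative real (Suc n) * t ^ n) (at t)"
      by (auto intro!: derivative_eq_intros simp del: power_Suc)
    from has_vector_derivative_scaleR[OF this 1] show ?thesis
      by (simp add: has_vector_derivative_at_within add.commute)
  qed
  then have "(?f has_integral (1 ^ Suc n *\<^sub>R g (1 *\<^sub>R x) - 0 ^ Suc n *\<^sub>R g (0 *\<^sub>R x))) {0..1}"
    by (intro fundamental_theorem_of_calculus) auto
  then have "integral {0..1} ?f = g x" by (simp add: integral_unique)
  moreover have "integral {0..1} ?f = real (Suc n) *\<^sub>R ray_int n g x + ray_int (Suc n) (\<lambda>y. fderiv g y x) x"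
    unfolding ray_int_def
    using ray_integrand_integrable[OF smooth_on_continuous[OF assms], of n x] ray_integrand_integrable[OF cont, of "Suc n" x]
    by (subst integral_add) (auto intro!: integrable_cmul simp: integral_cmul simp del: scaleR_scaleR)
  ultimately show ?thesis by simp
qed

lemma ray_int_add:
  fixes g :: "'a::real_normed_vector \<Rightarrow> 'b::banach"
  assumes "continuous_on UNIV f" "continuous_on UNIV g"
  shows "ray_int n (\<lambda>y. f y + g y) x = ray_int n f x + ray_int n g x"
  unfolding ray_int_def scaleR_add_right
  by (intro integral_add ray_integrand_integrable assms)

lemma ray_int_scaleR:
  fixes f :: "'a::real_normed_vector \<Rightarrow> 'b::banach"
  shows "ray_int n (\<lambda>y. c *\<^sub>R f y) x = c *\<^sub>R ray_int n f x"
proof -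
  have "ray_int n (\<lambda>y. c *\<^sub>R f y) x = integral {0..1} (\<lambda>t. c *\<^sub>R (t ^ n *\<^sub>R f (t *\<^sub>R x)))"
    unfolding ray_int_def by (simp add: mult.commute)
  then show ?thesis by (simp only: ray_int_def integral_cmul)
qed

subsection \<open>Multilinear families\<close>

lemma bilinear_alt: "bilinear f \<longleftrightarrow> (\<forall>a. linear (f a)) \<and> (\<forall>b. linear (\<lambda>a. f a b))"
  by (auto simp: bilinear_def)

lemma fderiv_linear_slot:
  fixes F :: "'x::real_normed_vector \<Rightarrow> 'a::real_vector \<Rightarrow> 'b::real_normed_vector"
  assumes S: "open S" "x \<in> S" and lin: "\<And>y. y \<in> S \<Longrightarrow> linear (F y)"
    and d: "\<And>a. (\<lambda>y. F y a) differentiable (at x)"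
  shows "linear (\<lambda>a. fderiv (\<lambda>y. F y a) x h)"
proof (rule linearI)
  fix a b :: 'a and c :: real
  have "((\<lambda>y. F y a + F y b) has_derivative (\<lambda>h. fderiv (\<lambda>y. F y a) x h + fderiv (\<lambda>y. F y b) x h)) (at x)"
    by (intro has_derivative_add has_fderiv d)
  then have "((\<lambda>y. F y (a + b)) has_derivative (\<lambda>h. fderiv (\<lambda>y. F y a) x h + fderiv (\<lambda>y. F y b) x h)) (at x)"
    by (rule has_derivative_transform_within_open[OF _ S]) (simp add: linear_add[OF lin])
  then show "fderiv (\<lambda>y. F y (a + b)) x h = fderiv (\<lambda>y. F y a) x h + fderiv (\<lambda>y. F y b) x h"
    by (rule fderiv_eq)
  have "((\<lambda>y. c *\<^sub>R F y a) has_derivative (\<lambda>h. c *\<^sub>R fderiv (\<lambda>y. F y a) x h)) (at x)"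
    by (intro has_derivative_scaleR_right has_fderiv d)
  then have "((\<lambda>y. F y (c *\<^sub>R a)) has_derivative (\<lambda>h. c *\<^sub>R fderiv (\<lambda>y. F y a) x h)) (at x)"
    by (rule has_derivative_transform_within_open[OF _ S]) (simp add: linear_cmul[OF lin])
  then show "fderiv (\<lambda>y. F y (c *\<^sub>R a)) x h = c *\<^sub>R fderiv (\<lambda>y. F y a) x h"
    by (rule fderiv_eq)
qed

lemma has_derivative_bilinear_family:
  fixes F :: "'x::real_normed_vector \<Rightarrow> 'a::real_normed_vector \<Rightarrow> 'c::real_normed_vector \<Rightarrow> 'b::real_normed_vector"
  assumes fd: "fin_dim TYPE('a)" "fin_dim TYPE('c)" and S: "open S" "x \<in> S"
    and lin: "\<And>x. x \<in> S \<Longrightarrow> bilinear (F x)"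
    and F: "\<And>a b. ((\<lambda>x. F x a b) has_derivative F' a b) (at x)"
    and g: "(g has_derivative g') (at x)" and k: "(k has_derivative k') (at x)"
  shows "((\<lambda>x. F x (g x) (k x)) has_derivative
    (\<lambda>h. F' (g x) (k x) h + F x (g x) (k' h) + F x (g' h) (k x))) (at x)"
proof (rule has_derivative_linear_family[OF fd(1) S, of "\<lambda>x a. F x a (k x)" "\<lambda>a h. F' a (k x) h + F x a (k' h)", OF _ _ g])
  show "linear (\<lambda>a. F y a (k y))" if "y \<in> S" for y using lin[OF that] by (simp add: bilinear_alt)
  show "((\<lambda>x. F x a (k x)) has_derivative (\<lambda>h. F' a (k x) h + F x a (k' h))) (at x)" for a
    by (rule has_derivative_linear_family[OF fd(2) S _ F k]) (use lin in \<open>simp add: bilinear_alt\<close>)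
qed

lemma smooth_on_bilinear_family:
  fixes F :: "'x::real_normed_vector \<Rightarrow> 'a::real_normed_vector \<Rightarrow> 'c::real_normed_vector \<Rightarrow> 'b::real_normed_vector"
  assumes fd: "fin_dim TYPE('a)" "fin_dim TYPE('c)" and S: "open S"
    and lin: "\<And>x. x \<in> S \<Longrightarrow> bilinear (F x)"
    and F: "\<And>a b. smooth_on S (\<lambda>x. F x a b)" and g: "smooth_on S g" and k: "smooth_on S k"
  shows "smooth_on S (\<lambda>x. F x (g x) (k x))"
proof (rule smooth_on_linear_family[OF fd(1) S, of "\<lambda>x a. F x a (k x)", OF _ _ g])
  show "linear (\<lambda>a. F y a (k y))" if "y \<in> S" for y using lin[OF that] by (simp add: bilinear_alt)
  show "smooth_on S (\<lambda>x. F x a (k x))" for a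
    by (rule smooth_on_linear_family[OF fd(2) S _ F k]) (use lin in \<open>simp add: bilinear_alt\<close>)
qed

lemma has_derivative_trilinear_family:
  fixes F :: "'x::real_normed_vector \<Rightarrow> 'a::real_normed_vector \<Rightarrow> 'a \<Rightarrow> 'a \<Rightarrow> 'b::real_normed_vector"
  assumes fd: "fin_dim TYPE('a)" and S: "open S" "x \<in> S"
    and lin: "\<And>x a. x \<in> S \<Longrightarrow> bilinear (F x a)" "\<And>x b c. x \<in> S \<Longrightarrow> linear (\<lambda>a. F x a b c)"
    and F: "\<And>a b c. ((\<lambda>x. F x a b c) has_derivative F' a b c) (at x)"
    and g: "(g has_derivative g') (at x)" and k: "(k has_derivative k') (at x)"
    and l: "(l has_derivative l') (at x)"
  shows "((\<lambda>x. F x (g x) (k x) (l x)) has_derivative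
    (\<lambda>h. F' (g x) (k x) (l x) h + F x (g x) (k x) (l' h) + F x (g x) (k' h) (l x) + F x (g' h) (k x) (l x))) (at x)"
  by (rule has_derivative_linear_family[OF fd(1) S, of "\<lambda>x a. F x a (k x) (l x)"
      "\<lambda>a h. F' a (k x) (l x) h + F x a (k x) (l' h) + F x a (k' h) (l x)", OF _ _ g])
    (use lin in \<open>auto intro!: has_derivative_bilinear_family[OF fd fd S _ F k l]\<close>)

lemma smooth_on_trilinear_family:
  fixes F :: "'x::real_normed_vector \<Rightarrow> 'a::real_normed_vector \<Rightarrow> 'a \<Rightarrow> 'a \<Rightarrow> 'b::real_normed_vector"
  assumes fd: "fin_dim TYPE('a)" and S: "open S"
    and lin: "\<And>x a. x \<in> S \<Longrightarrow> bilinear (F x a)" "\<And>x b c. x \<in> S \<Longrightarrow> linear (\<lambda>a. F x a b c)"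
    and F: "\<And>a b c. smooth_on S (\<lambda>x. F x a b c)"
    and g: "smooth_on S g" and k: "smooth_on S k" and l: "smooth_on S l"
  shows "smooth_on S (\<lambda>x. F x (g x) (k x) (l x))"
  by (rule smooth_on_linear_family[OF fd(1) S, of "\<lambda>x a. F x a (k x) (l x)", OF _ _ g])
    (use lin in \<open>auto intro!: smooth_on_bilinear_family[OF fd fd S _ F k l]\<close>)

subsection \<open>Differential forms of low degree in coordinates\<close>

text \<open>A \<open>k\<close>-form in coordinates is a curried family \<open>f x a\<^sub>1 \<dots> a\<^sub>k\<close> with exterior derivative \<open>ldk f\<close> and
  pullback \<open>pbk T f\<close>. Only \<open>k \<le> 3\<close> occurs, and for fixed small \<open>k\<close> the cancellations between
  second derivatives are plain linear identities.\<close>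

definition lform1 :: "'a::real_normed_vector set \<Rightarrow> ('a \<Rightarrow> 'a \<Rightarrow> 'b::real_normed_vector) \<Rightarrow> bool" where
  "lform1 S f \<longleftrightarrow> (\<forall>x\<in>S. linear (f x)) \<and> (\<forall>a. smooth_on S (\<lambda>x. f x a))"

definition lform2 :: "'a::real_normed_vector set \<Rightarrow> ('a \<Rightarrow> 'a \<Rightarrow> 'a \<Rightarrow> 'b::real_normed_vector) \<Rightarrow> bool" where
  "lform2 S f \<longleftrightarrow> (\<forall>x\<in>S. bilinear (f x) \<and> (\<forall>a. f x a a = 0)) \<and> (\<forall>a b. smooth_on S (\<lambda>x. f x a b))"

text \<open>Vanishing on equal neighbours suffices: antisymmetry in neighbouring slots moves equal
  outer arguments together.\<close>

definition lform3 :: "'a::real_normed_vector set \<Rightarrow> ('a \<Rightarrow> 'a \<Rightarrow> 'a \<Rightarrow> 'a \<Rightarrow> 'b::real_normed_vector) \<Rightarrow> bool" where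
  "lform3 S f \<longleftrightarrow> (\<forall>x\<in>S. (\<forall>a. bilinear (f x a)) \<and> (\<forall>b c. linear (\<lambda>a. f x a b c)) \<and>
      (\<forall>a b. f x a a b = 0 \<and> f x a b b = 0)) \<and> (\<forall>a b c. smooth_on S (\<lambda>x. f x a b c))"

definition ld1 :: "('a::real_normed_vector \<Rightarrow> 'a \<Rightarrow> 'b::real_normed_vector) \<Rightarrow> 'a \<Rightarrow> 'a \<Rightarrow> 'a \<Rightarrow> 'b" where
  "ld1 f x a b = fderiv (\<lambda>y. f y b) x a - fderiv (\<lambda>y. f y a) x b"

definition ld2 :: "('a::real_normed_vector \<Rightarrow> 'a \<Rightarrow> 'a \<Rightarrow> 'b::real_normed_vector) \<Rightarrow> 'a \<Rightarrow> 'a \<Rightarrow> 'a \<Rightarrow> 'a \<Rightarrow> 'b" where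
  "ld2 f x a b c = fderiv (\<lambda>y. f y b c) x a - fderiv (\<lambda>y. f y a c) x b + fderiv (\<lambda>y. f y a b) x c"

definition ld3 :: "('a::real_normed_vector \<Rightarrow> 'a \<Rightarrow> 'a \<Rightarrow> 'a \<Rightarrow> 'b::real_normed_vector) \<Rightarrow>
    'a \<Rightarrow> 'a \<Rightarrow> 'a \<Rightarrow> 'a \<Rightarrow> 'a \<Rightarrow> 'b" where
  "ld3 f x a b c e = fderiv (\<lambda>y. f y b c e) x a - fderiv (\<lambda>y. f y a c e) x b +
     fderiv (\<lambda>y. f y a b e) x c - fderiv (\<lambda>y. f y a b c) x e"

lemma bilinear_alternating_antisym:
  assumes "bilinear f" "\<And>a. f a a = 0"
  shows "f b a = - f a b"
proof -
  have "f (a + b) (a + b) = f a a + f a b + (f b a + f b b)"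
    by (simp add: bilinear_ladd[OF assms(1)] bilinear_radd[OF assms(1)] add_ac)
  then show ?thesis using assms(2) by (simp add: eq_neg_iff_add_eq_0 add.commute)
qed

lemma lform1D:
  assumes "lform1 S f"
  shows "x \<in> S \<Longrightarrow> linear (f x)" "smooth_on S (\<lambda>x. f x a)"
  using assms by (simp_all add: lform1_def)

lemma lform2D:
  assumes "lform2 S f"
  shows "x \<in> S \<Longrightarrow> bilinear (f x)" "x \<in> S \<Longrightarrow> linear (f x a)" "x \<in> S \<Longrightarrow> linear (\<lambda>a. f x a b)"
    "x \<in> S \<Longrightarrow> f x a a = 0" "smooth_on S (\<lambda>x. f x a b)"
  using assms by (simp_all add: lform2_def bilinear_alt)

lemma lform3D:
  assumes "lform3 S f"
  shows "x \<in> S \<Longrightarrow> bilinear (f x a)" "x \<in> S \<Longrightarrow> linear (f x a b)" "x \<in> S \<Longrightarrow> linear (\<lambda>b. f x a b c)"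
    "x \<in> S \<Longrightarrow> linear (\<lambda>a. f x a b c)"
    "x \<in> S \<Longrightarrow> f x a a b = 0" "x \<in> S \<Longrightarrow> f x a b b = 0" "smooth_on S (\<lambda>x. f x a b c)"
  using assms by (simp_all add: lform3_def bilinear_alt)

lemma lform2_antisym: "lform2 S f \<Longrightarrow> x \<in> S \<Longrightarrow> f x b a = - f x a b"
  by (rule bilinear_alternating_antisym[of "f x"]) (rule lform2D; assumption)+

lemma lform3_antisym:
  assumes "lform3 S f" "x \<in> S"
  shows "f x b a c = - f x a b c" "f x a c b = - f x a b c"
proof -
  have "bilinear (\<lambda>a b. f x a b c)" unfolding bilinear_alt by (intro conjI allI lform3D(1-6)[OF assms])
  then show "f x b a c = - f x a b c"
    by (rule bilinear_alternating_antisym) (rule lform3D(1-6)[OF assms])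
  show "f x a c b = - f x a b c"
    by (rule bilinear_alternating_antisym[of "f x a"]) (rule lform3D(1-6)[OF assms])+
qed

lemma lform1_fderiv_linear:
  assumes "open S" "lform1 S f" "x \<in> S"
  shows "linear (\<lambda>a. fderiv (\<lambda>y. f y a) x h)" "linear (fderiv (\<lambda>y. f y a) x)"
  by (rule fderiv_linear_slot[OF assms(1,3) lform1D(1)[OF assms(2)] smooth_on_differentiable[OF lform1D(2)[OF assms(2)] assms(3)]])
    (auto intro!: linear_frechet_derivative smooth_on_differentiable[OF lform1D(2)[OF assms(2)] assms(3)])

lemma lform2_fderiv_linear:
  assumes "open S" "lform2 S f" "x \<in> S"
  shows "linear (\<lambda>a. fderiv (\<lambda>y. f y a b) x h)" "linear (\<lambda>b. fderiv (\<lambda>y. f y a b) x h)"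
    "linear (fderiv (\<lambda>y. f y a b) x)"
proof -
  note d = smooth_on_differentiable[OF lform2D(5)[OF assms(2)] assms(3)]
  show "linear (\<lambda>a. fderiv (\<lambda>y. f y a b) x h)"
    by (rule fderiv_linear_slot[OF assms(1,3) lform2D(3)[OF assms(2)] d])
  show "linear (\<lambda>b. fderiv (\<lambda>y. f y a b) x h)"
    by (rule fderiv_linear_slot[OF assms(1,3) lform2D(2)[OF assms(2)] d])
  show "linear (fderiv (\<lambda>y. f y a b) x)"
    by (rule linear_frechet_derivative[OF d])
qed

lemma lform2_fderiv_alt:
  assumes "open S" "lform2 S f" "x \<in> S"
  shows "fderiv (\<lambda>y. f y a a) x h = 0"
  using fderiv_cong_open[OF assms(1,3), of "\<lambda>y. f y a a" "\<lambda>y. 0"] lform2D(4)[OF assms(2)] by simp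

lemma lform2_ld1:
  assumes "open S" "lform1 S f"
  shows "lform2 S (ld1 f)"
  unfolding lform2_def
proof (intro conjI ballI allI)
  fix x assume x: "x \<in> S"
  note l = lform1_fderiv_linear[OF assms x]
  show "bilinear (ld1 f x)" unfolding bilinear_alt ld1_def
    by (intro conjI allI linear_compose_sub l)
  show "ld1 f x a a = 0" for a by (simp add: ld1_def)
next
  show "smooth_on S (\<lambda>x. ld1 f x a b)" for a b
    unfolding ld1_def by (intro smooth_on_diff[OF assms(1)] smooth_on_fderiv lform1D[OF assms(2)])
qed

lemma lform3_ld2:
  assumes "open S" "lform2 S f"
  shows "lform3 S (ld2 f)"
  unfolding lform3_def
proof (intro conjI ballI allI)
  fix x assume x: "x \<in> S"
  note l = lform2_fderiv_linear[OF assms x]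
  show "bilinear (ld2 f x a)" for a unfolding bilinear_alt ld2_def
    by (intro conjI allI linear_compose_sub linear_compose_add l)
  show "linear (\<lambda>a. ld2 f x a b c)" for b c unfolding ld2_def
    by (intro conjI allI linear_compose_sub linear_compose_add l)
  show "ld2 f x a a b = 0" "ld2 f x a b b = 0" for a b
    using lform2_fderiv_alt[OF assms x] by (simp_all add: ld2_def)
next
  show "smooth_on S (\<lambda>x. ld2 f x a b c)" for a b c
    unfolding ld2_def
    by (intro smooth_on_diff[OF assms(1)] smooth_on_add[OF assms(1)] smooth_on_fderiv lform2D[OF assms(2)])
qed

text \<open>The twelve second derivatives cancel in six pairs, one for each pair of
  directions.\<close>

lemma ld3_ld2:
  assumes S: "open S" and f: "lform2 S f" and x: "x \<in> S"
  shows "ld3 (ld2 f) x a b c e = 0"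
proof -
  have sm: "smooth_on S (\<lambda>y. f y a b)" for a b using f by (simp add: lform2_def)
  have der: "((\<lambda>y. fderiv (\<lambda>y. f y a b) y v) has_derivative fderiv (\<lambda>y. fderiv (\<lambda>y. f y a b) y v) x) (at x)" for a b v
    by (rule smooth_on_has_derivative[OF smooth_on_fderiv[OF sm] x])
  have "fderiv (\<lambda>y. ld2 f y a b c) x h = fderiv (\<lambda>y. fderiv (\<lambda>y. f y b c) y a) x h
    - fderiv (\<lambda>y. fderiv (\<lambda>y. f y a c) y b) x h + fderiv (\<lambda>y. fderiv (\<lambda>y. f y a b) y c) x h" for a b c h
    unfolding ld2_def by (rule fderiv_eq) (intro has_derivative_add has_derivative_diff der)
  note d = this
  show ?thesis unfolding ld3_def d
    by (simp add: second_derivative_symmetric[OF S sm x, of _ _ b a] second_derivative_symmetric[OF S sm x, of _ _ c a]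
       second_derivative_symmetric[OF S sm x, of _ _ e a] second_derivative_symmetric[OF S sm x, of _ _ c b]
       second_derivative_symmetric[OF S sm x, of _ _ e b] second_derivative_symmetric[OF S sm x, of _ _ e c])
qed

definition pb1 :: "('a::real_normed_vector \<Rightarrow> 'c::real_normed_vector) \<Rightarrow> ('c \<Rightarrow> 'c \<Rightarrow> 'b) \<Rightarrow> 'a \<Rightarrow> 'a \<Rightarrow> 'b" where
  "pb1 T f x a = f (T x) (fderiv T x a)"
definition pb2 :: "('a::real_normed_vector \<Rightarrow> 'c::real_normed_vector) \<Rightarrow> ('c \<Rightarrow> 'c \<Rightarrow> 'c \<Rightarrow> 'b) \<Rightarrow> 'a \<Rightarrow> 'a \<Rightarrow> 'a \<Rightarrow> 'b" where
  "pb2 T f x a b = f (T x) (fderiv T x a) (fderiv T x b)"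
definition pb3 :: "('a::real_normed_vector \<Rightarrow> 'c::real_normed_vector) \<Rightarrow> ('c \<Rightarrow> 'c \<Rightarrow> 'c \<Rightarrow> 'c \<Rightarrow> 'b) \<Rightarrow> 'a \<Rightarrow> 'a \<Rightarrow> 'a \<Rightarrow> 'a \<Rightarrow> 'b" where
  "pb3 T f x a b c = f (T x) (fderiv T x a) (fderiv T x b) (fderiv T x c)"

context
  fixes S :: "'a::real_normed_vector set" and S' :: "'c::real_normed_vector set" and T
  assumes fd: "fin_dim TYPE('c)" and S: "open S" and S': "open S'" and TS: "T ` S \<subseteq> S'" and T: "smooth_on S T"
begin

lemma smooth_on_pb: "smooth_on S' f \<Longrightarrow> smooth_on S (\<lambda>x. f (T x))"
  by (rule smooth_on_compose[OF fd S S' TS _ T])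

lemma pb_in: "x \<in> S \<Longrightarrow> T x \<in> S'" using TS by blast

lemma linear_fderiv_pb: "x \<in> S \<Longrightarrow> linear (fderiv T x)"
  by (rule linear_frechet_derivative) (rule smooth_on_differentiable[OF T])

lemma has_derivative_pb:
  "smooth_on S' f \<Longrightarrow> x \<in> S \<Longrightarrow> ((\<lambda>y. f (T y)) has_derivative (\<lambda>h. fderiv f (T x) (fderiv T x h))) (at x)"
  by (rule has_derivative_compose[OF smooth_on_has_derivative[OF T] smooth_on_has_derivative]) (auto simp: pb_in)

lemma fderiv_pb_has_derivative:
  "x \<in> S \<Longrightarrow> ((\<lambda>y. fderiv T y a) has_derivative fderiv (\<lambda>y. fderiv T y a) x) (at x)"
  by (rule smooth_on_has_derivative[OF smooth_on_fderiv[OF T]])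

lemma lform1_pb: 
  assumes "lform1 S' f"
  shows "lform1 S (pb1 T f)"
  unfolding lform1_def pb1_def
proof (intro conjI ballI allI)
  show "linear (\<lambda>a. f (T x) (fderiv T x a))" if "x \<in> S" for x
    using linear_compose[OF linear_fderiv_pb[OF that] lform1D(1)[OF assms pb_in[OF that]]] by (simp add: o_def)
  show "smooth_on S (\<lambda>x. f (T x) (fderiv T x a))" for a
    by (rule smooth_on_linear_family[OF fd S])
      (auto intro: lform1D[OF assms] pb_in smooth_on_pb smooth_on_fderiv T)
qed

lemma lform2_pb:
  assumes "lform2 S' f"
  shows "lform2 S (pb2 T f)"
  unfolding lform2_def pb2_def bilinear_alt
proof (intro conjI ballI allI)
  fix x assume x: "x \<in> S"
  show "linear (\<lambda>b. f (T x) (fderiv T x a) (fderiv T x b))" for a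
    using linear_compose[OF linear_fderiv_pb[OF x] lform2D(2)[OF assms pb_in[OF x]]] by (simp add: o_def)
  show "linear (\<lambda>a. f (T x) (fderiv T x a) (fderiv T x b))" for b
    using linear_compose[OF linear_fderiv_pb[OF x] lform2D(3)[OF assms pb_in[OF x]]] by (simp add: o_def)
  show "f (T x) (fderiv T x a) (fderiv T x a) = 0" for a by (rule lform2D(4)[OF assms pb_in[OF x]])
next
  show "smooth_on S (\<lambda>x. f (T x) (fderiv T x a) (fderiv T x b))" for a b
    by (rule smooth_on_bilinear_family[OF fd fd S])
      (auto intro: lform2D[OF assms] pb_in smooth_on_pb smooth_on_fderiv T)
qed

lemma lform3_pb:
  assumes "lform3 S' f"
  shows "lform3 S (pb3 T f)"
  unfolding lform3_def pb3_def bilinear_alt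
proof (intro conjI ballI allI)
  fix x assume x: "x \<in> S"
  note f = lform3D[OF assms]
  show "linear (\<lambda>e. f (T x) (fderiv T x a) (fderiv T x b) (fderiv T x e))" for a b
    using linear_compose[OF linear_fderiv_pb[OF x] f(2)[OF pb_in[OF x]]] by (simp add: o_def)
  show "linear (\<lambda>b. f (T x) (fderiv T x a) (fderiv T x b) (fderiv T x e))" for a e
    using linear_compose[OF linear_fderiv_pb[OF x] f(3)[OF pb_in[OF x]]] by (simp add: o_def)
  show "linear (\<lambda>a. f (T x) (fderiv T x a) (fderiv T x b) (fderiv T x e))" for b e
    using linear_compose[OF linear_fderiv_pb[OF x] f(4)[OF pb_in[OF x]]] by (simp add: o_def)
  show "f (T x) (fderiv T x a) (fderiv T x a) (fderiv T x b) = 0"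
    "f (T x) (fderiv T x a) (fderiv T x b) (fderiv T x b) = 0" for a b
    by (rule f(5)[OF pb_in[OF x]], rule f(6)[OF pb_in[OF x]])
next
  show "smooth_on S (\<lambda>x. f (T x) (fderiv T x a) (fderiv T x b) (fderiv T x c))" for a b c
    by (rule smooth_on_trilinear_family[OF fd S])
      (auto intro: lform3D[OF assms] pb_in smooth_on_pb smooth_on_fderiv T)
qed

text \<open>Differentiating a pullback produces second derivatives of \<open>T\<close> besides the
  expected term. They are symmetric and cancel in the alternating sum; in degrees 2 and 3 this also
  uses the antisymmetry of \<open>f\<close>.\<close>

lemma ld1_pb:
  assumes f: "lform1 S' f" and x: "x \<in> S"
  shows "ld1 (pb1 T f) x a b = ld1 f (T x) (fderiv T x a) (fderiv T x b)"
proof -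
  have "fderiv (\<lambda>y. pb1 T f y b) x h = fderiv (\<lambda>z. f z (fderiv T x b)) (T x) (fderiv T x h)
      + f (T x) (fderiv (\<lambda>y. fderiv T y b) x h)" for b h
    unfolding pb1_def
    by (rule fderiv_eq, rule has_derivative_linear_family[OF fd S x _ has_derivative_pb[OF _ x] fderiv_pb_has_derivative[OF x]])
      (use f in \<open>auto simp: lform1_def pb_in\<close>)
  then show ?thesis using second_derivative_symmetric[OF S T x, of a b] by (simp add: ld1_def)
qed

lemma ld2_pb:
  assumes f: "lform2 S' f" and x: "x \<in> S"
  shows "ld2 (pb2 T f) x a b c = ld2 f (T x) (fderiv T x a) (fderiv T x b) (fderiv T x c)"
proof -
  have "fderiv (\<lambda>y. pb2 T f y b c) x h = fderiv (\<lambda>z. f z (fderiv T x b) (fderiv T x c)) (T x) (fderiv T x h)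
      + f (T x) (fderiv T x b) (fderiv (\<lambda>y. fderiv T y c) x h)
      + f (T x) (fderiv (\<lambda>y. fderiv T y b) x h) (fderiv T x c)" for b c h
    unfolding pb2_def
    by (rule fderiv_eq, rule has_derivative_bilinear_family[OF fd fd S x _ has_derivative_pb[OF _ x]
          fderiv_pb_has_derivative[OF x] fderiv_pb_has_derivative[OF x]])
      (use f in \<open>auto simp: lform2_def pb_in\<close>)
  moreover have "f (T x) (fderiv T x u) (fderiv (\<lambda>y. fderiv T y v) x w) = - f (T x) (fderiv (\<lambda>y. fderiv T y v) x w) (fderiv T x u)" for u v w
    by (rule lform2_antisym[OF f pb_in[OF x]])
  ultimately show ?thesis
    using second_derivative_symmetric[OF S T x, of b a] second_derivative_symmetric[OF S T x, of c a]
      second_derivative_symmetric[OF S T x, of c b]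
    by (simp add: ld2_def)
qed

lemma ld3_pb:
  assumes f: "lform3 S' f" and x: "x \<in> S"
  shows "ld3 (pb3 T f) x a b c e = ld3 f (T x) (fderiv T x a) (fderiv T x b) (fderiv T x c) (fderiv T x e)"
proof -
  let ?D = "\<lambda>a b. fderiv (\<lambda>y. fderiv T y a) x b"
  have d: "fderiv (\<lambda>y. pb3 T f y b c e) x h = fderiv (\<lambda>z. f z (fderiv T x b) (fderiv T x c) (fderiv T x e)) (T x) (fderiv T x h)
      + f (T x) (fderiv T x b) (fderiv T x c) (?D e h)
      + f (T x) (fderiv T x b) (?D c h) (fderiv T x e)
      + f (T x) (?D b h) (fderiv T x c) (fderiv T x e)" for b c e h
    unfolding pb3_def
    by (rule fderiv_eq, rule has_derivative_trilinear_family[OF fd S x _ _ has_derivative_pb[OF _ x]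
          fderiv_pb_has_derivative[OF x] fderiv_pb_has_derivative[OF x] fderiv_pb_has_derivative[OF x]])
      (use f in \<open>auto simp: lform3_def pb_in\<close>)
  have D: "?D b a = ?D a b" "?D c a = ?D a c" "?D e a = ?D a e" "?D c b = ?D b c" "?D e b = ?D b e" "?D e c = ?D c e"
    by (rule second_derivative_symmetric[OF S T x])+
  define p where "p = f (T x)"
  have 1: "p u v w = - p v u w" "p u v w = - p u w v" for u v w
    unfolding p_def by (rule lform3_antisym[OF f pb_in[OF x]])+
  \<comment> \<open>Every second derivative of \<open>T\<close> is moved to the first slot, where
    cancelling terms become syntactically equal.\<close>
  have 2: "p (fderiv T x u) (?D v w) (fderiv T x z) = - p (?D v w) (fderiv T x u) (fderiv T x z)"
    "p (fderiv T x u) (fderiv T x z) (?D v w) = p (?D v w) (fderiv T x u) (fderiv T x z)" for u v w z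
    by (rule 1(1)) (metis 1 minus_minus)
  have 3: "p (?D v w) (fderiv T x b) (fderiv T x a) = - p (?D v w) (fderiv T x a) (fderiv T x b)" for a b v w
    by (rule 1)
  show ?thesis unfolding ld3_def d D p_def[symmetric] 2 by simp
qed

end

text \<open>The homotopy formula for the radial contraction. Closedness trades the derivatives of
  \<open>f\<close> in the directions \<open>u\<close>, \<open>v\<close>, \<open>w\<close> for its
  derivative in the radial direction, and \<open>ray_int_eq\<close> then recombines the integrals to
  \<open>f\<close>.\<close>

lemma poincare_lemma_3:
  fixes f :: "'a::banach \<Rightarrow> 'a \<Rightarrow> 'a \<Rightarrow> 'a \<Rightarrow> 'b::banach"
  assumes fd: "fin_dim TYPE('a)" and f: "lform3 UNIV f" and closed: "\<And>x a b c e. ld3 f x a b c e = 0"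
  obtains g where "lform2 UNIV g" "\<And>x a b c. ld2 g x a b c = f x a b c"
proof -
  \<comment> \<open>\<open>g x v w\<close> is the integral of \<open>t\<^sup>2 f (t x) x v w\<close> over \<open>0 \<le> t \<le> 1\<close>.\<close>
  define F where "F x a v w = ray_int 2 (\<lambda>y. f y a v w) x" for x a v w
  define g where "g x v w = F x x v w" for x v w
  have lin: "linear (f x a b)" "linear (\<lambda>b. f x a b c)" "linear (\<lambda>a. f x a b c)" for x a b c
    using f by (simp_all add: lform3_def bilinear_alt)
  have sm: "smooth_on UNIV (\<lambda>y. f y a b c)" for a b c using f by (simp add: lform3_def)
  have cont: "continuous_on UNIV (\<lambda>y. f y a b c)" for a b c by (rule smooth_on_continuous[OF sm])
  have linF: "linear (F x a b)" "linear (\<lambda>b. F x a b c)" "linear (\<lambda>a. F x a b c)" for x a b c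
    unfolding F_def by (auto intro!: linearI simp: linear_add[OF lin(1)] linear_cmul[OF lin(1)] linear_add[OF lin(2)]
      linear_cmul[OF lin(2)] linear_add[OF lin(3)] linear_cmul[OF lin(3)] ray_int_add cont ray_int_scaleR)
  have smF: "smooth_on UNIV (\<lambda>x. F x a b c)" for a b c
    unfolding F_def by (rule smooth_on_ray_int[OF fd sm])
  have F_alt: "F x a b a = 0" "F x a a b = 0" "F x a b b = 0" for x a b
  proof -
    have "f y a b a = 0" for y
      using lform3_antisym(2)[OF f UNIV_I, of y a a b] lform3D(5)[OF f UNIV_I] by simp
    then show "F x a b a = 0" "F x a a b = 0" "F x a b b = 0"
      by (simp_all add: F_def ray_int_def lform3D(5,6)[OF f UNIV_I])
  qed
  have g: "lform2 UNIV g"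
    unfolding lform2_def bilinear_alt g_def
    by (intro conjI allI ballI linF F_alt smooth_on_linear_family[OF fd open_UNIV linF(3) smF])
      (auto simp: smooth_on_iff[of _ "\<lambda>x. x"] smooth_on_const)
  have dg: "fderiv (\<lambda>x. g x v w) x u = ray_int 3 (\<lambda>y. fderiv (\<lambda>z. f z x v w) y u) x + F x u v w" for x u v w
  proof (rule fderiv_eq)
    have "((\<lambda>x. F x a v w) has_derivative (\<lambda>h. ray_int 3 (\<lambda>y. fderiv (\<lambda>z. f z a v w) y h) x)) (at x)" for a
      unfolding F_def using ray_int_has_derivative[OF fd sm, of 2] by (simp add: numeral_3_eq_3 numeral_2_eq_2)
    from has_derivative_linear_family[OF fd open_UNIV UNIV_I linF(3) this has_derivative_ident]
    show "((\<lambda>x. g x v w) has_derivative (\<lambda>u. ray_int 3 (\<lambda>y. fderiv (\<lambda>z. f z x v w) y u) x + F x u v w)) (at x)"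
      unfolding g_def .
  qed
  have "ld2 g x u v w = f x u v w" for x u v w
  proof -
    have cd: "continuous_on UNIV (\<lambda>y. fderiv (\<lambda>z. f z a b c) y h)" for a b c h
      by (intro smooth_on_continuous smooth_on_fderiv sm)
    let ?R = "\<lambda>a b c h. ray_int 3 (\<lambda>y. fderiv (\<lambda>z. f z a b c) y h) x"
    have "fderiv (\<lambda>z. f z x v w) y u + (-1) *\<^sub>R fderiv (\<lambda>z. f z x u w) y v + fderiv (\<lambda>z. f z x u v) y w
        = fderiv (\<lambda>z. f z u v w) y x" for y
      using closed[of y x u v w] by (simp add: ld3_def algebra_simps)
    then have "?R u v w x = ray_int 3 (\<lambda>y. fderiv (\<lambda>z. f z x v w) y u + (-1) *\<^sub>R fderiv (\<lambda>z. f z x u w) y v + fderiv (\<lambda>z. f z x u v) y w) x"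
      by simp
    also have "\<dots> = ?R x v w u + (-1) *\<^sub>R ?R x u w v + ?R x u v w"
      by (simp only: ray_int_add ray_int_scaleR cd continuous_on_add continuous_on_scaleR continuous_on_const)
    finally have R: "?R u v w x = ?R x v w u - ?R x u w v + ?R x u v w" by simp
    have F: "F x v u w = - F x u v w" "F x w u v = F x u v w"
    proof -
      have "f y v u w = (-1) *\<^sub>R f y u v w" "f y w u v = f y u v w" for y
        using lform3_antisym[OF f UNIV_I] by (metis minus_minus scaleR_minus1_left)+
      then show "F x v u w = - F x u v w" "F x w u v = F x u v w" unfolding F_def by (simp_all only: ray_int_scaleR) simp
    qed
    \<comment> \<open>The slot filled by \<open>x\<close> is differentiated as well: each of the
      three terms of \<open>ld2\<close> contributes one copy of \<open>F x u v w\<close>, which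
      matches the factor \<open>Suc n\<close> of \<open>ray_int_eq\<close> for
      \<open>n = 2\<close>.\<close>
    have "ld2 g x u v w = 3 *\<^sub>R F x u v w + ?R u v w x"
      unfolding ld2_def dg R F by (simp add: algebra_simps) (simp add: scaleR_left_distrib[of 1 2, simplified] scaleR_2)
    also have "\<dots> = f x u v w"
      using ray_int_eq[OF sm, of 2 u v w x] by (simp add: F_def numeral_3_eq_3 numeral_2_eq_2)
    finally show ?thesis .
  qed
  then show thesis using that g by blast
qed

section \<open>Coordinates on a manifold\<close>

lemma lform1_local:
  assumes "\<And>x. x \<in> S \<Longrightarrow> \<exists>N. open N \<and> x \<in> N \<and> lform1 N f"
  shows "lform1 S f"
  unfolding lform1_def
proof (intro conjI allI ballI)
  show "smooth_on S (\<lambda>x. f x a)" for a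
  proof (rule smooth_on_local)
    fix x assume "x \<in> S"
    then obtain N where N: "open N" "x \<in> N" "lform1 N f" using assms by blast
    then show "\<exists>N. open N \<and> x \<in> N \<and> smooth_on N (\<lambda>x. f x a)" using lform1D(2)[OF N(3)] by blast
  qed
next
  fix x assume "x \<in> S"
  then obtain N where N: "lform1 N f" "x \<in> N" using assms by blast
  show "linear (f x)" by (rule lform1D(1)[OF N])
qed

lemma lform2_local:
  assumes "\<And>x. x \<in> S \<Longrightarrow> \<exists>N. open N \<and> x \<in> N \<and> lform2 N f"
  shows "lform2 S f"
  unfolding lform2_def
proof (intro conjI allI ballI)
  show "smooth_on S (\<lambda>x. f x a b)" for a b
  proof (rule smooth_on_local)
    fix x assume "x \<in> S"
    then obtain N where N: "open N" "x \<in> N" "lform2 N f" using assms by blast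
    then show "\<exists>N. open N \<and> x \<in> N \<and> smooth_on N (\<lambda>x. f x a b)" using lform2D(5)[OF N(3)] by blast
  qed
next
  fix x assume "x \<in> S"
  then obtain N where N: "lform2 N f" "x \<in> N" using assms by blast
  show "bilinear (f x)" by (rule lform2D(1)[OF N])
  show "f x a a = 0" for a by (rule lform2D(4)[OF N])
qed

lemma lform3_local:
  assumes "\<And>x. x \<in> S \<Longrightarrow> \<exists>N. open N \<and> x \<in> N \<and> lform3 N f"
  shows "lform3 S f"
  unfolding lform3_def
proof (intro conjI allI ballI)
  show "smooth_on S (\<lambda>x. f x a b c)" for a b c
  proof (rule smooth_on_local)
    fix x assume "x \<in> S"
    then obtain N where N: "open N" "x \<in> N" "lform3 N f" using assms by blast
    then show "\<exists>N. open N \<and> x \<in> N \<and> smooth_on N (\<lambda>x. f x a b c)" using lform3D(7)[OF N(3)] by blast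
  qed
next
  fix x assume "x \<in> S"
  then obtain N where N: "lform3 N f" "x \<in> N" using assms by blast
  show "bilinear (f x a)" for a by (rule lform3D(1)[OF N])
  show "linear (\<lambda>a. f x a b c)" for b c by (rule lform3D(4)[OF N])
  show "f x a a b = 0" for a b by (rule lform3D(5)[OF N])
  show "f x a b b = 0" for a b by (rule lform3D(6)[OF N])
qed

lemma lform1_cong:
  assumes "open S" "\<And>x a. x \<in> S \<Longrightarrow> f x a = g x a" "lform1 S g" shows "lform1 S f"
proof -
  have "f x = g x" if "x \<in> S" for x using assms(2)[OF that] by blast
  then show ?thesis
    using assms(3) smooth_on_congI[OF assms(1) lform1D(2)[OF assms(3)], of "\<lambda>x. f x _"] by (simp add: lform1_def)
qed

lemma lform2_cong:
  assumes "open S" "\<And>x a b. x \<in> S \<Longrightarrow> f x a b = g x a b" "lform2 S g" shows "lform2 S f"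
proof -
  have "f x = g x" if "x \<in> S" for x using assms(2)[OF that] by blast
  then show ?thesis
    using assms(3) smooth_on_congI[OF assms(1) lform2D(5)[OF assms(3)], of "\<lambda>x. f x _ _"] by (simp add: lform2_def)
qed

lemma lform3_cong:
  assumes "open S" "\<And>x a b c. x \<in> S \<Longrightarrow> f x a b c = g x a b c" "lform3 S g" shows "lform3 S f"
proof -
  have "f x = g x" if "x \<in> S" for x using assms(2)[OF that] by blast
  then show ?thesis
    using assms(3) smooth_on_congI[OF assms(1) lform3D(7)[OF assms(3)], of "\<lambda>x. f x _ _ _"] by (simp add: lform3_def)
qed

lemma ld1_cong:
  assumes "open S" "x \<in> S" "\<And>y a. y \<in> S \<Longrightarrow> f y a = g y a" shows "ld1 f x a b = ld1 g x a b"
  using fderiv_cong_open[OF assms(1,2), of "\<lambda>y. f y _" "\<lambda>y. g y _"] assms(3) by (simp add: ld1_def)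
lemma ld2_cong:
  assumes "open S" "x \<in> S" "\<And>y a b. y \<in> S \<Longrightarrow> f y a b = g y a b" shows "ld2 f x a b c = ld2 g x a b c"
  using fderiv_cong_open[OF assms(1,2), of "\<lambda>y. f y _ _" "\<lambda>y. g y _ _"] assms(3) by (simp add: ld2_def)
lemma ld3_cong:
  assumes "open S" "x \<in> S" "\<And>y a b c. y \<in> S \<Longrightarrow> f y a b c = g y a b c" shows "ld3 f x a b c e = ld3 g x a b c e"
  using fderiv_cong_open[OF assms(1,2), of "\<lambda>y. f y _ _ _" "\<lambda>y. g y _ _ _"] assms(3) by (simp add: ld3_def)

lemma chart_inv_left: "is_chart c \<Longrightarrow> p \<in> fst c \<Longrightarrow> chart_inv c (snd c p) = p"
  unfolding is_chart_def homeomorphism_def by blast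

lemma open_chart_image:
  assumes "is_chart c" "open W"
  shows "open (snd c ` (fst c \<inter> W))"
proof -
  have "snd c ` (fst c \<inter> W) = chart_inv c -` W \<inter> snd c ` fst c"
    using chart_inv_left[OF assms(1)] by auto
  moreover have "continuous_on (snd c ` fst c) (chart_inv c)" "open (snd c ` fst c)"
    using assms(1) by (auto simp: is_chart_def homeomorphism_def)
  ultimately show ?thesis using assms(2) continuous_on_open_vimage by metis
qed

section \<open>Charts, coordinate changes and tangent vectors\<close>

locale mfd =
  fixes \<A> :: "('m::{t2_space,second_countable_topology}, 'e::banach) chart set"
  assumes manifold: "smooth_manifold \<A>"
begin

lemma fd: "fin_dim TYPE('e)" using manifold by (simp add: smooth_manifold_def)

text \<open>The charts provided by a good cover are compatible with the atlas but need not belong to it.\<close>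

definition adm :: "('m, 'e) chart \<Rightarrow> bool" where
  "adm c \<longleftrightarrow> is_chart c \<and> (\<forall>c'\<in>\<A>. compatible c' c)"

definition jac :: "('m, 'e) chart \<Rightarrow> ('m, 'e) chart \<Rightarrow> 'm \<Rightarrow> 'e \<Rightarrow> 'e" where
  "jac c c' p = fderiv (transition c c') (snd c p)"

lemma adm_atlas: "c \<in> \<A> \<Longrightarrow> adm c"
  using manifold by (auto simp: smooth_manifold_def adm_def)

lemma adm_chart: "adm c \<Longrightarrow> is_chart c" by (simp add: adm_def)

lemma open_dom: "adm c \<Longrightarrow> open (fst c)" by (simp add: adm_def is_chart_def)

lemma open_img: "adm c \<Longrightarrow> open W \<Longrightarrow> open (snd c ` (fst c \<inter> W))"
  by (simp add: adm_def open_chart_image)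

lemma chart_at_in: "chart_at \<A> p \<in> charts_at \<A> p"
proof -
  have "p \<in> (\<Union>c\<in>\<A>. fst c)" using manifold by (simp add: smooth_manifold_def)
  then have "\<exists>c. c \<in> charts_at \<A> p" by (auto simp: charts_at_def)
  then show ?thesis unfolding chart_at_def by (rule someI_ex)
qed

lemma chart_at: "chart_at \<A> p \<in> \<A>" "p \<in> fst (chart_at \<A> p)" "adm (chart_at \<A> p)"
  using chart_at_in[of p] by (auto simp: charts_at_def adm_atlas)

lemma charts_atD: "c \<in> charts_at \<A> p \<Longrightarrow> adm c \<and> p \<in> fst c"
  by (auto simp: charts_at_def adm_atlas)

lemma transition_at: "adm c \<Longrightarrow> p \<in> fst c \<Longrightarrow> transition c c' (snd c p) = snd c' p"
  by (simp add: transition_def chart_inv_left adm_chart)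

text \<open>Admissible charts are compatible with the atlas, but by definition not with each other.
  Near each point the transition factors through an atlas chart.\<close>

lemma smooth_transition:
  assumes "adm c" "adm c'"
  shows "smooth_on (snd c ` (fst c \<inter> fst c')) (transition c c')"
proof (rule smooth_on_local)
  fix x assume "x \<in> snd c ` (fst c \<inter> fst c')"
  then obtain p where p: "p \<in> fst c" "p \<in> fst c'" "x = snd c p" by blast
  define d where "d = chart_at \<A> p"
  have d: "adm d" "p \<in> fst d" "d \<in> \<A>" using chart_at d_def by auto
  define N where "N = snd c ` (fst c \<inter> (fst c' \<inter> fst d))"
  have N: "open N" unfolding N_def by (intro open_img open_Int open_dom assms d)
  have "smooth_on (snd c ` (fst c \<inter> fst d)) (transition c d)" "smooth_on (snd d ` (fst d \<inter> fst c')) (transition d c')"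
    using assms d by (auto simp: adm_def compatible_def Int_commute)
  then have "smooth_on N (\<lambda>x. transition d c' (transition c d x))"
    by (intro smooth_on_compose[OF fd N open_img[OF d(1) open_dom[OF assms(2)]], where f = "transition d c'"])
      (auto simp: N_def transition_at assms intro: smooth_on_subset)
  then have "smooth_on N (transition c c')"
    by (rule smooth_on_congI[OF N]) (auto simp: N_def transition_at assms d)
  then show "\<exists>T. open T \<and> x \<in> T \<and> smooth_on T (transition c c')"
    using N p d by (intro exI[of _ N]) (auto simp: N_def)
qed

lemma transition_has_derivative:
  "adm c \<Longrightarrow> adm c' \<Longrightarrow> p \<in> fst c \<Longrightarrow> p \<in> fst c' \<Longrightarrow> (transition c c' has_derivative jac c c' p) (at (snd c p))"
  unfolding jac_def by (rule smooth_on_has_derivative[OF smooth_transition]) auto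

lemma linear_jac: "adm c \<Longrightarrow> adm c' \<Longrightarrow> p \<in> fst c \<Longrightarrow> p \<in> fst c' \<Longrightarrow> linear (jac c c' p)"
  using transition_has_derivative has_derivative_linear by blast

lemma jac_jac:
  assumes "adm c" "adm c'" "adm c''" "p \<in> fst c" "p \<in> fst c'" "p \<in> fst c''"
  shows "jac c' c'' p (jac c c' p e) = jac c c'' p e"
proof -
  have "((\<lambda>x. transition c' c'' (transition c c' x)) has_derivative (\<lambda>e. jac c' c'' p (jac c c' p e))) (at (snd c p))"
    by (rule has_derivative_compose[OF transition_has_derivative])
      (use assms transition_has_derivative[of c' c'' p] in \<open>auto simp: transition_at\<close>)
  then have "(transition c c'' has_derivative (\<lambda>e. jac c' c'' p (jac c c' p e))) (at (snd c p))"
    by (rule has_derivative_transform_within_open[where s = "snd c ` (fst c \<inter> (fst c' \<inter> fst c''))"])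
      (use assms in \<open>auto intro!: open_img open_dom simp: transition_at\<close>)
  then show ?thesis unfolding jac_def[of c c''] by (simp add: fderiv_eq)
qed

lemma jac_self:
  assumes "adm c" "p \<in> fst c"
  shows "jac c c p e = e"
proof -
  have "((\<lambda>x. x) has_derivative (\<lambda>e. e)) (at (snd c p))" by (rule has_derivative_ident)
  then have "(transition c c has_derivative (\<lambda>e. e)) (at (snd c p))"
    by (rule has_derivative_transform_within_open[where s = "snd c ` (fst c \<inter> UNIV)"])
      (use assms open_img[OF assms(1), of UNIV] in \<open>auto simp: transition_at\<close>)
  then show ?thesis unfolding jac_def by (simp add: fderiv_eq)
qed

lemma tangent_space_iff: "v \<in> tangent_space \<A> p \<longleftrightarrow>
    (\<forall>c\<in>charts_at \<A> p. \<forall>c'\<in>charts_at \<A> p. v c' = jac c c' p (v c)) \<and> (\<forall>c. c \<notin> charts_at \<A> p \<longrightarrow> v c = 0)"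
  by (simp add: tangent_space_def jac_def)

lemma tangent_of_eq: "tangent_of \<A> p c e = (\<lambda>c'. if c' \<in> charts_at \<A> p then jac c c' p e else 0)"
  unfolding tangent_of_def jac_def ..

lemma tangent_of_in: "adm c \<Longrightarrow> p \<in> fst c \<Longrightarrow> tangent_of \<A> p c e \<in> tangent_space \<A> p"
  unfolding tangent_space_iff tangent_of_eq using jac_jac charts_atD by auto

lemma tangent_of_change:
  "adm c \<Longrightarrow> adm c' \<Longrightarrow> p \<in> fst c \<Longrightarrow> p \<in> fst c' \<Longrightarrow> tangent_of \<A> p c e = tangent_of \<A> p c' (jac c c' p e)"
  unfolding tangent_of_eq using jac_jac charts_atD by (intro ext) auto

text \<open>A tangent vector stores entries only for atlas charts around \<open>p\<close>. Its
  coordinates in any other admissible chart are computed from the entry at the chosen chart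
  \<open>chart_at\<close>.\<close>

definition tcoord :: "('m, 'e) chart \<Rightarrow> 'm \<Rightarrow> ('m, 'e) tvec \<Rightarrow> 'e" where
  "tcoord c p v = jac (chart_at \<A> p) c p (v (chart_at \<A> p))"

lemma tangent_of_tcoord:
  assumes "adm c" "p \<in> fst c" "v \<in> tangent_space \<A> p"
  shows "tangent_of \<A> p c (tcoord c p v) = v"
proof
  fix c'
  show "tangent_of \<A> p c (tcoord c p v) c' = v c'"
  proof (cases "c' \<in> charts_at \<A> p")
    case True
    then have "v c' = jac (chart_at \<A> p) c' p (v (chart_at \<A> p))"
      using assms(3) chart_at_in[of p] unfolding tangent_space_iff by blast
    moreover have "tangent_of \<A> p c (tcoord c p v) c' = jac c c' p (jac (chart_at \<A> p) c p (v (chart_at \<A> p)))"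
      using True by (simp add: tangent_of_eq tcoord_def)
    moreover have "\<dots> = jac (chart_at \<A> p) c' p (v (chart_at \<A> p))"
      using assms charts_atD[OF True] chart_at by (intro jac_jac) auto
    ultimately show ?thesis by metis
  next
    case False
    then have "v c' = 0" using assms(3) unfolding tangent_space_iff by blast
    then show ?thesis using False by (simp add: tangent_of_eq)
  qed
qed

lemma tcoord_tangent_of: "adm c \<Longrightarrow> p \<in> fst c \<Longrightarrow> tcoord c p (tangent_of \<A> p c e) = e"
  using chart_at chart_at_in by (simp add: tcoord_def tangent_of_eq jac_jac jac_self)

lemma tcoord_atlas: "c \<in> charts_at \<A> p \<Longrightarrow> v \<in> tangent_space \<A> p \<Longrightarrow> tcoord c p v = v c"
  unfolding tcoord_def tangent_space_iff using chart_at_in by metis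

lemma tangent_of_atlas: "c \<in> charts_at \<A> p \<Longrightarrow> tangent_of \<A> p c e c = e"
  using charts_atD by (simp add: tangent_of_eq jac_self)

lemma tangent_of_coord: "c \<in> charts_at \<A> p \<Longrightarrow> v \<in> tangent_space \<A> p \<Longrightarrow> tangent_of \<A> p c (v c) = v"
  using tangent_of_tcoord[of c p v] tcoord_atlas charts_atD by auto

lemma components_at: "adm c \<Longrightarrow> p \<in> fst c \<Longrightarrow> components \<A> c \<omega> (snd c p) es = \<omega> p (map (tangent_of \<A> p c) es)"
  by (simp add: components_def chart_inv_left adm_chart)

lemma components_change:
  assumes "adm c" "adm c'" "p \<in> fst c" "p \<in> fst c'"
  shows "components \<A> c \<omega> (snd c p) es = components \<A> c' \<omega> (snd c' p) (map (jac c c' p) es)"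
proof -
  have "tangent_of \<A> p c = (\<lambda>e. tangent_of \<A> p c' (jac c c' p e))"
    using tangent_of_change[OF assms] by blast
  then show ?thesis by (simp add: components_at assms o_def)
qed

section \<open>Components of tensor fields and forms in charts\<close>

abbreviation cmp1 :: "('m, 'e) chart \<Rightarrow> ('m, 'e, 'b) tensor \<Rightarrow> 'e \<Rightarrow> 'e \<Rightarrow> 'b" where
  "cmp1 c \<omega> \<equiv> (\<lambda>x a. components \<A> c \<omega> x [a])"
abbreviation cmp2 :: "('m, 'e) chart \<Rightarrow> ('m, 'e, 'b) tensor \<Rightarrow> 'e \<Rightarrow> 'e \<Rightarrow> 'e \<Rightarrow> 'b" where
  "cmp2 c \<omega> \<equiv> (\<lambda>x a b. components \<A> c \<omega> x [a, b])"
abbreviation cmp3 :: "('m, 'e) chart \<Rightarrow> ('m, 'e, 'b) tensor \<Rightarrow> 'e \<Rightarrow> 'e \<Rightarrow> 'e \<Rightarrow> 'e \<Rightarrow> 'b" where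
  "cmp3 c \<omega> \<equiv> (\<lambda>x a b e. components \<A> c \<omega> x [a, b, e])"

lemma cmp_change:
  assumes "adm c" "adm c'" "x \<in> snd c ` (fst c \<inter> fst c')"
  shows "cmp1 c \<omega> x a = pb1 (transition c c') (cmp1 c' \<omega>) x a"
    "cmp2 c \<omega> x a b = pb2 (transition c c') (cmp2 c' \<omega>) x a b"
    "cmp3 c \<omega> x a b e = pb3 (transition c c') (cmp3 c' \<omega>) x a b e"
  using assms by (auto simp: pb1_def pb2_def pb3_def components_change[of c c'] transition_at jac_def)

definition supp :: "nat \<Rightarrow> 'm set \<Rightarrow> ('m, 'e, 'b::zero) tensor \<Rightarrow> bool" where
  "supp k W \<omega> \<longleftrightarrow> (\<forall>p vs. \<not> (p \<in> W \<and> length vs = k \<and> set vs \<subseteq> tangent_space \<A> p) \<longrightarrow> \<omega> p vs = 0)"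

lemma tensors_supp: "\<omega> \<in> tensors \<A> k W \<Longrightarrow> supp k W \<omega>"
  by (simp add: tensors_def supp_def)

lemma forms_tensors: "\<omega> \<in> forms \<A> k W \<Longrightarrow> \<omega> \<in> tensors \<A> k W"
  by (simp add: forms_def)

lemma forms_supp: "\<omega> \<in> forms \<A> k W \<Longrightarrow> supp k W \<omega>"
  using tensors_supp forms_tensors by blast

lemma suppD: "supp k W \<omega> \<Longrightarrow> \<not> (p \<in> W \<and> length vs = k \<and> set vs \<subseteq> tangent_space \<A> p) \<Longrightarrow> \<omega> p vs = 0"
  by (simp add: supp_def)

lemma tensors1_atlas:
  assumes "\<omega> \<in> tensors \<A> 1 W" "c \<in> \<A>"
  shows "lform1 (snd c ` (fst c \<inter> W)) (cmp1 c \<omega>)"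
  unfolding lform1_def
proof (intro conjI ballI allI)
  show "smooth_on (snd c ` (fst c \<inter> W)) (\<lambda>x. components \<A> c \<omega> x [a])" for a
    using assms by (auto simp: tensors_def)
  fix x assume x: "x \<in> snd c ` (fst c \<inter> W)"
  have "\<forall>i<1. linear (\<lambda>e. components \<A> c \<omega> x ([0][i := e]))"
    using assms x unfolding tensors_def by (auto simp del: list_update.simps)
  then show "linear (cmp1 c \<omega> x)" by simp
qed

lemma tensors2_atlas:
  assumes "\<omega> \<in> tensors \<A> 2 W" "c \<in> \<A>"
  shows "x \<in> snd c ` (fst c \<inter> W) \<Longrightarrow> bilinear (cmp2 c \<omega> x)"
    "smooth_on (snd c ` (fst c \<inter> W)) (\<lambda>x. cmp2 c \<omega> x a b)"
proof -
  show "smooth_on (snd c ` (fst c \<inter> W)) (\<lambda>x. cmp2 c \<omega> x a b)"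
    using assms by (auto simp: tensors_def)
  assume x: "x \<in> snd c ` (fst c \<inter> W)"
  have *: "linear (\<lambda>e. components \<A> c \<omega> x ([a, b][i := e]))" if "i < 2" for i a b
    using assms x that unfolding tensors_def by (auto simp del: list_update.simps)
  show "bilinear (cmp2 c \<omega> x)"
    unfolding bilinear_alt using *[of 0] *[of 1] by simp
qed

lemma tensors3_atlas:
  assumes "\<omega> \<in> tensors \<A> 3 W" "c \<in> \<A>" "x \<in> snd c ` (fst c \<inter> W)"
  shows "linear (\<lambda>a. cmp3 c \<omega> x a b e)" "linear (\<lambda>b. cmp3 c \<omega> x a b e)" "linear (\<lambda>e. cmp3 c \<omega> x a b e)"
proof -
  have *: "linear (\<lambda>u. components \<A> c \<omega> x ([a, b, e][i := u]))" if "i < 3" for i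
    using assms that unfolding tensors_def by (auto simp del: list_update.simps)
  show "linear (\<lambda>a. cmp3 c \<omega> x a b e)" "linear (\<lambda>b. cmp3 c \<omega> x a b e)" "linear (\<lambda>e. cmp3 c \<omega> x a b e)"
    using *[of 0] *[of 1] *[of 2] by (simp_all add: numeral_2_eq_2)
qed

text \<open>Transfers a local question from an admissible chart \<open>c\<close> to the chart chosen
  at \<open>p\<close>: on \<open>N\<close> the components in \<open>c\<close> are pullbacks of the
  components in that chart.\<close>

lemma chart_overlap:
  assumes c: "adm c" "p \<in> fst c" and W: "open W" "p \<in> W"
  defines "d \<equiv> chart_at \<A> p"
  obtains N where "open N" "snd c p \<in> N" "N \<subseteq> snd c ` (fst c \<inter> fst d)" "N \<subseteq> snd c ` (fst c \<inter> W)"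
    "transition c d ` N \<subseteq> snd d ` (fst d \<inter> W)" "smooth_on N (transition c d)"
proof -
  define N where "N = snd c ` (fst c \<inter> (fst d \<inter> W))"
  have d: "adm d" "p \<in> fst d" using chart_at by (auto simp: d_def)
  show thesis
  proof (rule that)
    show "open N" unfolding N_def by (intro open_img open_Int open_dom c d W)
    show "smooth_on N (transition c d)"
      by (rule smooth_on_subset[OF smooth_transition[OF c(1) d(1)]]) (auto simp: N_def)
  qed (use c d W in \<open>auto simp: N_def transition_at\<close>)
qed

text \<open>\<open>tensors\<close> constrains components in atlas charts only. In an arbitrary
  admissible chart they are locally pullbacks of such components along a transition map.\<close>

lemma forms1_lform:
  assumes "\<omega> \<in> tensors \<A> 1 W" "open W" "adm c"
  shows "lform1 (snd c ` (fst c \<inter> W)) (cmp1 c \<omega>)"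
proof (rule lform1_local)
  fix x assume "x \<in> snd c ` (fst c \<inter> W)"
  then obtain p where p: "p \<in> fst c" "p \<in> W" "x = snd c p" by blast
  note d = chart_at[of p]
  obtain N where N: "open N" "snd c p \<in> N" "N \<subseteq> snd c ` (fst c \<inter> fst (chart_at \<A> p))"
    "N \<subseteq> snd c ` (fst c \<inter> W)" "transition c (chart_at \<A> p) ` N \<subseteq> snd (chart_at \<A> p) ` (fst (chart_at \<A> p) \<inter> W)"
    "smooth_on N (transition c (chart_at \<A> p))"
    by (rule chart_overlap[OF assms(3) p(1) assms(2) p(2)])
  have "lform1 N (cmp1 c \<omega>)"
    by (rule lform1_cong[OF N(1) cmp_change(1)[OF assms(3) d(3) subsetD[OF N(3)]]
          lform1_pb[OF fd N(1) open_img[OF d(3) assms(2)] N(5,6) tensors1_atlas[OF assms(1) d(1)]]])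
  then show "\<exists>N. open N \<and> x \<in> N \<and> lform1 N (cmp1 c \<omega>)" using N p by blast
qed

lemma forms2_atlas:
  assumes "\<omega> \<in> forms \<A> 2 W" "c \<in> \<A>"
  shows "lform2 (snd c ` (fst c \<inter> W)) (cmp2 c \<omega>)"
  unfolding lform2_def
  using tensors2_atlas[OF forms_tensors[OF assms(1)] assms(2)] assms(1)
  by (auto simp: forms_def components_def)

lemma forms3_atlas:
  assumes "\<omega> \<in> forms \<A> 3 W" "c \<in> \<A>"
  shows "lform3 (snd c ` (fst c \<inter> W)) (cmp3 c \<omega>)"
  unfolding lform3_def bilinear_alt
proof (intro conjI ballI allI tensors3_atlas[OF forms_tensors[OF assms(1)] assms(2)])
  show "smooth_on (snd c ` (fst c \<inter> W)) (\<lambda>x. components \<A> c \<omega> x [a, b, e])" for a b e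
    using assms by (auto simp: forms_def tensors_def)
qed (use assms in \<open>auto simp: forms_def components_def\<close>)

lemma forms2_lform:
  assumes "\<omega> \<in> forms \<A> 2 W" "open W" "adm c"
  shows "lform2 (snd c ` (fst c \<inter> W)) (cmp2 c \<omega>)"
proof (rule lform2_local)
  fix x assume "x \<in> snd c ` (fst c \<inter> W)"
  then obtain p where p: "p \<in> fst c" "p \<in> W" "x = snd c p" by blast
  note d = chart_at[of p]
  obtain N where N: "open N" "snd c p \<in> N" "N \<subseteq> snd c ` (fst c \<inter> fst (chart_at \<A> p))"
    "N \<subseteq> snd c ` (fst c \<inter> W)" "transition c (chart_at \<A> p) ` N \<subseteq> snd (chart_at \<A> p) ` (fst (chart_at \<A> p) \<inter> W)"
    "smooth_on N (transition c (chart_at \<A> p))"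
    by (rule chart_overlap[OF assms(3) p(1) assms(2) p(2)])
  have "lform2 N (cmp2 c \<omega>)"
    by (rule lform2_cong[OF N(1) cmp_change(2)[OF assms(3) d(3) subsetD[OF N(3)]]
          lform2_pb[OF fd N(1) open_img[OF d(3) assms(2)] N(5,6) forms2_atlas[OF assms(1) d(1)]]])
  then show "\<exists>N. open N \<and> x \<in> N \<and> lform2 N (cmp2 c \<omega>)" using N p by blast
qed

lemma forms3_lform:
  assumes "\<omega> \<in> forms \<A> 3 W" "open W" "adm c"
  shows "lform3 (snd c ` (fst c \<inter> W)) (cmp3 c \<omega>)"
proof (rule lform3_local)
  fix x assume "x \<in> snd c ` (fst c \<inter> W)"
  then obtain p where p: "p \<in> fst c" "p \<in> W" "x = snd c p" by blast
  note d = chart_at[of p]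
  obtain N where N: "open N" "snd c p \<in> N" "N \<subseteq> snd c ` (fst c \<inter> fst (chart_at \<A> p))"
    "N \<subseteq> snd c ` (fst c \<inter> W)" "transition c (chart_at \<A> p) ` N \<subseteq> snd (chart_at \<A> p) ` (fst (chart_at \<A> p) \<inter> W)"
    "smooth_on N (transition c (chart_at \<A> p))"
    by (rule chart_overlap[OF assms(3) p(1) assms(2) p(2)])
  have "lform3 N (cmp3 c \<omega>)"
    by (rule lform3_cong[OF N(1) cmp_change(3)[OF assms(3) d(3) subsetD[OF N(3)]]
          lform3_pb[OF fd N(1) open_img[OF d(3) assms(2)] N(5,6) forms3_atlas[OF assms(1) d(1)]]])
  then show "\<exists>N. open N \<and> x \<in> N \<and> lform3 N (cmp3 c \<omega>)" using N p by blast
qed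

lemma tensors2I:
  assumes "\<And>c x. c \<in> \<A> \<Longrightarrow> x \<in> snd c ` (fst c \<inter> W) \<Longrightarrow> bilinear (cmp2 c \<omega> x)"
    "\<And>c a b. c \<in> \<A> \<Longrightarrow> smooth_on (snd c ` (fst c \<inter> W)) (\<lambda>x. cmp2 c \<omega> x a b)" "supp 2 W \<omega>"
  shows "\<omega> \<in> tensors \<A> 2 W"
  unfolding tensors_def using assms
  by (auto simp: bilinear_alt supp_def length_Suc_conv numeral_2_eq_2 less_Suc_eq)

lemma tangent_list_coords:
  assumes "c \<in> charts_at \<A> p" "set vs \<subseteq> tangent_space \<A> p"
  shows "vs = map (tangent_of \<A> p c) (map (\<lambda>v. v c) vs)"
  using assms tangent_of_coord[OF assms(1)] by (auto simp: subset_iff intro!: map_idI[symmetric])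

lemma forms2I:
  assumes "\<And>c. c \<in> \<A> \<Longrightarrow> lform2 (snd c ` (fst c \<inter> W)) (cmp2 c \<omega>)" "supp 2 W \<omega>"
  shows "\<omega> \<in> forms \<A> 2 W"
  unfolding forms_def mem_Collect_eq
proof (intro conjI allI impI)
  show "\<omega> \<in> tensors \<A> 2 W"
    by (rule tensors2I[OF lform2D(1)[OF assms(1)] lform2D(5)[OF assms(1)] assms(2)])
  fix p and vs :: "('m, 'e) tvec list" assume nd: "\<not> distinct vs"
  show "\<omega> p vs = 0"
  proof (cases "p \<in> W \<and> length vs = 2 \<and> set vs \<subseteq> tangent_space \<A> p")
    case True
    then obtain v where v: "vs = [v, v]" "v \<in> tangent_space \<A> p" using nd
      by (auto simp: numeral_2_eq_2 length_Suc_conv)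
    define c where "c = chart_at \<A> p"
    have c: "c \<in> charts_at \<A> p" "adm c" "p \<in> fst c" "c \<in> \<A>" using chart_at chart_at_in by (auto simp: c_def)
    have "cmp2 c \<omega> (snd c p) (v c) (v c) = 0"
      using c True by (intro lform2D(4)[OF assms(1)]) auto
    then show ?thesis using c v tangent_of_coord[OF c(1) v(2)] by (simp add: components_at)
  next
    case False
    then show ?thesis by (intro suppD[OF assms(2)])
  qed
qed

lemma forms3I:
  assumes "\<And>c. c \<in> \<A> \<Longrightarrow> lform3 (snd c ` (fst c \<inter> W)) (cmp3 c \<omega>)" "supp 3 W \<omega>"
  shows "\<omega> \<in> forms \<A> 3 W"
  unfolding forms_def mem_Collect_eq
proof (intro conjI allI impI)
  show "\<omega> \<in> tensors \<A> 3 W"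
    unfolding tensors_def using assms
    by (auto simp: lform3_def bilinear_alt supp_def length_Suc_conv numeral_3_eq_3 less_Suc_eq)
  fix p and vs :: "('m, 'e) tvec list" assume nd: "\<not> distinct vs"
  show "\<omega> p vs = 0"
  proof (cases "p \<in> W \<and> length vs = 3 \<and> set vs \<subseteq> tangent_space \<A> p")
    case True
    then obtain v w u where v: "vs = [v, w, u]" "v \<in> tangent_space \<A> p" "w \<in> tangent_space \<A> p" "u \<in> tangent_space \<A> p"
      by (auto simp: numeral_3_eq_3 length_Suc_conv)
    define c where "c = chart_at \<A> p"
    have c: "c \<in> charts_at \<A> p" "adm c" "p \<in> fst c" "c \<in> \<A>" using chart_at chart_at_in by (auto simp: c_def)
    have x: "snd c p \<in> snd c ` (fst c \<inter> W)" using c True by auto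
    note l = lform3D(5,6)[OF assms(1)[OF c(4)] x] lform3_antisym(2)[OF assms(1)[OF c(4)] x, of "v c" "v c" "w c"]
    have "cmp3 c \<omega> (snd c p) (v c) (w c) (u c) = 0"
      using nd l by (auto simp: v)
    then show ?thesis using c v tangent_of_coord[OF c(1)] by (simp add: components_at)
  next
    case False
    then show ?thesis by (intro suppD[OF assms(2)])
  qed
qed

subsection \<open>The exterior derivative in coordinates\<close>

lemma ext_d_local:
  assumes "open N" "p \<in> N" "\<And>q vs. q \<in> N \<Longrightarrow> \<omega> q vs = \<omega>' q vs"
  shows "ext_d \<A> \<omega> p = ext_d \<A> \<omega>' p"
proof
  fix vs
  define c where "c = chart_at \<A> p"
  have c: "adm c" "p \<in> fst c" using chart_at by (auto simp: c_def)
  have "fderiv (\<lambda>x. components \<A> c \<omega> x es) (snd c p) = fderiv (\<lambda>x. components \<A> c \<omega>' x es) (snd c p)" for es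
    by (rule fderiv_cong_open[OF open_img[OF c(1) assms(1)]])
      (use c assms in \<open>auto simp: components_at\<close>)
  then show "ext_d \<A> \<omega> p vs = ext_d \<A> \<omega>' p vs" by (simp add: ext_d_def Let_def c_def)
qed

lemma ext_d_eq_0:
  assumes "supp k W \<omega>" "open W" "p \<in> W" "\<not> (length vs = Suc k \<and> set vs \<subseteq> tangent_space \<A> p)"
  shows "ext_d \<A> \<omega> p vs = 0"
proof (cases "set vs \<subseteq> tangent_space \<A> p")
  case False
  then show ?thesis by (simp add: ext_d_def)
next
  case True
  then have len: "length vs \<noteq> Suc k" using assms by blast
  have "components \<A> (chart_at \<A> p) \<omega> x (map (\<lambda>v. v (chart_at \<A> p)) (take i vs @ drop (Suc i) vs)) = 0"
    if "i < length vs" for i x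
    unfolding components_def by (rule suppD[OF assms(1)]) (use that len in auto)
  then show ?thesis unfolding ext_d_def Let_def by (simp add: True)
qed

text \<open>\<open>ext_d\<close> is computed in the chart chosen at \<open>p\<close>. That every
  admissible chart gives the same value is the compatibility of \<open>ld1\<close> with pullback
  along the transition map; degrees 2 and 3 are alike.\<close>

lemma ext_d_coords1:
  assumes "\<omega> \<in> tensors \<A> 1 W" "open W" "adm c" "p \<in> fst c" "p \<in> W"
  shows "ext_d \<A> \<omega> p [tangent_of \<A> p c a, tangent_of \<A> p c b] = ld1 (cmp1 c \<omega>) (snd c p) a b"
proof -
  define d where "d = chart_at \<A> p"
  have d: "adm d" "p \<in> fst d" "d \<in> \<A>" "d \<in> charts_at \<A> p" using chart_at chart_at_in by (auto simp: d_def)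
  have co: "tangent_of \<A> p c a d = jac c d p a" for a using d by (simp add: tangent_of_eq)
  obtain N where N: "open N" "snd c p \<in> N" "N \<subseteq> snd c ` (fst c \<inter> fst d)"
    "N \<subseteq> snd c ` (fst c \<inter> W)" "transition c d ` N \<subseteq> snd d ` (fst d \<inter> W)" "smooth_on N (transition c d)"
    unfolding d_def by (rule chart_overlap[OF assms(3,4,2,5)])
  have "ext_d \<A> \<omega> p [tangent_of \<A> p c a, tangent_of \<A> p c b] = ld1 (cmp1 d \<omega>) (snd d p) (jac c d p a) (jac c d p b)"
    using assms tangent_of_in by (simp add: ext_d_def Let_def d_def[symmetric] ld1_def co)
  also have "\<dots> = ld1 (pb1 (transition c d) (cmp1 d \<omega>)) (snd c p) a b"
    using ld1_pb[OF fd N(1) open_img[OF d(1) assms(2)] N(5,6) forms1_lform[OF assms(1,2) d(1)] N(2), of a b]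
    by (simp add: transition_at assms jac_def)
  also have "\<dots> = ld1 (cmp1 c \<omega>) (snd c p) a b"
    by (rule ld1_cong[OF N(1,2)]) (rule cmp_change(1)[OF assms(3) d(1) subsetD[OF N(3)], symmetric])
  finally show ?thesis .
qed

lemma ext_d_coords2:
  assumes "\<omega> \<in> forms \<A> 2 W" "open W" "adm c" "p \<in> fst c" "p \<in> W"
  shows "ext_d \<A> \<omega> p [tangent_of \<A> p c a, tangent_of \<A> p c b, tangent_of \<A> p c e] = ld2 (cmp2 c \<omega>) (snd c p) a b e"
proof -
  define d where "d = chart_at \<A> p"
  have d: "adm d" "p \<in> fst d" "d \<in> \<A>" "d \<in> charts_at \<A> p" using chart_at chart_at_in by (auto simp: d_def)
  have co: "tangent_of \<A> p c a d = jac c d p a" for a using d by (simp add: tangent_of_eq)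
  obtain N where N: "open N" "snd c p \<in> N" "N \<subseteq> snd c ` (fst c \<inter> fst d)"
    "N \<subseteq> snd c ` (fst c \<inter> W)" "transition c d ` N \<subseteq> snd d ` (fst d \<inter> W)" "smooth_on N (transition c d)"
    unfolding d_def by (rule chart_overlap[OF assms(3,4,2,5)])
  have "ext_d \<A> \<omega> p [tangent_of \<A> p c a, tangent_of \<A> p c b, tangent_of \<A> p c e]
      = ld2 (cmp2 d \<omega>) (snd d p) (jac c d p a) (jac c d p b) (jac c d p e)"
    using assms tangent_of_in by (simp add: ext_d_def Let_def d_def[symmetric] ld2_def co numeral_2_eq_2)
  also have "\<dots> = ld2 (pb2 (transition c d) (cmp2 d \<omega>)) (snd c p) a b e"
    using ld2_pb[OF fd N(1) open_img[OF d(1) assms(2)] N(5,6) forms2_lform[OF assms(1,2) d(1)] N(2), of a b e]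
    by (simp add: transition_at assms jac_def)
  also have "\<dots> = ld2 (cmp2 c \<omega>) (snd c p) a b e"
    by (rule ld2_cong[OF N(1,2)]) (rule cmp_change(2)[OF assms(3) d(1) subsetD[OF N(3)], symmetric])
  finally show ?thesis .
qed

lemma ext_d_coords3:
  assumes "\<omega> \<in> forms \<A> 3 W" "open W" "adm c" "p \<in> fst c" "p \<in> W"
  shows "ext_d \<A> \<omega> p [tangent_of \<A> p c a, tangent_of \<A> p c b, tangent_of \<A> p c e, tangent_of \<A> p c h]
    = ld3 (cmp3 c \<omega>) (snd c p) a b e h"
proof -
  define d where "d = chart_at \<A> p"
  have d: "adm d" "p \<in> fst d" "d \<in> \<A>" "d \<in> charts_at \<A> p" using chart_at chart_at_in by (auto simp: d_def)
  have co: "tangent_of \<A> p c a d = jac c d p a" for a using d by (simp add: tangent_of_eq)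
  obtain N where N: "open N" "snd c p \<in> N" "N \<subseteq> snd c ` (fst c \<inter> fst d)"
    "N \<subseteq> snd c ` (fst c \<inter> W)" "transition c d ` N \<subseteq> snd d ` (fst d \<inter> W)" "smooth_on N (transition c d)"
    unfolding d_def by (rule chart_overlap[OF assms(3,4,2,5)])
  have "ext_d \<A> \<omega> p [tangent_of \<A> p c a, tangent_of \<A> p c b, tangent_of \<A> p c e, tangent_of \<A> p c h]
      = ld3 (cmp3 d \<omega>) (snd d p) (jac c d p a) (jac c d p b) (jac c d p e) (jac c d p h)"
    using assms tangent_of_in by (simp add: ext_d_def Let_def d_def[symmetric] ld3_def co numeral_2_eq_2 numeral_3_eq_3)
  also have "\<dots> = ld3 (pb3 (transition c d) (cmp3 d \<omega>)) (snd c p) a b e h"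
    using ld3_pb[OF fd N(1) open_img[OF d(1) assms(2)] N(5,6) forms3_lform[OF assms(1,2) d(1)] N(2), of a b e h]
    by (simp add: transition_at assms jac_def)
  also have "\<dots> = ld3 (cmp3 c \<omega>) (snd c p) a b e h"
    by (rule ld3_cong[OF N(1,2)]) (rule cmp_change(3)[OF assms(3) d(1) subsetD[OF N(3)], symmetric])
  finally show ?thesis .
qed

lemma cmp_ext_d:
  assumes "open W" "adm c" "x \<in> snd c ` (fst c \<inter> W)"
  shows "\<omega> \<in> tensors \<A> 1 W \<Longrightarrow> cmp2 c (ext_d \<A> \<omega>) x a b = ld1 (cmp1 c \<omega>) x a b"
    "\<omega> \<in> forms \<A> 2 W \<Longrightarrow> cmp3 c (ext_d \<A> \<omega>) x a b e = ld2 (cmp2 c \<omega>) x a b e"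
  using assms ext_d_coords1[OF _ assms(1,2), of \<omega>] ext_d_coords2[OF _ assms(1,2), of \<omega>] by (auto simp: components_at)

lemma components_res: "adm c \<Longrightarrow> x \<in> snd c ` (fst c \<inter> W) \<Longrightarrow> components \<A> c (res W \<omega>) x es = components \<A> c \<omega> x es"
  by (auto simp: components_at res_def)

text \<open>Membership needs the restriction, because the values of \<open>ext_d\<close> are
  controlled only at points of \<open>W\<close>.\<close>

lemma ext_d_form3:
  assumes "\<omega> \<in> forms \<A> 2 W" "open W"
  shows "res W (ext_d \<A> \<omega>) \<in> forms \<A> 3 W"
proof (rule forms3I)
  fix c assume "c \<in> \<A>"
  then have c: "adm c" by (rule adm_atlas)
  show "lform3 (snd c ` (fst c \<inter> W)) (cmp3 c (res W (ext_d \<A> \<omega>)))"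
    by (rule lform3_cong[OF open_img[OF c assms(2)] _ lform3_ld2[OF open_img[OF c assms(2)] forms2_lform[OF assms c]]])
      (simp add: components_res c cmp_ext_d(2)[OF assms(2) c _ assms(1)])
next
  show "supp 3 W (res W (ext_d \<A> \<omega>))"
    using ext_d_eq_0[OF forms_supp[OF assms(1)] assms(2)] by (auto simp: supp_def res_def)
qed

lemma ext_d_ext_d:
  assumes "\<omega> \<in> forms \<A> 2 W" "open W" "p \<in> W"
  shows "ext_d \<A> (res W (ext_d \<A> \<omega>)) p vs = 0"
proof (cases "length vs = 4 \<and> set vs \<subseteq> tangent_space \<A> p")
  case True
  note \<eta> = ext_d_form3[OF assms(1,2)]
  define c where "c = chart_at \<A> p"
  have c: "c \<in> charts_at \<A> p" "adm c" "p \<in> fst c" "c \<in> \<A>" using chart_at chart_at_in by (auto simp: c_def)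
  note o = open_img[OF c(2) assms(2)]
  have x: "snd c p \<in> snd c ` (fst c \<inter> W)" using c assms by auto
  obtain v1 v2 v3 v4 where vs: "vs = [v1, v2, v3, v4]"
    using True by (auto simp: length_Suc_conv numeral_eq_Suc)
  have "ext_d \<A> (res W (ext_d \<A> \<omega>)) p (map (tangent_of \<A> p c) [v1 c, v2 c, v3 c, v4 c]) =
      ld3 (cmp3 c (res W (ext_d \<A> \<omega>))) (snd c p) (v1 c) (v2 c) (v3 c) (v4 c)"
    using ext_d_coords3[OF \<eta> assms(2) c(2,3) assms(3)] by simp
  also have "\<dots> = ld3 (ld2 (cmp2 c \<omega>)) (snd c p) (v1 c) (v2 c) (v3 c) (v4 c)"
    by (rule ld3_cong[OF o x]) (simp add: components_res c cmp_ext_d(2)[OF assms(2) c(2) _ assms(1)])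
  also have "\<dots> = 0" by (rule ld3_ld2[OF o forms2_lform[OF assms(1,2) c(2)] x])
  finally show ?thesis using tangent_list_coords[OF c(1), of vs] True by (simp add: vs)
next
  case False
  then show ?thesis by (intro ext_d_eq_0[OF forms_supp[OF ext_d_form3[OF assms(1,2)]] assms(2,3)]) auto
qed

lemma components_differentiable:
  assumes "\<omega> \<in> tensors \<A> k W" "c \<in> \<A>" "p \<in> fst c" "p \<in> W"
  shows "(\<lambda>x. components \<A> c \<omega> x es) differentiable (at (snd c p))"
proof (cases "length es = k")
  case True
  then have "smooth_on (snd c ` (fst c \<inter> W)) (\<lambda>x. components \<A> c \<omega> x es)"
    using assms by (auto simp: tensors_def)
  then show ?thesis by (rule smooth_on_differentiable) (use assms in auto)
next
  case False
  then have "components \<A> c \<omega> x es = 0" for x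
    unfolding components_def by (intro suppD[OF tensors_supp[OF assms(1)]]) auto
  then show ?thesis by simp
qed

lemma ext_d_add:
  assumes "\<omega> \<in> tensors \<A> k W" "\<omega>' \<in> tensors \<A> k W" "p \<in> W"
  shows "ext_d \<A> (\<omega> + \<omega>') p vs = ext_d \<A> \<omega> p vs + ext_d \<A> \<omega>' p vs"
proof -
  define c where "c = chart_at \<A> p"
  have c: "p \<in> fst c" "c \<in> \<A>" using chart_at by (auto simp: c_def)
  have eq: "(\<lambda>x. components \<A> c (\<omega> + \<omega>') x es) = (\<lambda>x. components \<A> c \<omega> x es + components \<A> c \<omega>' x es)" for es
    by (simp add: components_def)
  have "fderiv (\<lambda>x. components \<A> c (\<omega> + \<omega>') x es) (snd c p) h =
      fderiv (\<lambda>x. components \<A> c \<omega> x es) (snd c p) h + fderiv (\<lambda>x. components \<A> c \<omega>' x es) (snd c p) h" for es h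
    unfolding eq by (intro fderiv_eq has_derivative_add has_fderiv
        components_differentiable[OF assms(1) c(2,1) assms(3)] components_differentiable[OF assms(2) c(2,1) assms(3)])
  then show ?thesis
    by (simp add: ext_d_def Let_def c_def[symmetric] scaleR_add_right sum.distrib)
qed

lemma ext_d_diff:
  assumes "\<omega> \<in> tensors \<A> k W" "\<omega>' \<in> tensors \<A> k W" "p \<in> W"
  shows "ext_d \<A> (\<omega> - \<omega>') p vs = ext_d \<A> \<omega> p vs - ext_d \<A> \<omega>' p vs"
proof -
  define c where "c = chart_at \<A> p"
  have c: "p \<in> fst c" "c \<in> \<A>" using chart_at by (auto simp: c_def)
  have eq: "(\<lambda>x. components \<A> c (\<omega> - \<omega>') x es) = (\<lambda>x. components \<A> c \<omega> x es - components \<A> c \<omega>' x es)" for es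
    by (simp add: components_def)
  have "fderiv (\<lambda>x. components \<A> c (\<omega> - \<omega>') x es) (snd c p) h =
      fderiv (\<lambda>x. components \<A> c \<omega> x es) (snd c p) h - fderiv (\<lambda>x. components \<A> c \<omega>' x es) (snd c p) h" for es h
    unfolding eq by (intro fderiv_eq has_derivative_diff has_fderiv
        components_differentiable[OF assms(1) c(2,1) assms(3)] components_differentiable[OF assms(2) c(2,1) assms(3)])
  then show ?thesis
    by (simp add: ext_d_def Let_def c_def[symmetric] scaleR_diff_right sum_subtractf)
qed

end

section \<open>Chern-Simons forms\<close>

lemma wedge_length: "length vs \<noteq> k + l \<Longrightarrow> wedge b k l \<alpha> \<beta> p vs = 0"
  by (simp add: wedge_def)

lemma wedge_1_1: "wedge b 1 1 \<alpha> \<beta> p [v, w] = b (\<alpha> p [v]) (\<beta> p [w]) - b (\<alpha> p [w]) (\<beta> p [v])"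
proof -
  have s: "{..<1 + 1} = {0::nat, 1}" by auto
  have f: "finite {1::nat}" "0 \<notin> {1::nat}" by auto
  show ?thesis
    unfolding wedge_def s sum_over_permutations_insert[OF f] permutes_sing
    by (simp add: sign_swap_id permutation_swap_id sign_compose sign_id transpose_def)
qed

text \<open>By antisymmetry of \<open>\<beta>\<close> the six permutations give each of the three
  terms twice, which cancels the normalising factor \<open>1 / 2\<close>.\<close>

lemma wedge_1_2:
  assumes \<beta>: "\<And>v w. \<beta> p [w, v] = - \<beta> p [v, w]" and b: "bilinear b"
  shows "wedge b 1 2 \<alpha> \<beta> p [u, v, w] =
    b (\<alpha> p [u]) (\<beta> p [v, w]) - b (\<alpha> p [v]) (\<beta> p [u, w]) + b (\<alpha> p [w]) (\<beta> p [u, v])"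
proof -
  have s: "{..<1 + 2} = {0::nat, 1, 2}" by auto
  have f: "finite {1::nat, 2}" "0 \<notin> {1::nat, 2}" "finite {2::nat}" "1 \<notin> {2::nat}" by auto
  have "wedge b 1 2 \<alpha> \<beta> p [u, v, w] = (1 / 2) *\<^sub>R
      (2 *\<^sub>R (b (\<alpha> p [u]) (\<beta> p [v, w]) - b (\<alpha> p [v]) (\<beta> p [u, w]) + b (\<alpha> p [w]) (\<beta> p [u, v])))"
    unfolding wedge_def s sum_over_permutations_insert[OF f(1,2)] sum_over_permutations_insert[OF f(3,4)] permutes_sing
    by (simp add: sign_swap_id permutation_swap_id sign_compose sign_id transpose_def upt_rec numeral_eq_Suc
        \<beta>[of v u] \<beta>[of w u] \<beta>[of w v] bilinear_rneg[OF b] scaleR_2 permutation_compose algebra_simps)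
  then show ?thesis by simp
qed

text \<open>Up to the antisymmetry of \<open>R\<close> and the symmetry of \<open>b\<close>, the 24
  permutations realise each of the three splittings into two pairs eight times; the normalisation
  divides by 4.\<close>

lemma wedge_2_2:
  fixes b :: "'b::real_vector \<Rightarrow> 'b \<Rightarrow> 'c::real_vector"
  assumes R: "\<And>v w. R p [w, v] = - R p [v, w]" and b: "bilinear b" "\<And>x y. b x y = b y x"
  shows "wedge b 2 2 R R p [u, v, w, z] = (2::real) *\<^sub>R
    (b (R p [u, v]) (R p [w, z]) - b (R p [u, w]) (R p [v, z]) + b (R p [u, z]) (R p [v, w]))"
proof -
  have s: "{..<2 + 2} = {0::nat, 1, 2, 3}" by auto
  have f: "finite {1::nat, 2, 3}" "0 \<notin> {1::nat, 2, 3}" "finite {2::nat, 3}" "1 \<notin> {2::nat, 3}" "finite {3::nat}" "2 \<notin> {3::nat}" by auto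
  note c = b(2)[of "R p [w, z]" "R p [u, v]"] b(2)[of "R p [v, z]" "R p [u, w]"] b(2)[of "R p [v, w]" "R p [u, z]"]
  have eight: "8 *\<^sub>R x = x + x + x + x + x + x + x + x" for x :: 'c
  proof -
    have "(8::real) = 1 + 1 + 1 + 1 + 1 + 1 + 1 + 1" by simp
    then show ?thesis by (simp only: scaleR_add_left scaleR_one)
  qed
  have "wedge b 2 2 R R p [u, v, w, z] = (1 / 4) *\<^sub>R (8 *\<^sub>R
    (b (R p [u, v]) (R p [w, z]) - b (R p [u, w]) (R p [v, z]) + b (R p [u, z]) (R p [v, w])))"
    unfolding wedge_def s sum_over_permutations_insert[OF f(1,2)] sum_over_permutations_insert[OF f(3,4)]
      sum_over_permutations_insert[OF f(5,6)] permutes_sing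
    by (simp add: sign_swap_id permutation_swap_id sign_compose sign_id transpose_def upt_rec numeral_eq_Suc
        R[of v u] R[of w u] R[of z u] R[of w v] R[of z v] R[of z w] c
        bilinear_rneg[OF b(1)] bilinear_lneg[OF b(1)] permutation_compose
        del: scaleR_scaleR) (simp add: eight algebra_simps)
  then show ?thesis by simp
qed

section \<open>Identities in quadratic Lie algebras and their consequences for Chern-Simons
  forms\<close>

locale qla =
  fixes br :: "'g::banach \<Rightarrow> 'g \<Rightarrow> 'g" and pr :: "'g \<Rightarrow> 'g \<Rightarrow> real"
  assumes quadratic: "quadratic_lie_algebra br pr"
begin

lemma fin_dim_g: "fin_dim TYPE('g)"
  and bilinear_br: "bilinear br" and bilinear_pr: "bilinear pr"
  and br_self [simp]: "br x x = 0" and pr_sym: "pr x y = pr y x"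
  and jacobi: "br x (br y z) + br y (br z x) + br z (br x y) = 0"
  and pr_inv: "pr (br x y) z = - pr y (br x z)"
  using quadratic by (auto simp: quadratic_lie_algebra_def eq_neg_iff_add_eq_0)

lemma bounded_br: "bounded_bilinear br"
  by (rule fin_dim_bilinear_bounded[OF fin_dim_g fin_dim_g bilinear_br])

lemma bounded_pr: "bounded_bilinear pr"
  by (rule fin_dim_bilinear_bounded[OF fin_dim_g fin_dim_g bilinear_pr])

lemmas br_simps = bounded_bilinear.add_left[OF bounded_br] bounded_bilinear.add_right[OF bounded_br]
  bounded_bilinear.diff_left[OF bounded_br] bounded_bilinear.diff_right[OF bounded_br]
  bounded_bilinear.minus_left[OF bounded_br] bounded_bilinear.minus_right[OF bounded_br]
  bounded_bilinear.zero_left[OF bounded_br] bounded_bilinear.zero_right[OF bounded_br]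
  bounded_bilinear.scaleR_left[OF bounded_br] bounded_bilinear.scaleR_right[OF bounded_br]

lemmas pr_simps = bounded_bilinear.add_left[OF bounded_pr] bounded_bilinear.add_right[OF bounded_pr]
  bounded_bilinear.diff_left[OF bounded_pr] bounded_bilinear.diff_right[OF bounded_pr]
  bounded_bilinear.minus_left[OF bounded_pr] bounded_bilinear.minus_right[OF bounded_pr]
  bounded_bilinear.zero_left[OF bounded_pr] bounded_bilinear.zero_right[OF bounded_pr]
  bounded_bilinear.scaleR_left[OF bounded_pr] bounded_bilinear.scaleR_right[OF bounded_pr]

lemma br_antisym: "br y x = - br x y"
  by (rule bilinear_alternating_antisym[OF bilinear_br br_self])

text \<open>Together with \<open>pr_swap\<close> this makes \<open>pr x (br y z)\<close> totally
  antisymmetric: it is the Cartan 3-form of the Lie algebra.\<close>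

lemma pr_cyc: "pr y (br z x) = pr x (br y z)"
proof -
  have "pr x (br y z) = pr (br y z) x" by (rule pr_sym)
  also have "\<dots> = - pr (br z y) x" by (subst br_antisym) (simp add: pr_simps)
  also have "\<dots> = pr y (br z x)" by (simp add: pr_inv)
  finally show ?thesis by simp
qed

lemma pr_swap: "pr y (br x z) = - pr x (br y z)"
  using pr_cyc[of y z x] br_antisym[of z x] by (simp add: pr_simps)

lemma pr_br_self [simp]: "pr x (br x y) = 0" "pr y (br x y) = 0"
  using pr_swap[of x x y] pr_swap[of y x y] by (simp_all add: pr_simps)

text \<open>Moving one bracket across the pairing turns the sum into \<open>pr a\<close> of the
  Jacobi sum. This is why the part of \<open>(R, R)\<close> that is quartic in the connection
  vanishes.\<close>

lemma pr_br_br: "pr (br a b) (br c e) - pr (br a c) (br b e) + pr (br a e) (br b c) = 0"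
proof -
  have 1: "pr (br x y) z = pr x (br y z)" for x y z
    using pr_inv[of x y z] pr_swap[of y x z] by simp
  have "pr a (br b (br c e)) + pr a (br c (br e b)) + pr a (br e (br b c)) = 0"
    using arg_cong[OF jacobi[of b c e], of "pr a"] by (simp add: pr_simps)
  moreover have "pr a (br c (br e b)) = - pr a (br c (br b e))"
    by (subst br_antisym[of e b]) (simp add: pr_simps br_simps)
  ultimately show ?thesis by (simp add: 1)
qed

text \<open>The pointwise content of \<open>d cs\<^sub>3 = (R, R)\<close>: \<open>F u\<close> stands
  for \<theta>(u), \<open>D u h\<close> for its derivative along \<open>h\<close>,
  \<open>E u h k\<close> for its second derivative, and \<open>dl\<close> is the product rule
  applied to the Chern-Simons expression.\<close>

lemma cs_algebra:
  fixes F :: "'k \<Rightarrow> 'g" and D :: "'k \<Rightarrow> 'k \<Rightarrow> 'g" and E :: "'k \<Rightarrow> 'k \<Rightarrow> 'k \<Rightarrow> 'g"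
  assumes E: "\<And>u h k. E u h k = E u k h"
  defines "dl \<equiv> \<lambda>u v w h. pr (D u h) (D w v - D v w) + pr (F u) (E w v h - E v w h)
      - (pr (D v h) (D w u - D u w) + pr (F v) (E w u h - E u w h))
      + (pr (D w h) (D v u - D u v) + pr (F w) (E v u h - E u v h))
      + 2 * (pr (D u h) (br (F v) (F w)) + pr (F u) (br (D v h) (F w)) + pr (F u) (br (F v) (D w h)))"
    and "R \<equiv> \<lambda>u v. D v u - D u v + br (F u) (F v)"
  shows "dl b c e a - dl a c e b + dl a b e c - dl a b c e =
    2 * (pr (R a b) (R c e) - pr (R a c) (R b e) + pr (R a e) (R b c))"
proof -
  \<comment> \<open>Normal form of the cubic terms: the derivative becomes the first argument of the
    pairing.\<close>
  have 1: "pr (F u) (br (D v h) (F w)) = pr (D v h) (br (F w) (F u))"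
    "pr (F u) (br (F v) (D w h)) = pr (D w h) (br (F u) (F v))"
    "pr (br (F u) (F v)) (D w h) = pr (D w h) (br (F u) (F v))" for u v w h
    using pr_cyc[of "F u" "D v h" "F w"] pr_cyc pr_sym by metis+
  note anti = br_antisym[of "F b" "F a"] br_antisym[of "F c" "F a"] br_antisym[of "F e" "F a"]
    br_antisym[of "F c" "F b"] br_antisym[of "F e" "F b"] br_antisym[of "F e" "F c"]
  note Es = E[of _ b a] E[of _ c a] E[of _ e a] E[of _ c b] E[of _ e b] E[of _ e c]
  \<comment> \<open>The quartic terms on the right have no counterpart on the left and must cancel
    among themselves.\<close>
  have quartic: "pr (br (F a) (F b)) (br (F c) (F e)) = pr (br (F a) (F c)) (br (F b) (F e)) - pr (br (F a) (F e)) (br (F b) (F c))"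
    using pr_br_br[of "F a" "F b" "F c" "F e"] by simp
  have comm: "pr (D u v) (D w z) = pr (D w z) (D u v)" for u v w z by (rule pr_sym)
  show ?thesis
    unfolding dl_def R_def
    by (simp add: pr_simps 1 anti Es quartic) (simp add: algebra_simps comm)
qed

text \<open>The components of \<open>cs3\<close> in a chart with all wedge products expanded; the
  link is \<open>cmp3_cs3\<close>.\<close>

definition lcs :: "('x::real_normed_vector \<Rightarrow> 'x \<Rightarrow> 'g) \<Rightarrow> 'x \<Rightarrow> 'x \<Rightarrow> 'x \<Rightarrow> 'x \<Rightarrow> real" where
  "lcs f x u v w = pr (f x u) (ld1 f x v w) - pr (f x v) (ld1 f x u w) + pr (f x w) (ld1 f x u v)
     + 2 * pr (f x u) (br (f x v) (f x w))"

lemma lform3_lcs: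
  assumes S: "open S" and f: "lform1 S f"
  shows "lform3 S (lcs f)"
proof -
  note d = lform2_ld1[OF S f]
  show ?thesis
    unfolding lform3_def bilinear_alt
  proof (intro conjI allI ballI)
    fix x assume x: "x \<in> S"
    note l = linear_add[OF lform1D(1)[OF f x]] linear_cmul[OF lform1D(1)[OF f x]]
      linear_add[OF lform2D(2)[OF d x]] linear_cmul[OF lform2D(2)[OF d x]]
      linear_add[OF lform2D(3)[OF d x]] linear_cmul[OF lform2D(3)[OF d x]]
    show "linear (lcs f x a b)" for a b
      by (rule linearI) (simp_all add: lcs_def l pr_simps br_simps algebra_simps)
    show "linear (\<lambda>b. lcs f x a b c)" for a c
      by (rule linearI) (simp_all add: lcs_def l pr_simps br_simps algebra_simps)
    show "linear (\<lambda>a. lcs f x a b c)" for b c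
      by (rule linearI) (simp_all add: lcs_def l pr_simps br_simps algebra_simps)
    show "lcs f x a a b = 0" "lcs f x a b b = 0" for a b
      by (simp_all add: lcs_def lform2D(4)[OF d x] pr_simps)
  next
    show "smooth_on S (\<lambda>x. lcs f x a b c)" for a b c
      unfolding lcs_def
      by (intro smooth_on_add[OF S] smooth_on_diff[OF S] smooth_on_mult_left[OF S] smooth_on_bilinear[OF bounded_pr S]
          smooth_on_bilinear[OF bounded_br S] lform1D[OF f] lform2D(5)[OF d])
  qed
qed

lemma ld3_lcs:
  assumes S: "open S" and f: "lform1 S f" and x: "x \<in> S"
  defines "R \<equiv> \<lambda>u v. ld1 f x u v + br (f x u) (f x v)"
  shows "ld3 (lcs f) x a b c e = 2 * (pr (R a b) (R c e) - pr (R a c) (R b e) + pr (R a e) (R b c))"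
proof -
  note sm = lform1D(2)[OF f]
  define D where "D u h = fderiv (\<lambda>y. f y u) x h" for u h
  define E where "E u h k = fderiv (\<lambda>y. fderiv (\<lambda>y. f y u) y h) x k" for u h k
  have f': "((\<lambda>y. f y u) has_derivative D u) (at x)" for u
    unfolding D_def by (rule smooth_on_has_derivative[OF sm x])
  have f'': "((\<lambda>y. fderiv (\<lambda>y. f y u) y h) has_derivative E u h) (at x)" for u h
    unfolding E_def by (rule smooth_on_has_derivative[OF smooth_on_fderiv[OF sm] x])
  have d: "((\<lambda>y. ld1 f y u v) has_derivative (\<lambda>h. E v u h - E u v h)) (at x)" for u v
    unfolding ld1_def by (intro has_derivative_diff f'')
  have ld: "ld1 f x u v = D v u - D u v" for u v by (simp add: ld1_def D_def)
  have dl: "fderiv (\<lambda>y. lcs f y u v w) x h = pr (D u h) (D w v - D v w) + pr (f x u) (E w v h - E v w h)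
      - (pr (D v h) (D w u - D u w) + pr (f x v) (E w u h - E u w h))
      + (pr (D w h) (D v u - D u v) + pr (f x w) (E v u h - E u v h))
      + 2 * (pr (D u h) (br (f x v) (f x w)) + pr (f x u) (br (D v h) (f x w)) + pr (f x u) (br (f x v) (D w h)))" for u v w h
  proof (rule fderiv_eq)
    have "((\<lambda>y. lcs f y u v w) has_derivative (\<lambda>h. (pr (f x u) (E w v h - E v w h) + pr (D u h) (ld1 f x v w))
      - (pr (f x v) (E w u h - E u w h) + pr (D v h) (ld1 f x u w))
      + (pr (f x w) (E v u h - E u v h) + pr (D w h) (ld1 f x u v))
      + 2 * (pr (f x u) (br (f x v) (D w h) + br (D v h) (f x w)) + pr (D u h) (br (f x v) (f x w))))) (at x)"
      unfolding lcs_def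
      by (intro has_derivative_add has_derivative_diff bounded_bilinear.FDERIV[OF bounded_pr]
          bounded_bilinear.FDERIV[OF bounded_br] has_derivative_mult_right f' d)
    then show "((\<lambda>y. lcs f y u v w) has_derivative (\<lambda>h. pr (D u h) (D w v - D v w) + pr (f x u) (E w v h - E v w h)
      - (pr (D v h) (D w u - D u w) + pr (f x v) (E w u h - E u w h))
      + (pr (D w h) (D v u - D u v) + pr (f x w) (E v u h - E u v h))
      + 2 * (pr (D u h) (br (f x v) (f x w)) + pr (f x u) (br (D v h) (f x w)) + pr (f x u) (br (f x v) (D w h))))) (at x)"
      by (rule has_derivative_eq_rhs) (auto simp: ld pr_simps fun_eq_iff)
  qed
  have "E u h k = E u k h" for u h k
    unfolding E_def by (rule second_derivative_symmetric[OF S sm x])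
  from cs_algebra[where E = E and D = D and F = "f x" and a = a and b = b and c = c and e = e, OF this] show ?thesis
    unfolding ld3_def dl R_def ld .
qed

text \<open>The pointwise content of the bracket axiom. Here \<open>a\<close> stands for
  \<tau>\<theta>', \<open>A u h\<close> for \<tau> applied to the derivative of \<theta>'(u) along
  \<open>h\<close>, \<open>P u h\<close> for the derivative of \<phi>(u) along \<open>h\<close>, and
  \<open>bd\<close> for the derivatives of the 2-form. By the differential equation for \<tau>,
  \<open>T u h\<close> is then the derivative of \<theta>(u) along \<open>h\<close>, and
  \<open>\<beta> h u w\<close> that of the number \<beta>(u)(w).\<close>

lemma gauge_algebra:
  fixes a \<phi> :: "'k \<Rightarrow> 'g" and A P :: "'k \<Rightarrow> 'k \<Rightarrow> 'g" and bd :: "'k \<Rightarrow> 'k \<Rightarrow> 'k \<Rightarrow> real"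
  assumes flat: "\<And>u v. P v u = P u v - br (\<phi> u) (\<phi> v)"
  defines "\<theta> \<equiv> \<lambda>u. a u + \<phi> u" and "T \<equiv> \<lambda>u h. A u h - br (\<phi> h) (a u) + P u h"
  defines "cs \<equiv> \<lambda>f D u v w. pr (f u) (D w v - D v w) - pr (f v) (D w u - D u w) + pr (f w) (D v u - D u v)
      + 2 * pr (f u) (br (f v) (f w))"
  defines "\<beta> \<equiv> \<lambda>h u w. bd h u w - (pr (T w h) (\<theta> u) + pr (\<theta> w) (T u h)) + (pr (A w h) (a u) + pr (a w) (A u h))
      + 2 * (pr (A u h - br (\<phi> h) (a u)) (\<phi> w) + pr (a u) (P w h))"
  assumes cs: "cs a A X Y W - cs \<theta> T X Y W = bd X Y W - bd Y X W + bd W X Y"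
  shows "\<beta> X Y W - \<beta> Y X W + \<beta> W X Y + 2 * pr (\<phi> Y) (P X W) = 0"
proof -
  \<comment> \<open>Numbering the six vectors lets the simplifier sort every triple product \<open>(x, [y, z])\<close>.\<close>
  define g where "g = (!) [a X, a Y, a W, \<phi> X, \<phi> Y, \<phi> W]"
  have g: "a X = g 0" "a Y = g 1" "a W = g 2" "\<phi> X = g 3" "\<phi> Y = g 4" "\<phi> W = g 5"
    by (simp_all add: g_def)
  have g': "br (g j) (g i) = - br (g i) (g j)" if "i < j" for i j by (rule br_antisym)
  have g'': "pr (g i) (br (g j) (g k)) = - pr (g j) (br (g i) (g k))" if "j < i" "i < k" for i j k by (rule pr_swap)
  have g''': "pr (g i) (br (g j) (g k)) = pr (g j) (br (g k) (g i))" if "j < k" "k < i" for i j k by (rule pr_cyc[symmetric])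
  have P: "P Y X = P X Y - br (g 3) (g 4)" "P W X = P X W - br (g 3) (g 5)" "P W Y = P Y W - br (g 4) (g 5)"
    using flat[of Y X] flat[of W X] flat[of W Y] by (simp_all add: g)
  have c: "pr (P u v) (g i) = pr (g i) (P u v)" "pr (A u v) (g i) = pr (g i) (A u v)"
    "pr (br (g i) (g j)) (g k) = pr (g k) (br (g i) (g j))" for u v i j k by (rule pr_sym)+
  \<comment> \<open>The Chern-Simons hypothesis enters by eliminating one of the three derivatives
    of the 2-form; the other two then cancel.\<close>
  have bd: "bd X Y W = cs a A X Y W - cs \<theta> T X Y W + bd Y X W - bd W X Y" using cs by simp
  show ?thesis
    unfolding \<beta>_def bd unfolding cs_def \<theta>_def T_def g P
    by (simp add: pr_simps br_simps c g' g'' g''' algebra_simps)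
qed

end

section \<open>Restriction and sums of forms, and primitives in a chart\<close>

context mfd
begin

lemma res_tensors:
  assumes "\<omega> \<in> tensors \<A> k U" "W \<subseteq> U" "open W"
  shows "res W \<omega> \<in> tensors \<A> k W"
  unfolding tensors_def mem_Collect_eq
proof (intro conjI allI ballI impI)
  fix c es assume c: "c \<in> \<A>" and len: "length (es::'e list) = k"
  note ac = adm_atlas[OF c]
  have sub: "snd c ` (fst c \<inter> W) \<subseteq> snd c ` (fst c \<inter> U)" using assms(2) by blast
  have "smooth_on (snd c ` (fst c \<inter> U)) (\<lambda>x. components \<A> c \<omega> x es)"
    using assms(1) c len unfolding tensors_def by blast
  then have "smooth_on (snd c ` (fst c \<inter> W)) (\<lambda>x. components \<A> c \<omega> x es)"
    using sub by (rule smooth_on_subset)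
  then show "smooth_on (snd c ` (fst c \<inter> W)) (\<lambda>x. components \<A> c (res W \<omega>) x es)"
    by (rule smooth_on_congI[OF open_img[OF ac assms(3)]]) (rule components_res[OF ac])
  fix x i assume x: "x \<in> snd c ` (fst c \<inter> W)" and i: "i < k"
  have "linear (\<lambda>e. components \<A> c \<omega> x (es[i := e]))"
    using assms(1) c len i subsetD[OF sub x] unfolding tensors_def by blast
  then show "linear (\<lambda>e. components \<A> c (res W \<omega>) x (es[i := e]))"
    by (simp add: components_res[OF ac x])
next
  fix p and vs :: "('m, 'e) tvec list"
  assume "\<not> (p \<in> W \<and> length vs = k \<and> set vs \<subseteq> tangent_space \<A> p)"
  then show "res W \<omega> p vs = 0"
    using suppD[OF tensors_supp[OF assms(1)], of p vs] by (auto simp: res_def)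
qed

lemma res_forms:
  assumes "\<omega> \<in> forms \<A> k U" "W \<subseteq> U" "open W"
  shows "res W \<omega> \<in> forms \<A> k W"
  using res_tensors[OF forms_tensors[OF assms(1)] assms(2,3)] assms(1) by (simp add: forms_def res_def)

lemma ext_d_res: "open W \<Longrightarrow> p \<in> W \<Longrightarrow> ext_d \<A> (res W \<omega>) p = ext_d \<A> \<omega> p"
  by (rule ext_d_local[of W]) (auto simp: res_def)

lemma tensors_add:
  assumes "\<omega> \<in> tensors \<A> k W" "\<omega>' \<in> tensors \<A> k W" "open W"
  shows "\<omega> + \<omega>' \<in> tensors \<A> k W"
  using assms unfolding tensors_def
  by (auto simp: components_def linear_compose_add intro!: smooth_on_add open_img adm_atlas)

lemma tensors_diff:
  assumes "\<omega> \<in> tensors \<A> k W" "\<omega>' \<in> tensors \<A> k W" "open W"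
  shows "\<omega> - \<omega>' \<in> tensors \<A> k W"
  using assms unfolding tensors_def
  by (auto simp: components_def linear_compose_sub intro!: smooth_on_diff open_img adm_atlas)

lemma forms_add: "\<omega> \<in> forms \<A> k W \<Longrightarrow> \<omega>' \<in> forms \<A> k W \<Longrightarrow> open W \<Longrightarrow> \<omega> + \<omega>' \<in> forms \<A> k W"
  using tensors_add by (auto simp: forms_def)

lemma forms_diff: "\<omega> \<in> forms \<A> k W \<Longrightarrow> \<omega>' \<in> forms \<A> k W \<Longrightarrow> open W \<Longrightarrow> \<omega> - \<omega>' \<in> forms \<A> k W"
  using tensors_diff by (auto simp: forms_def)

lemma forms_zero: "0 \<in> forms \<A> k W"
  by (auto simp: forms_def tensors_def components_def smooth_on_const linear_zero)

text \<open>The Poincare lemma is applied to the components in \<open>\<psi>\<close>, and the result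
  is read back as a tensor field through the coordinates \<open>tcoord \<psi>\<close>. As
  \<open>\<psi>\<close> need not belong to the atlas, smoothness of \<open>B\<close> in atlas charts
  is that of a pullback along the transition to \<open>\<psi>\<close>.\<close>

lemma poincare_chart:
  fixes \<omega> :: "('m, 'e, real) tensor"
  assumes \<psi>: "adm \<psi>" "snd \<psi> ` fst \<psi> = UNIV"
    and \<omega>: "\<omega> \<in> forms \<A> 3 (fst \<psi>)" and closed: "\<And>p vs. p \<in> fst \<psi> \<Longrightarrow> ext_d \<A> \<omega> p vs = 0"
  obtains B where "B \<in> forms \<A> 2 (fst \<psi>)" "\<And>p. p \<in> fst \<psi> \<Longrightarrow> ext_d \<A> B p = \<omega> p"
proof -
  let ?W = "fst \<psi>"
  have W: "open ?W" by (rule open_dom[OF \<psi>(1)])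
  have img: "snd \<psi> ` (fst \<psi> \<inter> ?W) = UNIV" using \<psi>(2) by simp
  have f: "lform3 UNIV (cmp3 \<psi> \<omega>)" using forms3_lform[OF \<omega> W \<psi>(1)] unfolding img .
  have cl: "ld3 (cmp3 \<psi> \<omega>) x a b c e = 0" for x a b c e
  proof -
    obtain p where p: "p \<in> ?W" "x = snd \<psi> p" using \<psi>(2) by blast
    show ?thesis using ext_d_coords3[OF \<omega> W \<psi>(1) p(1) p(1), of a b c e] closed[OF p(1)] p by simp
  qed
  obtain g where g: "lform2 UNIV g" "\<And>x a b c. ld2 g x a b c = cmp3 \<psi> \<omega> x a b c"
    using poincare_lemma_3[OF fd f cl] by blast
  define B where "B p vs = (if p \<in> ?W \<and> length vs = 2 \<and> set vs \<subseteq> tangent_space \<A> p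
    then g (snd \<psi> p) (tcoord \<psi> p (vs ! 0)) (tcoord \<psi> p (vs ! 1)) else 0)" for p vs
  have cmp: "cmp2 c B x a b = pb2 (transition c \<psi>) g x a b" if c: "adm c" and x: "x \<in> snd c ` (fst c \<inter> ?W)" for c x a b
  proof -
    obtain p where p: "p \<in> fst c" "p \<in> ?W" "x = snd c p" using x by blast
    have "tcoord \<psi> p (tangent_of \<A> p c a) = jac c \<psi> p a" for a
      using p c \<psi> tangent_of_change[OF c \<psi>(1) p(1,2), of a] by (simp add: tcoord_tangent_of)
    then show ?thesis using p c tangent_of_in[OF c p(1)]
      by (simp add: components_at B_def pb2_def transition_at jac_def)
  qed
  have B: "B \<in> forms \<A> 2 ?W"
  proof (rule forms2I)
    fix c assume "c \<in> \<A>"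
    then have c: "adm c" by (rule adm_atlas)
    have "lform2 (snd c ` (fst c \<inter> ?W)) (pb2 (transition c \<psi>) g)"
      by (rule lform2_pb[OF fd open_img[OF c W] open_UNIV _ smooth_transition[OF c \<psi>(1)] g(1)]) simp
    then show "lform2 (snd c ` (fst c \<inter> ?W)) (cmp2 c B)"
      by (rule lform2_cong[OF open_img[OF c W] cmp[OF c], rotated])
  next
    show "supp 2 ?W B" by (auto simp: supp_def B_def)
  qed
  have "ext_d \<A> B p vs = \<omega> p vs" if p: "p \<in> ?W" for p vs
  proof (cases "length vs = 3 \<and> set vs \<subseteq> tangent_space \<A> p")
    case True
    then obtain u v w where vs: "vs = [u, v, w]" by (auto simp: length_Suc_conv numeral_eq_Suc)
    have t: "tangent_of \<A> p \<psi> (tcoord \<psi> p z) = z" if "z \<in> set vs" for z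
      using True that by (intro tangent_of_tcoord \<psi> p) auto
    have x: "snd \<psi> p \<in> UNIV" by simp
    \<comment> \<open>\<open>\<psi>\<close> maps onto the whole model space, so its transition to
      itself is the identity everywhere, and the components of \<open>B\<close> in
      \<open>\<psi>\<close> are just \<open>g\<close>.\<close>
    have tr: "transition \<psi> \<psi> y = y" and jt: "fderiv (transition \<psi> \<psi>) y e = e" for y e
    proof -
      obtain q where q: "q \<in> ?W" "y = snd \<psi> q" using \<psi>(2) by blast
      then show "transition \<psi> \<psi> y = y" "fderiv (transition \<psi> \<psi>) y e = e"
        using transition_at[OF \<psi>(1)] jac_self[OF \<psi>(1) q(1), of e] by (simp_all add: jac_def)
    qed
    have "ext_d \<A> B p vs = ld2 (cmp2 \<psi> B) (snd \<psi> p) (tcoord \<psi> p u) (tcoord \<psi> p v) (tcoord \<psi> p w)"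
      using ext_d_coords2[OF B W \<psi>(1) p p, of "tcoord \<psi> p u" "tcoord \<psi> p v" "tcoord \<psi> p w"] t by (simp add: vs)
    also have "\<dots> = ld2 g (snd \<psi> p) (tcoord \<psi> p u) (tcoord \<psi> p v) (tcoord \<psi> p w)"
      by (rule ld2_cong[OF open_UNIV x]) (use cmp[OF \<psi>(1)] img in \<open>simp add: pb2_def tr jt\<close>)
    also have "\<dots> = \<omega> p vs" using t \<psi> p by (simp add: g components_at vs)
    finally show ?thesis .
  next
    case False
    then show ?thesis using ext_d_eq_0[OF forms_supp[OF B] W p] suppD[OF forms_supp[OF \<omega>]] by auto
  qed
  then show thesis using that[OF B] by blast
qed

subsection \<open>Vector fields\<close>

lemma coordinate_vfield:
  assumes "adm \<psi>"
  shows "(\<lambda>q. tangent_of \<A> q \<psi> e) \<in> vfields \<A> (fst \<psi>)"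
  unfolding vfields_def mem_Collect_eq
proof (intro conjI ballI)
  fix p assume "p \<in> fst \<psi>" then show "tangent_of \<A> p \<psi> e \<in> tangent_space \<A> p" by (rule tangent_of_in[OF assms])
next
  fix c assume "c \<in> \<A>"
  then have c: "adm c" by (rule adm_atlas)
  let ?N = "snd c ` (fst c \<inter> fst \<psi>)"
  have "smooth_on ?N (\<lambda>x. fderiv (transition \<psi> c) (transition c \<psi> x) e)"
    by (rule smooth_on_compose[OF fd open_img[OF c open_dom[OF assms]] open_img[OF assms open_dom[OF c]] _
        smooth_on_fderiv[OF smooth_transition[OF assms c]] smooth_transition[OF c assms]])
      (auto simp: transition_at c)
  then show "smooth_on ?N (\<lambda>x. tangent_of \<A> (chart_inv c x) \<psi> e c)"
  proof (rule smooth_on_congI[OF open_img[OF c open_dom[OF assms]]])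
    fix x assume "x \<in> ?N"
    then obtain q where q: "q \<in> fst c" "q \<in> fst \<psi>" "x = snd c q" by blast
    then show "tangent_of \<A> (chart_inv c x) \<psi> e c = fderiv (transition \<psi> c) (transition c \<psi> x) e"
      using c \<open>c \<in> \<A>\<close> by (simp add: tangent_of_eq chart_inv_left adm_chart charts_at_def jac_def transition_at)
  qed
qed

lemma vfield_coords:
  assumes "X \<in> vfields \<A> W" "c \<in> \<A>"
  shows "smooth_on (snd c ` (fst c \<inter> W)) (\<lambda>x. X (chart_inv c x) c)"
    "q \<in> W \<Longrightarrow> q \<in> fst c \<Longrightarrow> tangent_of \<A> q c (X q c) = X q"
    "q \<in> W \<Longrightarrow> X q \<in> tangent_space \<A> q"
  using assms tangent_of_coord[of c q "X q"] by (auto simp: vfields_def charts_at_def)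

text \<open>The bracket is given chart by chart. Differentiating the transformation laws of
  \<open>X\<close> and \<open>Y\<close> adds second derivatives of the transition map, which cancel
  in the difference by symmetry.\<close>

lemma vf_bracket_in:
  assumes X: "X \<in> vfields \<A> W" and Y: "Y \<in> vfields \<A> W" and W: "open W" "p \<in> W"
  shows "vf_bracket \<A> X Y p \<in> tangent_space \<A> p"
  unfolding tangent_space_iff
proof (intro conjI ballI allI impI)
  fix c c' assume "c \<in> charts_at \<A> p" "c' \<in> charts_at \<A> p"
  then have cA: "c \<in> \<A>" "c' \<in> \<A>" and c: "adm c" "adm c'" "p \<in> fst c" "p \<in> fst c'"
    and cp: "c \<in> charts_at \<A> p" "c' \<in> charts_at \<A> p" by (auto simp: charts_at_def adm_atlas)
  define T where "T = transition c c'"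
  define N where "N = snd c ` (fst c \<inter> (fst c' \<inter> W))"
  have N: "open N" unfolding N_def by (intro open_img open_Int open_dom c W)
  define x where "x = snd c p"
  have x: "x \<in> N" using c W by (auto simp: N_def x_def)
  have T: "smooth_on N T" unfolding T_def
    by (rule smooth_on_subset[OF smooth_transition[OF c(1,2)]]) (auto simp: N_def)
  \<comment> \<open>The representative of \<open>Z\<close> in \<open>c'\<close> is differentiated
    along \<open>T\<close> in two ways: by the chain rule, and after replacing it by
    \<open>fderiv T\<close> of the representative in \<open>c\<close>.\<close>
  have key: "fderiv (\<lambda>y. Z (chart_inv c' y) c') (T x) (fderiv T x v) =
      fderiv T x (fderiv (\<lambda>y. Z (chart_inv c y) c) x v) + fderiv (\<lambda>y. fderiv T y (Z p c)) x v"
    if Z: "Z \<in> vfields \<A> W" for Z v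
  proof -
    have dT: "(T has_derivative fderiv T x) (at x)" by (rule smooth_on_has_derivative[OF T x])
    have "T x = snd c' p" using c by (simp add: T_def x_def transition_at)
    then have "((\<lambda>y. Z (chart_inv c' y) c') has_derivative fderiv (\<lambda>y. Z (chart_inv c' y) c') (T x)) (at (T x))"
      by (intro smooth_on_has_derivative[OF vfield_coords(1)[OF Z cA(2)]]) (use c W in auto)
    from has_derivative_compose[OF dT this]
    have "((\<lambda>y. Z (chart_inv c' (T y)) c') has_derivative (\<lambda>v. fderiv (\<lambda>y. Z (chart_inv c' y) c') (T x) (fderiv T x v))) (at x)" .
    then have 1: "((\<lambda>y. fderiv T y (Z (chart_inv c y) c)) has_derivative (\<lambda>v. fderiv (\<lambda>y. Z (chart_inv c' y) c') (T x) (fderiv T x v))) (at x)"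
    proof (rule has_derivative_transform_within_open[OF _ N x])
      fix y assume "y \<in> N"
      then obtain q where q: "q \<in> fst c" "q \<in> fst c'" "q \<in> W" "y = snd c q" by (auto simp: N_def)
      then have "Z q c' = jac c c' q (Z q c)"
      proof -
        have "c \<in> charts_at \<A> q" "c' \<in> charts_at \<A> q" using cA q by (auto simp: charts_at_def)
        then show ?thesis using vfield_coords(3)[OF Z cA(1) q(3)] unfolding tangent_space_iff by blast
      qed
      then show "Z (chart_inv c' (T y)) c' = fderiv T y (Z (chart_inv c y) c)"
        using q c by (simp add: T_def transition_at chart_inv_left adm_chart jac_def)
    qed
    have "((\<lambda>y. Z (chart_inv c y) c) has_derivative fderiv (\<lambda>y. Z (chart_inv c y) c) x) (at x)"
      by (rule smooth_on_has_derivative[OF vfield_coords(1)[OF Z cA(1)]]) (use c W in \<open>auto simp: x_def\<close>)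
    from has_derivative_linear_family[OF fd N x linear_frechet_derivative[OF smooth_on_differentiable[OF T]]
        smooth_on_has_derivative[OF smooth_on_fderiv[OF T] x] this]
    have "((\<lambda>y. fderiv T y (Z (chart_inv c y) c)) has_derivative (\<lambda>v. fderiv (\<lambda>y. fderiv T y (Z (chart_inv c x) c)) x v
      + fderiv T x (fderiv (\<lambda>y. Z (chart_inv c y) c) x v))) (at x)"
      by simp
    from fderiv_eq[OF this, of v] fderiv_eq[OF 1, of v] show ?thesis
      using c by (simp add: x_def chart_inv_left adm_chart add.commute)
  qed
  have tr: "Z p c' = fderiv T x (Z p c)" if "Z \<in> vfields \<A> W" for Z
    using vfield_coords(3)[OF that cA(1) W(2)] cp unfolding tangent_space_iff jac_def T_def x_def by blast
  have "T x = snd c' p" using c by (simp add: T_def x_def transition_at)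
  then have "vf_bracket \<A> X Y p c' = fderiv T x (fderiv (\<lambda>y. Y (chart_inv c y) c) x (X p c))
      + fderiv (\<lambda>y. fderiv T y (Y p c)) x (X p c)
      - (fderiv T x (fderiv (\<lambda>y. X (chart_inv c y) c) x (Y p c)) + fderiv (\<lambda>y. fderiv T y (X p c)) x (Y p c))"
    using cp key[OF Y, of "X p c"] key[OF X, of "Y p c"] by (simp add: vf_bracket_def tr[OF X] tr[OF Y])
  also have "\<dots> = fderiv T x (fderiv (\<lambda>y. Y (chart_inv c y) c) x (X p c)) - fderiv T x (fderiv (\<lambda>y. X (chart_inv c y) c) x (Y p c))"
    using second_derivative_symmetric[OF N T x, of "Y p c" "X p c"] by simp
  also have "\<dots> = jac c c' p (vf_bracket \<A> X Y p c)"
    using cp linear_diff[OF linear_jac[OF c]] by (simp add: vf_bracket_def jac_def T_def x_def)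
  finally show "vf_bracket \<A> X Y p c' = jac c c' p (vf_bracket \<A> X Y p c)" .
qed (simp add: vf_bracket_def)

end

section \<open>Chern-Simons and Pontryagin forms of a connection\<close>

locale lie_mfd = mfd \<A> + qla br pr
  for \<A> :: "('m::{t2_space,second_countable_topology}, 'e::banach) chart set"
    and br :: "'g::banach \<Rightarrow> 'g \<Rightarrow> 'g" and pr :: "'g \<Rightarrow> 'g \<Rightarrow> real"
begin

lemma ext_d1_antisym: "ext_d \<A> \<theta> p [w, v] = - ext_d \<A> \<theta> p [v, w]"
  by (simp add: ext_d_def Let_def)

text \<open>The factor 2 is 6 times \<open>1 / 3\<close>: each of the three terms of the second
  wedge product equals twice (\<theta>(u), [\<theta>(v), \<theta>(w)]).\<close>

lemma cs3_eq:
  "cs3 \<A> br pr \<theta> p [u, v, w] = pr (\<theta> p [u]) (ext_d \<A> \<theta> p [v, w]) - pr (\<theta> p [v]) (ext_d \<A> \<theta> p [u, w])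
    + pr (\<theta> p [w]) (ext_d \<A> \<theta> p [u, v]) + 2 * pr (\<theta> p [u]) (br (\<theta> p [v]) (\<theta> p [w]))"
proof -
  define \<gamma> where "\<gamma> = wedge br 1 1 \<theta> \<theta>"
  have \<gamma>: "\<gamma> p [v, w] = 2 *\<^sub>R br (\<theta> p [v]) (\<theta> p [w])" for v w
    using br_antisym[of "\<theta> p [w]" "\<theta> p [v]"] by (simp add: \<gamma>_def wedge_1_1[unfolded One_nat_def] scaleR_2)
  have "\<gamma> p [w, v] = - \<gamma> p [v, w]" for v w
    unfolding \<gamma> using br_antisym[of "\<theta> p [w]" "\<theta> p [v]"] by simp
  from wedge_1_2[of \<gamma> p pr \<theta> u v w, OF this bilinear_pr]
  have 1: "wedge pr 1 2 \<theta> \<gamma> p [u, v, w] = 6 * pr (\<theta> p [u]) (br (\<theta> p [v]) (\<theta> p [w]))"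
    unfolding \<gamma> using pr_swap[of "\<theta> p [v]" "\<theta> p [u]" "\<theta> p [w]"] pr_cyc[of "\<theta> p [w]" "\<theta> p [u]" "\<theta> p [v]"]
      pr_cyc[of "\<theta> p [v]" "\<theta> p [w]" "\<theta> p [u]"]
    by (simp only: pr_simps) simp
  show ?thesis
    unfolding cs3_def \<gamma>_def[symmetric] 1 using wedge_1_2[of "ext_d \<A> \<theta>" p pr \<theta> u v w, OF ext_d1_antisym bilinear_pr] by simp
qed

lemma cs3_zero:
  assumes "\<theta> \<in> tensors \<A> 1 W" "open W" "p \<in> W" "\<not> (length vs = 3 \<and> set vs \<subseteq> tangent_space \<A> p)"
  shows "cs3 \<A> br pr \<theta> p vs = 0"
proof (cases "length vs = 3")
  case True
  then obtain u v w where vs: "vs = [u, v, w]" by (auto simp: length_Suc_conv numeral_eq_Suc)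
  have z: "\<theta> p [z] = 0" "ext_d \<A> \<theta> p [z, y] = 0" "ext_d \<A> \<theta> p [y, z] = 0" if "z \<notin> tangent_space \<A> p" for z y
    using that suppD[OF tensors_supp[OF assms(1)], of p "[z]"] by (auto simp: ext_d_def)
  show ?thesis using assms(4) True z unfolding vs cs3_eq
    by (auto simp: pr_simps br_simps)
next
  case False
  then show ?thesis by (simp add: cs3_def wedge_length)
qed

lemma cmp3_cs3:
  assumes \<theta>: "\<theta> \<in> tensors \<A> 1 W" "open W" and c: "adm c" and x: "x \<in> snd c ` (fst c \<inter> W)"
  shows "cmp3 c (cs3 \<A> br pr \<theta>) x a b e = lcs (cmp1 c \<theta>) x a b e"
proof -
  obtain p where p: "p \<in> fst c" "p \<in> W" "x = snd c p" using x by blast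
  show ?thesis unfolding lcs_def using p c
    by (simp add: components_at cs3_eq ext_d_coords1[OF \<theta> c])
qed

lemma cs3_form:
  assumes \<theta>: "\<theta> \<in> tensors \<A> 1 W" "open W"
  shows "res W (cs3 \<A> br pr \<theta>) \<in> forms \<A> 3 W"
proof (rule forms3I)
  fix c assume "c \<in> \<A>"
  then have c: "adm c" by (rule adm_atlas)
  show "lform3 (snd c ` (fst c \<inter> W)) (cmp3 c (res W (cs3 \<A> br pr \<theta>)))"
    by (rule lform3_cong[OF open_img[OF c \<theta>(2)] _ lform3_lcs[OF open_img[OF c \<theta>(2)] forms1_lform[OF \<theta> c]]])
      (simp add: components_res c cmp3_cs3[OF \<theta> c])
next
  show "supp 3 W (res W (cs3 \<A> br pr \<theta>))"
    using cs3_zero[OF \<theta>] by (auto simp: supp_def res_def)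
qed

lemma curvature_eq:
  "curvature \<A> br \<theta> p [v, w] = ext_d \<A> \<theta> p [v, w] + br (\<theta> p [v]) (\<theta> p [w])"
  using br_antisym[of "\<theta> p [w]" "\<theta> p [v]"] by (simp add: curvature_def wedge_1_1[unfolded One_nat_def] scaleR_2[symmetric])

lemma curvature_antisym: "curvature \<A> br \<theta> p [w, v] = - curvature \<A> br \<theta> p [v, w]"
  unfolding curvature_eq using ext_d1_antisym[of \<theta> p w v] br_antisym[of "\<theta> p [w]" "\<theta> p [v]"] by simp

lemma pontryagin_eq:
  fixes \<theta> :: "('m, 'e, 'g) tensor"
  defines "R \<equiv> curvature \<A> br \<theta>"
  shows "wedge pr 2 2 R R p [u, v, w, z] =
    2 * (pr (R p [u, v]) (R p [w, z]) - pr (R p [u, w]) (R p [v, z]) + pr (R p [u, z]) (R p [v, w]))"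
  unfolding R_def
  by (subst wedge_2_2[of "curvature \<A> br \<theta>" p pr u v w z, OF curvature_antisym bilinear_pr pr_sym]) simp

lemma pontryagin_zero:
  assumes "\<theta> \<in> tensors \<A> 1 W" "open W" "p \<in> W" "\<not> (length vs = 4 \<and> set vs \<subseteq> tangent_space \<A> p)"
  shows "wedge pr 2 2 (curvature \<A> br \<theta>) (curvature \<A> br \<theta>) p vs = 0"
proof (cases "length vs = 4")
  case True
  then obtain u v w y where vs: "vs = [u, v, w, y]" by (auto simp: length_Suc_conv numeral_eq_Suc)
  have z: "curvature \<A> br \<theta> p [z, y] = 0" "curvature \<A> br \<theta> p [y, z] = 0" if "z \<notin> tangent_space \<A> p" for z y
    using that suppD[OF tensors_supp[OF assms(1)], of p "[z]"] by (auto simp: ext_d_def curvature_eq br_simps)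
  show ?thesis using assms(4) True z unfolding vs pontryagin_eq
    by (auto simp: pr_simps)
next
  case False
  then show ?thesis by (simp add: wedge_length)
qed

lemma ext_d_cs3:
  assumes \<theta>: "\<theta> \<in> tensors \<A> 1 W" "open W" and p: "p \<in> W"
  shows "ext_d \<A> (res W (cs3 \<A> br pr \<theta>)) p vs = wedge pr 2 2 (curvature \<A> br \<theta>) (curvature \<A> br \<theta>) p vs"
proof (cases "length vs = 4 \<and> set vs \<subseteq> tangent_space \<A> p")
  case True
  define c where "c = chart_at \<A> p"
  have c: "c \<in> charts_at \<A> p" "adm c" "p \<in> fst c" "c \<in> \<A>" using chart_at chart_at_in by (auto simp: c_def)
  note o = open_img[OF c(2) \<theta>(2)]
  have x: "snd c p \<in> snd c ` (fst c \<inter> W)" using c p by auto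
  obtain v1 v2 v3 v4 where vs: "vs = [v1, v2, v3, v4]"
    using True by (auto simp: length_Suc_conv numeral_eq_Suc)
  have R: "ld1 (cmp1 c \<theta>) (snd c p) a b + br (cmp1 c \<theta> (snd c p) a) (cmp1 c \<theta> (snd c p) b)
      = curvature \<A> br \<theta> p [tangent_of \<A> p c a, tangent_of \<A> p c b]" for a b
    unfolding curvature_eq using ext_d_coords1[OF \<theta> c(2,3) p] c by (simp add: components_at)
  have "ext_d \<A> (res W (cs3 \<A> br pr \<theta>)) p (map (tangent_of \<A> p c) [v1 c, v2 c, v3 c, v4 c]) =
      ld3 (cmp3 c (res W (cs3 \<A> br pr \<theta>))) (snd c p) (v1 c) (v2 c) (v3 c) (v4 c)"
    using ext_d_coords3[OF cs3_form[OF \<theta>] \<theta>(2) c(2,3) p] by simp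
  also have "\<dots> = ld3 (lcs (cmp1 c \<theta>)) (snd c p) (v1 c) (v2 c) (v3 c) (v4 c)"
    by (rule ld3_cong[OF o x]) (simp add: components_res c cmp3_cs3[OF \<theta> c(2)])
  also have "\<dots> = wedge pr 2 2 (curvature \<A> br \<theta>) (curvature \<A> br \<theta>) p (map (tangent_of \<A> p c) [v1 c, v2 c, v3 c, v4 c])"
    unfolding ld3_lcs[OF o forms1_lform[OF \<theta> c(2)] x] R list.map pontryagin_eq ..
  finally show ?thesis using tangent_list_coords[OF c(1), of vs] True by (simp add: vs)
next
  case False
  then show ?thesis
    using ext_d_eq_0[OF forms_supp[OF cs3_form[OF \<theta>]] \<theta>(2) p, of vs] pontryagin_zero[OF \<theta> p, of vs] by auto
qed

end

section \<open>Gauge transformations\<close>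

text \<open>\<open>deriv_\<tau>\<close> and \<open>flat\<close> are the conditions on \<tau> and
  \<phi> for single tangent vectors instead of vector fields. The locale is instantiated with the
  transition data on overlaps and, for isomorphisms of lifts, with \<open>\<phi> = 0\<close> and
  \<open>\<tau> = id\<close>.\<close>

locale gauge = lie_mfd \<A> br pr
  for \<A> :: "('m::{t2_space,second_countable_topology}, 'e::banach) chart set"
    and br :: "'g::banach \<Rightarrow> 'g \<Rightarrow> 'g" and pr :: "'g \<Rightarrow> 'g \<Rightarrow> real" +
  fixes W :: "'m set" and \<theta> \<theta>' \<phi> :: "('m, 'e, 'g) tensor" and \<tau> :: "'m \<Rightarrow> 'g \<Rightarrow> 'g"
  assumes W: "open W"
    and \<theta>: "\<theta> \<in> forms \<A> 1 W" and \<theta>': "\<theta>' \<in> forms \<A> 1 W" and \<phi>: "\<phi> \<in> forms \<A> 1 W"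
    and aut: "aut_field \<A> br pr W \<tau>"
    and compat: "connection_compat \<A> br W \<phi> \<tau>"
    and deriv_\<tau>: "\<And>p v a. p \<in> W \<Longrightarrow> v \<in> tangent_space \<A> p \<Longrightarrow>
      vderiv \<A> p v (\<lambda>q. \<tau> q a) = - br (\<phi> p [v]) (\<tau> p a)"
    and flat: "\<And>p u v. p \<in> W \<Longrightarrow> u \<in> tangent_space \<A> p \<Longrightarrow> v \<in> tangent_space \<A> p \<Longrightarrow>
      ext_d \<A> \<phi> p [u, v] + br (\<phi> p [u]) (\<phi> p [v]) = 0"
    and gauge: "\<And>p v. p \<in> W \<Longrightarrow> v \<in> tangent_space \<A> p \<Longrightarrow> \<theta> p [v] = \<tau> p (\<theta>' p [v]) + \<phi> p [v]"
begin

lemma tau: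
  assumes "p \<in> W"
  shows "linear (\<tau> p)" "\<tau> p (br a b) = br (\<tau> p a) (\<tau> p b)" "pr (\<tau> p a) (\<tau> p b) = pr a b"
  using aut assms by (auto simp: aut_field_def quad_aut_def)

lemma tau_coords:
  assumes "c \<in> \<A>"
  shows "smooth_on (snd c ` (fst c \<inter> W)) (\<lambda>y. \<tau> (chart_inv c y) a)"
    "y \<in> snd c ` (fst c \<inter> W) \<Longrightarrow> linear (\<tau> (chart_inv c y))"
    "y \<in> snd c ` (fst c \<inter> W) \<Longrightarrow> cmp1 c \<theta> y u = \<tau> (chart_inv c y) (cmp1 c \<theta>' y u) + cmp1 c \<phi> y u"
proof -
  note c = adm_atlas[OF assms]
  show "smooth_on (snd c ` (fst c \<inter> W)) (\<lambda>y. \<tau> (chart_inv c y) a)"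
    using aut assms by (auto simp: aut_field_def smooth_map_def o_def)
  assume "y \<in> snd c ` (fst c \<inter> W)"
  then obtain q where q: "q \<in> fst c" "q \<in> W" "y = snd c q" by blast
  show "linear (\<tau> (chart_inv c y))"
    using q tau(1)[OF q(2)] by (simp add: chart_inv_left adm_chart c)
  show "cmp1 c \<theta> y u = \<tau> (chart_inv c y) (cmp1 c \<theta>' y u) + cmp1 c \<phi> y u"
    using q gauge[OF q(2) tangent_of_in[OF c q(1)]] by (simp add: components_at chart_inv_left adm_chart c)
qed

text \<open>The only \<open>\<beta>\<close> that can complete \<open>(\<phi>, \<tau>)\<close> to a 1-morphism with \<open>B' - B = b\<close>.\<close>

definition beta_of :: "('m, 'e, real) tensor \<Rightarrow> ('m, 'e, real) tensor" where
  "beta_of b p vs = (if p \<in> W \<and> length vs = 2 \<and> set vs \<subseteq> tangent_space \<A> p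
    then b p vs - pr (\<theta> p [vs ! 1]) (\<theta> p [vs ! 0]) + pr (\<theta>' p [vs ! 1]) (\<theta>' p [vs ! 0]) +
      2 * pr (\<tau> p (\<theta>' p [vs ! 0])) (\<phi> p [vs ! 1]) else 0)"

lemma beta_of_tangent:
  assumes "p \<in> W" "v \<in> tangent_space \<A> p" "w \<in> tangent_space \<A> p"
  shows "beta_of b p [v, w] = b p [v, w] - pr (\<theta> p [w]) (\<theta> p [v]) + pr (\<theta>' p [w]) (\<theta>' p [v]) +
      2 * pr (\<tau> p (\<theta>' p [v])) (\<phi> p [w])"
  using assms by (simp add: beta_of_def)

lemma beta_of_coords:
  assumes "c \<in> \<A>" "y \<in> snd c ` (fst c \<inter> W)"
  shows "cmp2 c (beta_of b) y u v = cmp2 c b y u v - pr (cmp1 c \<theta> y v) (cmp1 c \<theta> y u)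
    + pr (cmp1 c \<theta>' y v) (cmp1 c \<theta>' y u) + 2 * pr (\<tau> (chart_inv c y) (cmp1 c \<theta>' y u)) (cmp1 c \<phi> y v)"
proof -
  note c = adm_atlas[OF assms(1)]
  obtain q where q: "q \<in> fst c" "q \<in> W" "y = snd c q" using assms(2) by blast
  show ?thesis using q c by (simp add: components_at beta_of_tangent tangent_of_in chart_inv_left adm_chart)
qed

lemma beta_of_tensor:
  assumes b: "b \<in> forms \<A> 2 W"
  shows "beta_of b \<in> tensors \<A> 2 W"
proof (rule tensors2I)
  show "supp 2 W (beta_of b)" by (auto simp: supp_def beta_of_def)
next
  fix c u v assume cA: "c \<in> \<A>"
  note c = adm_atlas[OF cA] and o = open_img[OF adm_atlas[OF cA] W]
  note l = forms1_lform[OF forms_tensors[OF \<theta>] W c] forms1_lform[OF forms_tensors[OF \<theta>'] W c]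
    forms1_lform[OF forms_tensors[OF \<phi>] W c]
  show "smooth_on (snd c ` (fst c \<inter> W)) (\<lambda>x. cmp2 c (beta_of b) x u v)"
    by (rule smooth_on_congI[OF o _ beta_of_coords[OF cA]])
      (intro smooth_on_add[OF o] smooth_on_diff[OF o] smooth_on_mult_left[OF o] smooth_on_bilinear[OF bounded_pr o]
        lform1D(2)[OF l(1)] lform1D(2)[OF l(2)] lform1D(2)[OF l(3)] lform2D(5)[OF forms2_lform[OF b W c]]
        smooth_on_linear_family[OF fin_dim_g o tau_coords(2)[OF cA] tau_coords(1)[OF cA]])
next
  fix c x assume cA: "c \<in> \<A>" and x: "x \<in> snd c ` (fst c \<inter> W)"
  note c = adm_atlas[OF cA]
  note l = lform1D(1)[OF forms1_lform[OF forms_tensors[OF \<theta>] W c] x] lform1D(1)[OF forms1_lform[OF forms_tensors[OF \<theta>'] W c] x]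
    lform1D(1)[OF forms1_lform[OF forms_tensors[OF \<phi>] W c] x] tau_coords(2)[OF cA x]
  note b' = lform2D(2,3)[OF forms2_lform[OF b W c] x]
  note s = linear_add[OF l(1)] linear_add[OF l(2)] linear_add[OF l(3)] linear_add[OF l(4)]
    linear_cmul[OF l(1)] linear_cmul[OF l(2)] linear_cmul[OF l(3)] linear_cmul[OF l(4)]
    linear_add[OF b'(1)] linear_add[OF b'(2)] linear_cmul[OF b'(1)] linear_cmul[OF b'(2)]
  show "bilinear (cmp2 c (beta_of b) x)"
    unfolding bilinear_alt
    by (intro conjI allI linearI) (simp_all add: beta_of_coords[OF cA x] s pr_simps algebra_simps)
qed

text \<open>After expanding \<theta> = \<tau>\<theta>' + \<phi>, orthogonality of \<tau> cancels the
  terms in \<theta>' alone, the mixed terms cancel against the last summand of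
  \<open>beta_of\<close>, and the 2-form \<open>b\<close> drops out by antisymmetry.\<close>

lemma beta_of_symmetric_part:
  assumes b: "b \<in> forms \<A> 2 W" and p: "p \<in> W" and v: "v \<in> tangent_space \<A> p" and w: "w \<in> tangent_space \<A> p"
  shows "beta_of b p [v, w] + beta_of b p [w, v] = - 2 * pr (\<phi> p [v]) (\<phi> p [w])"
proof -
  define c where "c = chart_at \<A> p"
  have c: "c \<in> charts_at \<A> p" "adm c" "p \<in> fst c" "c \<in> \<A>" using chart_at chart_at_in by (auto simp: c_def)
  have x: "snd c p \<in> snd c ` (fst c \<inter> W)" using c p by auto
  have "cmp2 c b (snd c p) (w c) (v c) = - cmp2 c b (snd c p) (v c) (w c)"
    by (rule lform2_antisym[OF forms2_lform[OF b W c(2)] x])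
  then have "b p [w, v] = - b p [v, w]"
    using c tangent_of_coord[OF c(1) v] tangent_of_coord[OF c(1) w] by (simp add: components_at)
  then show ?thesis
    using tau(3)[OF p, of "\<theta>' p [v]" "\<theta>' p [w]"]
    by (simp add: beta_of_tangent p v w gauge pr_simps pr_sym[of "\<theta>' p [w]"] pr_sym[of "\<tau> p (\<theta>' p [w])"]
        pr_sym[of "\<phi> p [w]"])
qed

end

section \<open>Gauge transformations in coordinates around a point\<close>

locale gauge_at = gauge +
  fixes p
  assumes p: "p \<in> W"
begin

definition "c = chart_at \<A> p"
definition "x = snd c p"
definition "N = snd c ` (fst c \<inter> W)"
abbreviation "f \<equiv> cmp1 c \<theta>"
abbreviation "f' \<equiv> cmp1 c \<theta>'"
abbreviation "h \<equiv> cmp1 c \<phi>"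
abbreviation "t \<equiv> \<lambda>y. \<tau> (chart_inv c y)"

lemma c: "c \<in> charts_at \<A> p" "adm c" "p \<in> fst c" "c \<in> \<A>"
  using chart_at chart_at_in by (auto simp: c_def)

lemma N: "open N" "x \<in> N"
  using c p open_img[OF c(2) W] by (auto simp: N_def x_def)

lemma inv_x: "chart_inv c x = p" using c by (simp add: x_def chart_inv_left adm_chart)

lemma lforms: "lform1 N f" "lform1 N f'" "lform1 N h"
  using forms1_lform[OF forms_tensors[OF \<theta>] W c(2)] forms1_lform[OF forms_tensors[OF \<theta>'] W c(2)]
    forms1_lform[OF forms_tensors[OF \<phi>] W c(2)] by (simp_all add: N_def)

lemma deriv:
  "((\<lambda>y. f y u) has_derivative fderiv (\<lambda>y. f y u) x) (at x)"
  "((\<lambda>y. f' y u) has_derivative fderiv (\<lambda>y. f' y u) x) (at x)"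
  "((\<lambda>y. h y u) has_derivative fderiv (\<lambda>y. h y u) x) (at x)"
  using smooth_on_has_derivative[OF lform1D(2)[OF lforms(1)] N(2)]
    smooth_on_has_derivative[OF lform1D(2)[OF lforms(2)] N(2)] smooth_on_has_derivative[OF lform1D(2)[OF lforms(3)] N(2)] .

lemma t_has_derivative: "((\<lambda>y. t y a) has_derivative (\<lambda>v. - br (h x v) (t x a))) (at x)"
proof -
  have "fderiv (\<lambda>y. t y a) x v = - br (h x v) (t x a)" for v
    using deriv_\<tau>[OF p tangent_of_in[OF c(2,3)], of v a] tangent_of_atlas[OF c(1), of v] c
    by (simp add: vderiv_def Let_def c_def[symmetric] o_def x_def[symmetric] inv_x components_def)
  then have "fderiv (\<lambda>y. t y a) x = (\<lambda>v. - br (h x v) (t x a))" by blast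
  then show ?thesis
    using smooth_on_has_derivative[OF tau_coords(1)[OF c(4), of a]] N by (metis N_def)
qed

lemma t_f'_has_derivative:
  "((\<lambda>y. t y (f' y u)) has_derivative (\<lambda>v. t x (fderiv (\<lambda>y. f' y u) x v) - br (h x v) (t x (f' x u)))) (at x)"
proof -
  have "((\<lambda>y. t y (f' y u)) has_derivative (\<lambda>v. - br (h x v) (t x (f' x u)) + t x (fderiv (\<lambda>y. f' y u) x v))) (at x)"
    by (rule has_derivative_linear_family[OF fin_dim_g N _ t_has_derivative deriv(2)])
      (use tau_coords(2)[OF c(4)] in \<open>simp add: N_def\<close>)
  then show ?thesis by simp
qed

lemma fderiv_f: "fderiv (\<lambda>y. f y u) x v =
    t x (fderiv (\<lambda>y. f' y u) x v) - br (h x v) (t x (f' x u)) + fderiv (\<lambda>y. h y u) x v"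
proof (rule fderiv_eq)
  have "((\<lambda>y. t y (f' y u) + h y u) has_derivative
    (\<lambda>v. t x (fderiv (\<lambda>y. f' y u) x v) - br (h x v) (t x (f' x u)) + fderiv (\<lambda>y. h y u) x v)) (at x)"
    by (intro has_derivative_add t_f'_has_derivative deriv)
  then show "((\<lambda>y. f y u) has_derivative
    (\<lambda>v. t x (fderiv (\<lambda>y. f' y u) x v) - br (h x v) (t x (f' x u)) + fderiv (\<lambda>y. h y u) x v)) (at x)"
    by (rule has_derivative_transform_within_open[OF _ N]) (use tau_coords(3)[OF c(4)] in \<open>simp add: N_def\<close>)
qed

lemma f_x: "f x u = t x (f' x u) + h x u"
  using tau_coords(3)[OF c(4)] N by (simp add: N_def)

lemma t_x: "linear (t x)" "t x (br a b) = br (t x a) (t x b)" "pr (t x a) (t x b) = pr a b"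
  using tau[OF p] by (simp_all add: inv_x)

lemma flat_x: "fderiv (\<lambda>y. h y v) x u - fderiv (\<lambda>y. h y u) x v = - br (h x u) (h x v)"
  using flat[OF p tangent_of_in[OF c(2,3)] tangent_of_in[OF c(2,3)], of u v]
    ext_d_coords1[OF forms_tensors[OF \<phi>] W c(2,3) p, of u v] c
  by (simp add: ld1_def components_at x_def[symmetric] eq_neg_iff_add_eq_0) (simp add: components_at x_def)

text \<open>The terms from differentiating \<tau> cancel the mixed brackets of \<phi> with
  \<tau>\<theta>', and flatness cancels the bracket of \<phi> with itself. What remains is the
  covariance of the curvature.\<close>

lemma ld1_f: "ld1 f x u v + br (f x u) (f x v) = t x (ld1 f' x u v + br (f' x u) (f' x v))"
proof -
  have "ld1 f x u v = t x (ld1 f' x u v) - br (h x u) (t x (f' x v)) + br (h x v) (t x (f' x u)) - br (h x u) (h x v)"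
    using flat_x[of v u] by (simp add: ld1_def fderiv_f linear_diff[OF t_x(1)])
  then show ?thesis
    using br_antisym[of "h x v" "t x (f' x u)"]
    by (simp add: f_x br_simps linear_add[OF t_x(1)] t_x(2))
qed

lemma curvature_gauge:
  assumes "u \<in> tangent_space \<A> p" "v \<in> tangent_space \<A> p"
  shows "curvature \<A> br \<theta> p [u, v] = \<tau> p (curvature \<A> br \<theta>' p [u, v])"
proof -
  have 1: "curvature \<A> br \<eta> p [u, v] = ld1 (cmp1 c \<eta>) x (u c) (v c) + br (cmp1 c \<eta> x (u c)) (cmp1 c \<eta> x (v c))"
    if "\<eta> \<in> forms \<A> 1 W" for \<eta> :: "('a, 'b, 'c) tensor"
    using ext_d_coords1[OF forms_tensors[OF that] W c(2,3) p, of "u c" "v c"] c tangent_of_coord[OF c(1)] assms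
    by (simp add: curvature_eq components_at x_def)
  show ?thesis unfolding 1[OF \<theta>] 1[OF \<theta>'] ld1_f by (simp add: inv_x)
qed

lemma pontryagin_gauge:
  "wedge pr 2 2 (curvature \<A> br \<theta>) (curvature \<A> br \<theta>) p vs = wedge pr 2 2 (curvature \<A> br \<theta>') (curvature \<A> br \<theta>') p vs"
proof (cases "length vs = 4 \<and> set vs \<subseteq> tangent_space \<A> p")
  case True
  then obtain v1 v2 v3 v4 where "vs = [v1, v2, v3, v4]" by (auto simp: length_Suc_conv numeral_eq_Suc)
  with True show ?thesis
    by (simp add: pontryagin_eq
        curvature_gauge tau(3)[OF p])
next
  case False
  then show ?thesis
    using pontryagin_zero[OF forms_tensors[OF \<theta>] W p, of vs] pontryagin_zero[OF forms_tensors[OF \<theta>'] W p, of vs] by simp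
qed

text \<open>The derivatives of \<open>X\<close> and \<open>Y\<close> cancel because the symmetric part of \<open>\<beta>\<close> is \<open>- (\<phi>, \<phi>)\<close>; what
  remains is tensorial in \<open>X\<close>, \<open>Y\<close> and \<open>w\<close>.\<close>

lemma courant_bracket_eq:
  assumes b: "b \<in> forms \<A> 2 W"
    and cs: "\<And>u v w. cs3 \<A> br pr \<theta>' p [u, v, w] - cs3 \<A> br pr \<theta> p [u, v, w] = ext_d \<A> b p [u, v, w]"
    and X: "X \<in> vfields \<A> W" and Y: "Y \<in> vfields \<A> W" and w: "w \<in> tangent_space \<A> p"
  defines "\<beta> \<equiv> beta_of b"
  shows "lie_deriv \<A> X (contract Y \<beta>) p [w] - contract Y (ext_d \<A> (contract X \<beta>)) p [w] -
        contract (vf_bracket \<A> X Y) \<beta> p [w] +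
        P_form \<A> pr (\<lambda>q. \<phi> q [X q]) (\<lambda>q. \<phi> q [Y q]) p w = 0"
proof -
  define \<beta>c where "\<beta>c = cmp2 c \<beta>"
  define Xc where "Xc y = X (chart_inv c y) c" for y
  define Yc where "Yc y = Y (chart_inv c y) c" for y
  define DX where "DX = fderiv Xc x"
  define DY where "DY = fderiv Yc x"
  define Bd where "Bd u v = fderiv (\<lambda>y. \<beta>c y u v) x" for u v
  define P where "P u = fderiv (\<lambda>y. h y u) x" for u
  define k where "k = w c"
  have XY: "((\<lambda>y. Xc y) has_derivative DX) (at x)" "((\<lambda>y. Yc y) has_derivative DY) (at x)"
    unfolding DX_def DY_def Xc_def Yc_def
    using smooth_on_has_derivative[OF vfield_coords(1)[OF X c(4)]] smooth_on_has_derivative[OF vfield_coords(1)[OF Y c(4)]] N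
    by (simp_all add: N_def)
  note tens = beta_of_tensor[OF b]
  have bil: "bilinear (\<beta>c y)" if "y \<in> N" for y
    unfolding \<beta>c_def \<beta>_def using tensors2_atlas(1)[OF tens c(4)] that by (simp add: N_def)
  have Bd: "((\<lambda>y. \<beta>c y u v) has_derivative Bd u v) (at x)" for u v
    unfolding \<beta>c_def \<beta>_def Bd_def
    using smooth_on_has_derivative[OF tensors2_atlas(2)[OF tens c(4)]] N by (simp add: N_def)
  have Xp: "tangent_of \<A> q c (Xc (snd c q)) = X q" "tangent_of \<A> q c (Yc (snd c q)) = Y q" if "q \<in> fst c" "q \<in> W" for q
    unfolding Xc_def Yc_def using vfield_coords(2)[OF X c(4) that(2,1)] vfield_coords(2)[OF Y c(4) that(2,1)] c that
    by (simp_all add: chart_inv_left adm_chart)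
  have at: "Xc x = X p c" "Yc x = Y p c" by (simp_all add: Xc_def Yc_def inv_x)
  have wk: "tangent_of \<A> p c k = w" unfolding k_def by (rule tangent_of_coord[OF c(1) w])
  have cX: "components \<A> c (contract X \<beta>) y [e] = \<beta>c y (Xc y) e"
    and cY: "components \<A> c (contract Y \<beta>) y [e] = \<beta>c y (Yc y) e"
    and cXY: "components \<A> c (contract X (contract Y \<beta>)) y [] = \<beta>c y (Yc y) (Xc y)"
    and hX: "\<phi> (chart_inv c y) [X (chart_inv c y)] = h y (Xc y)" if "y \<in> N" for y e
    using that c Xp by (auto simp: N_def components_at contract_def \<beta>c_def chart_inv_left adm_chart)
  have tX: "X p \<in> tangent_space \<A> p" "Y p \<in> tangent_space \<A> p"
    using vfield_coords(3)[OF X c(4) p] vfield_coords(3)[OF Y c(4) p] .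
  have d0: "ext_d \<A> \<omega> p [v] = fderiv (\<lambda>y. components \<A> c \<omega> y []) x (v c)" if "v \<in> tangent_space \<A> p" for \<omega> :: "('a, 'b, real) tensor" and v
    using that by (simp add: ext_d_def Let_def c_def[symmetric] x_def[symmetric])
  have d1: "ext_d \<A> \<omega> p [u, v] = fderiv (\<lambda>y. components \<A> c \<omega> y [v c]) x (u c) - fderiv (\<lambda>y. components \<A> c \<omega> y [u c]) x (v c)"
    if "u \<in> tangent_space \<A> p" "v \<in> tangent_space \<A> p" for \<omega> :: "('a, 'b, real) tensor" and u v
    using that by (simp add: ext_d_def Let_def c_def[symmetric] x_def[symmetric])
  have DcX: "fderiv (\<lambda>y. components \<A> c (contract X \<beta>) y [e]) x v = Bd (Xc x) e v + \<beta>c x (DX v) e"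
    and DcY: "fderiv (\<lambda>y. components \<A> c (contract Y \<beta>) y [e]) x v = Bd (Yc x) e v + \<beta>c x (DY v) e" for e v
  proof -
    have lin: "linear (\<lambda>a. \<beta>c y a e)" if "y \<in> N" for y using bil[OF that] by (simp add: bilinear_alt)
    have "fderiv (\<lambda>y. components \<A> c (contract X \<beta>) y [e]) x = fderiv (\<lambda>y. \<beta>c y (Xc y) e) x"
      by (rule fderiv_cong_open[OF N]) (rule cX)
    then show "fderiv (\<lambda>y. components \<A> c (contract X \<beta>) y [e]) x v = Bd (Xc x) e v + \<beta>c x (DX v) e"
      using fderiv_eq[OF has_derivative_linear_family[OF fd N lin Bd XY(1)]] by simp
    have "fderiv (\<lambda>y. components \<A> c (contract Y \<beta>) y [e]) x = fderiv (\<lambda>y. \<beta>c y (Yc y) e) x"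
      by (rule fderiv_cong_open[OF N]) (rule cY)
    then show "fderiv (\<lambda>y. components \<A> c (contract Y \<beta>) y [e]) x v = Bd (Yc x) e v + \<beta>c x (DY v) e"
      using fderiv_eq[OF has_derivative_linear_family[OF fd N lin Bd XY(2)]] by simp
  qed
  have DcXY: "fderiv (\<lambda>y. components \<A> c (contract X (contract Y \<beta>)) y []) x v =
      Bd (Yc x) (Xc x) v + \<beta>c x (Yc x) (DX v) + \<beta>c x (DY v) (Xc x)" for v
  proof -
    have "fderiv (\<lambda>y. components \<A> c (contract X (contract Y \<beta>)) y []) x = fderiv (\<lambda>y. \<beta>c y (Yc y) (Xc y)) x"
      by (rule fderiv_cong_open[OF N]) (rule cXY)
    then show ?thesis
      using fderiv_eq[OF has_derivative_bilinear_family[OF fd fd N bil Bd XY(2,1)]] by simp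
  qed
  have DhX: "vderiv \<A> p w (\<lambda>q. \<phi> q [X q]) = P (Xc x) k + h x (DX k)"
  proof -
    have "vderiv \<A> p w (\<lambda>q. \<phi> q [X q]) = fderiv (\<lambda>y. \<phi> (chart_inv c y) [X (chart_inv c y)]) x k"
      by (simp add: vderiv_def Let_def c_def[symmetric] x_def[symmetric] o_def k_def)
    also have "\<dots> = fderiv (\<lambda>y. h y (Xc y)) x k" using fderiv_cong_open[OF N hX] by simp
    also have "\<dots> = P (Xc x) k + h x (DX k)"
      unfolding P_def by (rule fderiv_eq[OF has_derivative_linear_family[OF fd N lform1D(1)[OF lforms(3)] deriv(3) XY(1)]])
    finally show ?thesis .
  qed
  have \<phi>Y: "\<phi> p [Y p] = h x (Yc x)" using Xp(2)[OF c(3) p] c by (simp add: components_at x_def)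
  have br_c: "vf_bracket \<A> X Y p c = DY (Xc x) - DX (Yc x)"
    using c by (simp add: vf_bracket_def DX_def DY_def Xc_def[abs_def, symmetric] Yc_def[abs_def, symmetric] x_def[symmetric] at)
  have "\<beta> p [vf_bracket \<A> X Y p, w] = \<beta>c x (DY (Xc x) - DX (Yc x)) k"
    using tangent_of_coord[OF c(1) vf_bracket_in[OF X Y W p]] wk c unfolding br_c
    by (simp add: \<beta>c_def components_at x_def)
  also have "\<dots> = \<beta>c x (DY (Xc x)) k - \<beta>c x (DX (Yc x)) k"
    using bil[OF N(2)] by (simp add: bilinear_lsub)
  finally have t4: "\<beta> p [vf_bracket \<A> X Y p, w] = \<beta>c x (DY (Xc x)) k - \<beta>c x (DX (Yc x)) k" .
  \<comment> \<open>The two terms with the derivative of \<open>X\<close> along \<open>w\<close>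
    form a symmetric pair, so they are governed by the metric axiom.\<close>
  have sym: "\<beta>c x (Yc x) (DX k) + \<beta>c x (DX k) (Yc x) = - 2 * pr (h x (Yc x)) (h x (DX k))"
    using beta_of_symmetric_part[OF b p tangent_of_in[OF c(2,3)] tangent_of_in[OF c(2,3)], of "Yc x" "DX k"] c
    by (simp add: \<beta>c_def \<beta>_def components_at x_def)
  define bd where "bd v u z = fderiv (\<lambda>y. cmp2 c b y u z) x v" for v u z
  have main: "Bd (Yc x) k (Xc x) - Bd (Xc x) k (Yc x) + Bd (Xc x) (Yc x) k + 2 * pr (h x (Yc x)) (P (Xc x) k) = 0"
  proof -
    \<comment> \<open>The product rule for \<open>beta_of\<close>, written in \<tau>\<theta>' and
      \<phi> alone: the gauge relation replaces \<theta>, and orthogonality replaces pairings of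
      \<theta>' by pairings of \<tau>\<theta>'.\<close>
    have Bd': "Bd u z v = bd v u z - (pr (t x (fderiv (\<lambda>y. f' y z) x v) - br (h x v) (t x (f' x z)) + P z v) (t x (f' x u) + h x u)
        + pr (t x (f' x z) + h x z) (t x (fderiv (\<lambda>y. f' y u) x v) - br (h x v) (t x (f' x u)) + P u v))
        + (pr (t x (fderiv (\<lambda>y. f' y z) x v)) (t x (f' x u)) + pr (t x (f' x z)) (t x (fderiv (\<lambda>y. f' y u) x v)))
        + 2 * (pr (t x (fderiv (\<lambda>y. f' y u) x v) - br (h x v) (t x (f' x u))) (h x z) + pr (t x (f' x u)) (P z v))" for u z v
    proof -
      have b': "((\<lambda>y. cmp2 c b y u z) has_derivative (\<lambda>v. bd v u z)) (at x)"
        unfolding bd_def using smooth_on_has_derivative[OF lform2D(5)[OF forms2_lform[OF b W c(2)]]] N by (simp add: N_def)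
      have "((\<lambda>y. cmp2 c b y u z - pr (f y z) (f y u) + pr (f' y z) (f' y u) + 2 * pr (t y (f' y u)) (h y z)) has_derivative
        (\<lambda>v. bd v u z - (pr (f x z) (fderiv (\<lambda>y. f y u) x v) + pr (fderiv (\<lambda>y. f y z) x v) (f x u))
          + (pr (f' x z) (fderiv (\<lambda>y. f' y u) x v) + pr (fderiv (\<lambda>y. f' y z) x v) (f' x u))
          + 2 * (pr (t x (f' x u)) (P z v) + pr (t x (fderiv (\<lambda>y. f' y u) x v) - br (h x v) (t x (f' x u))) (h x z)))) (at x)"
        unfolding P_def
        by (intro has_derivative_add has_derivative_diff has_derivative_mult_right bounded_bilinear.FDERIV[OF bounded_pr]
            b' deriv t_f'_has_derivative)
      then have "((\<lambda>y. \<beta>c y u z) has_derivative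
        (\<lambda>v. bd v u z - (pr (f x z) (fderiv (\<lambda>y. f y u) x v) + pr (fderiv (\<lambda>y. f y z) x v) (f x u))
          + (pr (f' x z) (fderiv (\<lambda>y. f' y u) x v) + pr (fderiv (\<lambda>y. f' y z) x v) (f' x u))
          + 2 * (pr (t x (f' x u)) (P z v) + pr (t x (fderiv (\<lambda>y. f' y u) x v) - br (h x v) (t x (f' x u))) (h x z)))) (at x)"
        by (rule has_derivative_transform_within_open[OF _ N])
          (simp add: \<beta>c_def \<beta>_def beta_of_coords[OF c(4)] N_def)
      from fderiv_eq[OF this, of v] show ?thesis
        unfolding Bd_def fderiv_f f_x P_def[symmetric] t_x(3) by simp
    qed
    have csx: "lcs f' x u v z - lcs f x u v z = bd u v z - bd v u z + bd z u v" for u v z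
    proof -
      have xi: "x \<in> snd c ` (fst c \<inter> W)" using N by (simp add: N_def)
      have "cmp3 c (cs3 \<A> br pr \<theta>') x u v z - cmp3 c (cs3 \<A> br pr \<theta>) x u v z = cmp3 c (ext_d \<A> b) x u v z"
        using cs c by (simp add: components_def inv_x)
      then show ?thesis
        unfolding cmp3_cs3[OF forms_tensors[OF \<theta>'] W c(2) xi] cmp3_cs3[OF forms_tensors[OF \<theta>] W c(2) xi]
          cmp_ext_d(2)[OF W c(2) xi b] ld2_def bd_def by simp
    qed
    \<comment> \<open>The Chern-Simons expression does not change when the orthogonal automorphism
      \<tau> is applied to all its values; this gives it the shape required by
      \<open>gauge_algebra\<close>.\<close>
    have lcs': "lcs f' x u v z = pr (t x (f' x u)) (t x (fderiv (\<lambda>y. f' y z) x v) - t x (fderiv (\<lambda>y. f' y v) x z))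
      - pr (t x (f' x v)) (t x (fderiv (\<lambda>y. f' y z) x u) - t x (fderiv (\<lambda>y. f' y u) x z))
      + pr (t x (f' x z)) (t x (fderiv (\<lambda>y. f' y v) x u) - t x (fderiv (\<lambda>y. f' y u) x v))
      + 2 * pr (t x (f' x u)) (br (t x (f' x v)) (t x (f' x z)))" for u v z
      unfolding linear_diff[OF t_x(1), symmetric] t_x(2)[symmetric] t_x(3) by (simp add: lcs_def ld1_def)
    have fl: "P v u = P u v - br (h x u) (h x v)" for u v
      using flat_x[of v u] by (simp add: P_def algebra_simps)
    show ?thesis
      unfolding Bd'
      by (rule gauge_algebra[where P = P and \<phi> = "h x" and a = "\<lambda>u. t x (f' x u)" and
          A = "\<lambda>u v. t x (fderiv (\<lambda>y. f' y u) x v)" and X = "Xc x" and Y = "Yc x" and W = k and bd = bd, OF fl])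
        (use csx[of "Xc x" "Yc x" k] in \<open>simp add: lcs' lcs_def[of f] ld1_def[of f] fderiv_f f_x P_def\<close>)
  qed
  have "lie_deriv \<A> X (contract Y \<beta>) p [w] = ext_d \<A> (contract X (contract Y \<beta>)) p [w] + ext_d \<A> (contract Y \<beta>) p [X p, w]"
    by (simp add: lie_deriv_def contract_def)
  \<comment> \<open>All terms with \<open>DY\<close> cancel. Those with \<open>DX\<close> leave the
    symmetric part of \<beta> and one term from \<open>P_form\<close>, and these two cancel by
    \<open>sym\<close>.\<close>
  then have "lie_deriv \<A> X (contract Y \<beta>) p [w] - contract Y (ext_d \<A> (contract X \<beta>)) p [w] -
        contract (vf_bracket \<A> X Y) \<beta> p [w] + P_form \<A> pr (\<lambda>q. \<phi> q [X q]) (\<lambda>q. \<phi> q [Y q]) p w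
    = (Bd (Yc x) k (Xc x) - Bd (Xc x) k (Yc x) + Bd (Xc x) (Yc x) k + 2 * pr (h x (Yc x)) (P (Xc x) k))
      + (\<beta>c x (Yc x) (DX k) + \<beta>c x (DX k) (Yc x)) + 2 * pr (h x (Yc x)) (h x (DX k))"
    unfolding contract_def[of Y "ext_d \<A> (contract X \<beta>)"] contract_def[of "vf_bracket \<A> X Y"] t4 d0[OF w] d1[OF tX(1) w] d1[OF tX(2) w]
      P_form_def DhX \<phi>Y DcX DcY DcXY k_def[symmetric] at[symmetric]
    by (simp add: pr_simps algebra_simps)
  then show ?thesis unfolding main sym by simp
qed

end

context gauge
begin

text \<open>The metric axiom comes from the symmetric part of \<open>beta_of\<close>, the flatness
  axiom from \<open>flat\<close>, and the bracket axiom from the Chern-Simons condition; the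
  equation for \<open>B' - B\<close> holds by the choice of \<open>beta_of\<close>.\<close>

lemma local_mor_beta_of:
  assumes B: "B \<in> forms \<A> 2 W" and B': "B' \<in> forms \<A> 2 W"
    and cs: "\<And>p. p \<in> W \<Longrightarrow> (cs3 \<A> br pr \<theta>' - cs3 \<A> br pr \<theta>) p = ext_d \<A> (B' - B) p"
  shows "local_mor \<A> br pr W (\<theta>', B') (\<phi>, \<tau>, beta_of (B' - B)) (\<theta>, B)"
proof -
  note b = forms_diff[OF B' B W]
  have 1: "1 / 2 * (beta_of (B' - B) p [v, w] + beta_of (B' - B) p [w, v]) + pr (\<phi> p [v]) (\<phi> p [w]) = 0"
    if "p \<in> W" "v \<in> tangent_space \<A> p" "w \<in> tangent_space \<A> p" for p v w
    unfolding beta_of_symmetric_part[OF b that] by simp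
  have 2: "ext_d \<A> \<phi> p [v, w] + (1/2) *\<^sub>R wedge br 1 1 \<phi> \<phi> p [v, w] = 0"
    if "p \<in> W" "v \<in> tangent_space \<A> p" "w \<in> tangent_space \<A> p" for p v w
    using flat[OF that] curvature_eq[of \<phi> p v w] by (simp add: curvature_def)
  have 3: "lie_deriv \<A> X (contract Y (beta_of (B' - B))) p [w] - contract Y (ext_d \<A> (contract X (beta_of (B' - B)))) p [w] -
        contract (vf_bracket \<A> X Y) (beta_of (B' - B)) p [w] +
        P_form \<A> pr (\<lambda>q. \<phi> q [X q]) (\<lambda>q. \<phi> q [Y q]) p w = 0"
    if "X \<in> vfields \<A> W" "Y \<in> vfields \<A> W" "p \<in> W" "w \<in> tangent_space \<A> p" for X Y p w
  proof -
    interpret gauge_at \<A> br pr W \<theta> \<theta>' \<phi> \<tau> p by unfold_locales (rule that(3))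
    have "cs3 \<A> br pr \<theta>' p vs - cs3 \<A> br pr \<theta> p vs = ext_d \<A> (B' - B) p vs" for vs
      using cs[OF that(3)] by (metis minus_apply)
    then show ?thesis by (rule courant_bracket_eq[OF b _ that(1,2,4)])
  qed
  have "courant_aut \<A> br pr W (\<phi>, \<tau>, beta_of (B' - B))"
    using forms_tensors[OF \<phi>] beta_of_tensor[OF b] aut compat 1 2 3 by simp
  then show ?thesis using cs gauge by (simp add: beta_of_tangent)
qed

text \<open>The equation for \<open>B' - B\<close> fixes \<beta> on tangent vectors, and both tensor
  fields vanish on all other arguments.\<close>

lemma local_mor_beta:
  assumes "local_mor \<A> br pr W (\<theta>', B') (\<phi>, \<tau>, \<beta>) (\<theta>, B)"
  shows "\<beta> = beta_of (B' - B)"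
proof (intro ext)
  fix p and vs :: "('m, 'e) tvec list"
  have \<beta>: "\<beta> \<in> tensors \<A> 2 W" using assms by simp
  show "\<beta> p vs = beta_of (B' - B) p vs"
  proof (cases "p \<in> W \<and> length vs = 2 \<and> set vs \<subseteq> tangent_space \<A> p")
    case True
    then obtain v w where vs: "vs = [v, w]" by (auto simp: length_Suc_conv numeral_eq_Suc)
    then have "(B' - B) p [v, w] = \<beta> p [v, w] + pr (\<theta> p [w]) (\<theta> p [v]) - pr (\<theta>' p [w]) (\<theta>' p [v]) -
          2 * pr (\<tau> p (\<theta>' p [v])) (\<phi> p [w])" using assms True by simp
    then show ?thesis using True vs by (simp add: beta_of_tangent)
  next
    case False
    then show ?thesis using suppD[OF tensors_supp[OF \<beta>] False] by (simp only: beta_of_def if_False)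
  qed
qed

end

section \<open>Lifts of transitive Lie data\<close>

locale lie_setup = lie_mfd \<A> br pr
  for \<A> :: "('m::{t2_space,second_countable_topology}, 'e::banach) chart set"
    and br :: "'g::banach \<Rightarrow> 'g \<Rightarrow> 'g" and pr :: "'g \<Rightarrow> 'g \<Rightarrow> real" +
  fixes A :: "('i, 'm, 'e, 'g) lie_data"
  assumes good: "good_cover \<A> (idx A) (cov A)" and lie: "is_lie_data \<A> br pr A"
begin

abbreviation "I \<equiv> idx A"
abbreviation "U \<equiv> cov A"
abbreviation "\<Theta> \<equiv> conn A"

lemma cover: "open_cover I U" using good by (simp add: good_cover_def)

lemma open_U: "i \<in> I \<Longrightarrow> open (U i)" using cover by (simp add: open_cover_def)

lemma U_cover: "\<exists>i. i \<in> I \<and> p \<in> U i" using cover unfolding open_cover_def by blast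

text \<open>The case \<open>i = j\<close> covers the single members of the cover, where the
  primitives are taken; the general case provides coordinate vector fields on overlaps.\<close>

lemma good_chart:
  assumes "i \<in> I" "j \<in> I" "U i \<inter> U j \<noteq> {}"
  obtains \<psi> where "adm \<psi>" "fst \<psi> = U i \<inter> U j" "snd \<psi> ` fst \<psi> = UNIV"
proof -
  have "\<forall>J. J \<subseteq> I \<and> finite J \<and> J \<noteq> {} \<and> (\<Inter>j\<in>J. U j) \<noteq> {} \<longrightarrow>
        (\<exists>\<psi>. is_chart (\<Inter>j\<in>J. U j, \<psi>) \<and> \<psi> ` (\<Inter>j\<in>J. U j) = UNIV \<and>
             (\<forall>c\<in>\<A>. compatible c (\<Inter>j\<in>J. U j, \<psi>)))"
    using good by (simp add: good_cover_def)
  from this[rule_format, of "{i, j}"] assms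
  obtain \<psi> where "is_chart (U i \<inter> U j, \<psi>)" "\<psi> ` (U i \<inter> U j) = UNIV" "\<forall>c\<in>\<A>. compatible c (U i \<inter> U j, \<psi>)"
    by auto
  then show thesis using that[of "(U i \<inter> U j, \<psi>)"] by (simp add: adm_def)
qed

lemma conn_form: "i \<in> I \<Longrightarrow> \<Theta> i \<in> forms \<A> 1 (U i)"
  using lie by (simp add: is_lie_data_def)

lemma conn_res_form: "i \<in> I \<Longrightarrow> open W \<Longrightarrow> W \<subseteq> U i \<Longrightarrow> res W (\<Theta> i) \<in> forms \<A> 1 W"
  using res_forms[OF conn_form] by blast

lemma lie_dataD:
  assumes "i \<in> I" "j \<in> I"
  shows "phi A i j \<in> forms \<A> 1 (U i \<inter> U j)" "aut_field \<A> br pr (U i \<inter> U j) (tau A i j)"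
    "\<And>X Y p. X \<in> vfields \<A> (U i \<inter> U j) \<Longrightarrow> Y \<in> vfields \<A> (U i \<inter> U j) \<Longrightarrow> p \<in> U i \<inter> U j \<Longrightarrow>
           phi A i j p [vf_bracket \<A> X Y p] =
             vderiv \<A> p (X p) (\<lambda>q. phi A i j q [Y q]) - vderiv \<A> p (Y p) (\<lambda>q. phi A i j q [X q]) +
             br (phi A i j p [X p]) (phi A i j p [Y p])"
    "connection_compat \<A> br (U i \<inter> U j) (phi A i j) (tau A i j)"
    "\<And>p v. p \<in> U i \<inter> U j \<Longrightarrow> v \<in> tangent_space \<A> p \<Longrightarrow> \<Theta> i p [v] - tau A i j p (\<Theta> j p [v]) = phi A i j p [v]"
  using lie assms unfolding is_lie_data_def Let_def by blast+

text \<open>The conditions on \<open>\<phi>\<^sub>i\<^sub>j\<close> and \<open>\<tau>\<^sub>i\<^sub>j\<close> quantify over vector fields on the whole overlap. To evaluate them at a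
  point no cut-off functions are needed: the chart of the good cover has the overlap as its domain,
  so its coordinate vector fields are defined everywhere.\<close>

lemma gauge_overlap:
  assumes ij: "i \<in> I" "j \<in> I"
  defines "W \<equiv> U i \<inter> U j"
  shows "gauge \<A> br pr W (res W (\<Theta> i)) (res W (\<Theta> j)) (phi A i j) (tau A i j)"
proof -
  note d = lie_dataD[OF ij, folded W_def]
  have W: "open W" using ij open_U by (auto simp: W_def)
  have key: "vderiv \<A> p v (\<lambda>q. tau A i j q a) = - br (phi A i j p [v]) (tau A i j p a)"
    "ext_d \<A> (phi A i j) p [u, v] + br (phi A i j p [u]) (phi A i j p [v]) = 0"
    if p: "p \<in> W" and u: "u \<in> tangent_space \<A> p" and v: "v \<in> tangent_space \<A> p" for p u v a
  proof -
    have "U i \<inter> U j \<noteq> {}" using p W_def by blast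
    then obtain \<psi> where \<psi>: "adm \<psi>" "fst \<psi> = W" unfolding W_def by (rule good_chart[OF ij])
    \<comment> \<open>The fields with constant coefficients in \<open>\<psi>\<close> that take the
      prescribed values at \<open>p\<close>.\<close>
    define X where "X q = tangent_of \<A> q \<psi> (tcoord \<psi> p u)" for q
    define Y where "Y q = tangent_of \<A> q \<psi> (tcoord \<psi> p v)" for q
    have XW: "X \<in> vfields \<A> W" "Y \<in> vfields \<A> W"
      unfolding X_def[abs_def] Y_def[abs_def] using coordinate_vfield[OF \<psi>(1)] \<psi>(2) by simp_all
    have Xp: "X p = u" "Y p = v"
      using p \<psi> u v by (simp_all add: X_def Y_def tangent_of_tcoord)
    \<comment> \<open>For a constant section the derivative inside \<tau> vanishes, and the
      compatibility condition becomes a differential equation for \<tau>.\<close>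
    have "smooth_map \<A> W (\<lambda>q. a)" by (simp add: smooth_map_def o_def smooth_on_const)
    then have "tau A i j p (vderiv \<A> p (Y p) (\<lambda>q. a)) - vderiv \<A> p (Y p) (\<lambda>q. tau A i j q a) -
        br (phi A i j p [Y p]) (tau A i j p a) = 0"
      using d(4) XW(2) p unfolding connection_compat_def by blast
    moreover have "vderiv \<A> p (Y p) (\<lambda>q. a) = 0" by (simp add: vderiv_def o_def)
    moreover have "linear (tau A i j p)" using d(2) p by (simp add: aut_field_def quad_aut_def)
    ultimately have "- vderiv \<A> p v (\<lambda>q. tau A i j q a) = br (phi A i j p [v]) (tau A i j p a)"
      by (simp add: Xp linear_0)
    then show "vderiv \<A> p v (\<lambda>q. tau A i j q a) = - br (phi A i j p [v]) (tau A i j p a)"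
      by (metis minus_minus)
    define c where "c = chart_at \<A> p"
    have c: "c \<in> charts_at \<A> p" "adm c" "p \<in> fst c" "c \<in> \<A>" using chart_at chart_at_in by (auto simp: c_def)
    define N where "N = snd c ` (fst c \<inter> W)"
    define x where "x = snd c p"
    have N: "open N" "x \<in> N" using c p open_img[OF c(2) W] by (auto simp: N_def x_def)
    note ph = forms1_lform[OF forms_tensors[OF d(1)] W c(2), folded N_def]
    have dphi: "vderiv \<A> p z (\<lambda>q. phi A i j q [Z q]) = fderiv (\<lambda>y. cmp1 c (phi A i j) y (Z p c)) x (z c)
        + cmp1 c (phi A i j) x (fderiv (\<lambda>y. Z (chart_inv c y) c) x (z c))"
      if Z: "Z \<in> vfields \<A> W" for Z z
    proof -
      have "vderiv \<A> p z (\<lambda>q. phi A i j q [Z q]) = fderiv (\<lambda>y. phi A i j (chart_inv c y) [Z (chart_inv c y)]) x (z c)"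
        by (simp add: vderiv_def Let_def o_def c_def x_def)
      also have "fderiv (\<lambda>y. phi A i j (chart_inv c y) [Z (chart_inv c y)]) x =
          fderiv (\<lambda>y. cmp1 c (phi A i j) y (Z (chart_inv c y) c)) x"
        by (rule fderiv_cong_open[OF N])
          (use c vfield_coords(2)[OF Z c(4)] in \<open>auto simp: N_def components_at chart_inv_left adm_chart\<close>)
      also have "fderiv (\<lambda>y. cmp1 c (phi A i j) y (Z (chart_inv c y) c)) x (z c) =
          fderiv (\<lambda>y. cmp1 c (phi A i j) y (Z (chart_inv c x) c)) x (z c)
          + cmp1 c (phi A i j) x (fderiv (\<lambda>y. Z (chart_inv c y) c) x (z c))"
        by (rule fderiv_eq[OF has_derivative_linear_family[OF fd N lform1D(1)[OF ph]
              smooth_on_has_derivative[OF lform1D(2)[OF ph] N(2)]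
              smooth_on_has_derivative[OF vfield_coords(1)[OF Z c(4), folded N_def] N(2)]]])
      finally show ?thesis using c by (simp add: x_def chart_inv_left adm_chart)
    qed
    have lin: "linear (cmp1 c (phi A i j) x)" by (rule lform1D(1)[OF ph N(2)])
    have "phi A i j p [vf_bracket \<A> X Y p] = cmp1 c (phi A i j) x (vf_bracket \<A> X Y p c)"
      using tangent_of_coord[OF c(1) vf_bracket_in[OF XW W p]] c by (simp add: components_at x_def)
    also have "\<dots> = cmp1 c (phi A i j) x (fderiv (\<lambda>y. Y (chart_inv c y) c) x (u c))
        - cmp1 c (phi A i j) x (fderiv (\<lambda>y. X (chart_inv c y) c) x (v c))"
      using c by (simp add: vf_bracket_def x_def[symmetric] Xp linear_diff[OF lin])
    \<comment> \<open>The derivatives of \<open>X\<close> and \<open>Y\<close> produced by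
      \<open>dphi\<close> cancel against the value of \<phi> on their bracket.\<close>
    finally have "fderiv (\<lambda>y. cmp1 c (phi A i j) y (v c)) x (u c) - fderiv (\<lambda>y. cmp1 c (phi A i j) y (u c)) x (v c)
        + br (phi A i j p [u]) (phi A i j p [v]) = 0"
      using d(3)[OF XW p] unfolding dphi[OF XW(1)] dphi[OF XW(2)] Xp by (simp add: algebra_simps)
    moreover have "ext_d \<A> (phi A i j) p [u, v] =
        fderiv (\<lambda>y. cmp1 c (phi A i j) y (v c)) x (u c) - fderiv (\<lambda>y. cmp1 c (phi A i j) y (u c)) x (v c)"
      using u v by (simp add: ext_d_def Let_def c_def x_def)
    ultimately show "ext_d \<A> (phi A i j) p [u, v] + br (phi A i j p [u]) (phi A i j p [v]) = 0" by simp
  qed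
  show ?thesis
  proof unfold_locales
    show "res W (\<Theta> i) p [v] = tau A i j p (res W (\<Theta> j) p [v]) + phi A i j p [v]"
      if "p \<in> W" "v \<in> tangent_space \<A> p" for p v
      using d(5)[OF that] that by (simp add: res_def diff_eq_eq add.commute)
  qed (use W d key conn_res_form ij in \<open>auto simp: W_def\<close>)
qed

text \<open>The trivial gauge transformation. The 1-morphisms over it are the isomorphisms of lifts
  that project to the identity.\<close>

lemma gauge_id:
  assumes i: "i \<in> I"
  shows "gauge \<A> br pr (U i) (\<Theta> i) (\<Theta> i) 0 (\<lambda>_. id)"
proof unfold_locales
  show "aut_field \<A> br pr (U i) (\<lambda>_. id)"
    by (auto simp: aut_field_def quad_aut_def linear_id smooth_map_def o_def smooth_on_const)
  show "connection_compat \<A> br (U i) 0 (\<lambda>_. id)"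
    by (simp add: connection_compat_def br_simps)
  show "vderiv \<A> p v (\<lambda>q. id a) = - br (0 p [v]) (id a)" for p v a
    by (simp add: vderiv_def o_def br_simps)
  show "ext_d \<A> (0 :: ('m, 'e, 'g) tensor) p [u, v] + br (0 p [u]) (0 p [v]) = 0" for p u v
    by (simp add: ext_d_def Let_def components_def br_simps)
qed (use i open_U conn_form forms_zero in auto)

text \<open>The forms \<open>cs\<^sub>3(\<theta>\<^sub>i) - dB\<^sub>i\<close>, which for a lift glue to the global 3-form \<open>Hform B\<close>.\<close>

definition hform :: "('i \<Rightarrow> ('m, 'e, real) tensor) \<Rightarrow> 'i \<Rightarrow> ('m, 'e, real) tensor" where
  "hform B i = cs3 \<A> br pr (\<Theta> i) - ext_d \<A> (B i)"

definition twisting :: "('i \<Rightarrow> ('m, 'e, real) tensor) \<Rightarrow> bool" where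
  "twisting B \<longleftrightarrow> (\<forall>i\<in>I. B i \<in> forms \<A> 2 (U i)) \<and>
     (\<forall>i\<in>I. \<forall>j\<in>I. \<forall>p\<in>U i \<inter> U j. hform B i p = hform B j p)"

definition betas :: "('i \<Rightarrow> ('m, 'e, real) tensor) \<Rightarrow> 'i \<Rightarrow> 'i \<Rightarrow> ('m, 'e, real) tensor" where
  "betas B i j = (let W = U i \<inter> U j in
     gauge.beta_of \<A> pr W (res W (\<Theta> i)) (res W (\<Theta> j)) (phi A i j) (tau A i j) (res W (B j) - res W (B i)))"

lemma cs3_local:
  assumes "open N" "p \<in> N" "\<And>q vs. q \<in> N \<Longrightarrow> \<theta> q vs = \<theta>' q vs"
  shows "cs3 \<A> br pr \<theta> p vs = cs3 \<A> br pr \<theta>' p vs"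
  using ext_d_local[OF assms] assms(3)[OF assms(2)] by (simp add: cs3_def wedge_def)

lemma cs3_res: "open W \<Longrightarrow> p \<in> W \<Longrightarrow> cs3 \<A> br pr (res W \<theta>) p = cs3 \<A> br pr \<theta> p"
  by (intro ext cs3_local[of W]) (auto simp: res_def)

lemma cs_condition_iff:
  assumes "i \<in> I" "j \<in> I" "B i \<in> forms \<A> 2 (U i)" "B j \<in> forms \<A> 2 (U j)" "p \<in> U i \<inter> U j"
  defines "W \<equiv> U i \<inter> U j"
  shows "(cs3 \<A> br pr (res W (\<Theta> j)) - cs3 \<A> br pr (res W (\<Theta> i))) p = ext_d \<A> (res W (B j) - res W (B i)) p
    \<longleftrightarrow> hform B i p = hform B j p"
proof -
  have W: "open W" "p \<in> W" using assms open_U by auto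
  have B: "res W (B j) \<in> tensors \<A> 2 W" "res W (B i) \<in> tensors \<A> 2 W"
    using assms W by (auto intro!: res_tensors[OF forms_tensors])
  have "ext_d \<A> (res W (B j) - res W (B i)) p vs = ext_d \<A> (B j) p vs - ext_d \<A> (B i) p vs" for vs
    by (simp add: ext_d_diff[OF B W(2)] ext_d_res[OF W])
  then have "(cs3 \<A> br pr (res W (\<Theta> j)) - cs3 \<A> br pr (res W (\<Theta> i))) p vs = ext_d \<A> (res W (B j) - res W (B i)) p vs
      \<longleftrightarrow> hform B i p vs = hform B j p vs" for vs
    by (simp add: cs3_res[OF W] hform_def) linarith
  then show ?thesis unfolding fun_eq_iff by blast
qed

lemma betas_eq:
  assumes "i \<in> I" "j \<in> I"
  shows "betas B i j p vs = (if p \<in> U i \<inter> U j \<and> length vs = 2 \<and> set vs \<subseteq> tangent_space \<A> p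
    then B j p vs - B i p vs - pr (\<Theta> i p [vs ! 1]) (\<Theta> i p [vs ! 0]) + pr (\<Theta> j p [vs ! 1]) (\<Theta> j p [vs ! 0]) +
      2 * pr (tau A i j p (\<Theta> j p [vs ! 0])) (phi A i j p [vs ! 1]) else 0)"
  unfolding betas_def Let_def gauge.beta_of_def[OF gauge_overlap[OF assms]] by (simp add: res_def)

text \<open>The 2-forms \<open>B i\<close> telescope. In the rest, substituting
  \<open>\<theta>\<^sub>j = \<tau>\<^sub>j\<^sub>k \<theta>\<^sub>k + \<phi>\<^sub>j\<^sub>k\<close>
  and using orthogonality leaves exactly the cross term that matrix multiplication produces.\<close>

lemma betas_cocycle:
  assumes B: "\<And>i. i \<in> I \<Longrightarrow> B i \<in> forms \<A> 2 (U i)" and ijk: "i \<in> I" "j \<in> I" "k \<in> I"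
    and p: "p \<in> U i \<inter> U j \<inter> U k"
  shows "mat_apply pr (phi A i j, tau A i j, betas B i j) p \<circ> mat_apply pr (phi A j k, tau A j k, betas B j k) p
    = mat_apply pr (phi A i k, tau A i k, betas B i k) p"
proof -
  have cc: "\<And>v. v \<in> tangent_space \<A> p \<Longrightarrow> phi A i j p [v] + tau A i j p (phi A j k p [v]) = phi A i k p [v]"
    "tau A i j p \<circ> tau A j k p = tau A i k p"
    using lie ijk p unfolding is_lie_data_def by blast+
  have tt: "tau A i j p (tau A j k p a) = tau A i k p a" for a
    using fun_cong[OF cc(2), of a] by simp
  have pp: "p \<in> U i \<inter> U j" "p \<in> U j \<inter> U k" "p \<in> U i \<inter> U k" using p by auto
  have "linear (tau A i j p)" "\<And>a b. pr (tau A i j p a) (tau A i j p b) = pr a b"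
    using lie_dataD(2)[OF ijk(1,2)] pp(1) by (auto simp: aut_field_def quad_aut_def)
  note t = linear_add[OF this(1)] linear_0[OF this(1)] this(2)
  \<comment> \<open>\<open>mat_apply\<close> accepts arbitrary functions in place of tangent
    vectors, so the cocycle identities are also needed there, where all terms are 0.\<close>
  have z: "phi A i j p [v] = 0" "phi A j k p [v] = 0" "phi A i k p [v] = 0" if "v \<notin> tangent_space \<A> p" for v
    using that suppD[OF forms_supp[OF lie_dataD(1)[OF ijk(1,2)]]] suppD[OF forms_supp[OF lie_dataD(1)[OF ijk(2,3)]]]
      suppD[OF forms_supp[OF lie_dataD(1)[OF ijk(1,3)]]] by auto
  have phi: "phi A i k p [v] = phi A i j p [v] + tau A i j p (phi A j k p [v])" for v
    using cc(1)[of v] z[of v] t(2) by (cases "v \<in> tangent_space \<A> p") auto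
  have tp: "pr (tau A i k p a) (tau A i j p b) = pr (tau A j k p a) b" for a b
    by (simp add: tt[symmetric] t)
  have beta: "betas B i k p [v, w] = betas B i j p [v, w] + betas B j k p [v, w]
      - 2 * pr (tau A i j p (phi A j k p [v])) (phi A i j p [w])" for v w
  proof (cases "v \<in> tangent_space \<A> p \<and> w \<in> tangent_space \<A> p")
    case True
    have th: "\<Theta> j p [v] = tau A j k p (\<Theta> k p [v]) + phi A j k p [v]"
      using lie_dataD(5)[OF ijk(2,3) pp(2), of v] True by (simp add: diff_eq_eq add.commute)
    have "pr (tau A i j p (\<Theta> j p [v])) b = pr (tau A i k p (\<Theta> k p [v])) b + pr (tau A i j p (phi A j k p [v])) b" for b
      by (simp add: th t tt pr_simps)
    then show ?thesis
      using True p by (simp add: betas_eq ijk phi tp pr_simps)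
  next
    case False
    then show ?thesis using z t(2) by (auto simp: betas_eq ijk pr_simps)
  qed
  show ?thesis
  proof
    fix y :: "('m, 'e) tvec \<times> 'g \<times> (('m, 'e) tvec \<Rightarrow> real)"
    obtain v a \<xi> where y: "y = (v, a, \<xi>)" by (cases y)
    show "(mat_apply pr (phi A i j, tau A i j, betas B i j) p \<circ> mat_apply pr (phi A j k, tau A j k, betas B j k) p) y
      = mat_apply pr (phi A i k, tau A i k, betas B i k) p y"
      by (simp add: y phi beta t(1) tt tp pr_simps fun_eq_iff)
  qed
qed

lemma truncate_eqD:
  assumes "lie_data.truncate C = A"
  shows "idx C = I" "cov C = U" "conn C = \<Theta>" "phi C = phi A" "tau C = tau A"
  unfolding assms[symmetric] by (simp_all add: lie_data.truncate_def)

lemma courant_data_iff: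
  assumes C: "lie_data.truncate C = A"
  shows "is_courant_data \<A> br pr C \<longleftrightarrow> twisting (bfield C) \<and>
    (\<forall>i\<in>I. \<forall>j\<in>I. beta C i j = betas (bfield C) i j)"
proof
  note e = truncate_eqD[OF C]
  assume D: "is_courant_data \<A> br pr C"
  have B: "\<And>i. i \<in> I \<Longrightarrow> bfield C i \<in> forms \<A> 2 (U i)"
    using D by (simp add: is_courant_data_def e)
  have mor: "local_mor \<A> br pr W (res W (\<Theta> j), res W (bfield C j)) (phi A i j, tau A i j, beta C i j)
      (res W (\<Theta> i), res W (bfield C i))" if "i \<in> I" "j \<in> I" "W = U i \<inter> U j" for i j W
    using D that unfolding is_courant_data_def Let_def trans_mat_def e by blast
  have "hform (bfield C) i p = hform (bfield C) j p" if ij: "i \<in> I" "j \<in> I" and p: "p \<in> U i \<inter> U j" for i j p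
    using cs_condition_iff[OF ij B[OF ij(1)] B[OF ij(2)] p] mor[OF ij refl] p by simp
  moreover have "beta C i j = betas (bfield C) i j" if ij: "i \<in> I" "j \<in> I" for i j
    using gauge.local_mor_beta[OF gauge_overlap[OF ij] mor[OF ij refl]] by (simp add: betas_def Let_def)
  ultimately show "twisting (bfield C) \<and> (\<forall>i\<in>I. \<forall>j\<in>I. beta C i j = betas (bfield C) i j)"
    using B unfolding twisting_def by blast
next
  note e = truncate_eqD[OF C]
  assume a: "twisting (bfield C) \<and> (\<forall>i\<in>I. \<forall>j\<in>I. beta C i j = betas (bfield C) i j)"
  then have B: "\<And>i. i \<in> I \<Longrightarrow> bfield C i \<in> forms \<A> 2 (U i)"
    and H: "\<And>i j p. i \<in> I \<Longrightarrow> j \<in> I \<Longrightarrow> p \<in> U i \<inter> U j \<Longrightarrow> hform (bfield C) i p = hform (bfield C) j p"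
    and b: "\<And>i j. i \<in> I \<Longrightarrow> j \<in> I \<Longrightarrow> beta C i j = betas (bfield C) i j"
    unfolding twisting_def by blast+
  have mor: "local_mor \<A> br pr W (res W (\<Theta> j), res W (bfield C j)) (phi A i j, tau A i j, beta C i j)
      (res W (\<Theta> i), res W (bfield C i))" if ij: "i \<in> I" "j \<in> I" and Wd: "W = U i \<inter> U j" for i j W
  proof -
    have W: "open W" using ij open_U Wd by auto
    show ?thesis unfolding b[OF ij] betas_def Let_def Wd
    proof (rule gauge.local_mor_beta_of[OF gauge_overlap[OF ij]])
      fix p assume p: "p \<in> U i \<inter> U j"
      show "(cs3 \<A> br pr (res (U i \<inter> U j) (\<Theta> j)) - cs3 \<A> br pr (res (U i \<inter> U j) (\<Theta> i))) p =
         ext_d \<A> (res (U i \<inter> U j) (bfield C j) - res (U i \<inter> U j) (bfield C i)) p"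
        using cs_condition_iff[OF ij B[OF ij(1)] B[OF ij(2)] p] H[OF ij p] by simp
    qed (use W Wd res_forms[OF B[OF ij(1)]] res_forms[OF B[OF ij(2)]] in auto)
  qed
  have "open_cover I U" using good by (simp add: good_cover_def)
  then show "is_courant_data \<A> br pr C"
    unfolding is_courant_data_def Let_def trans_mat_def e
    using B conn_form mor[OF _ _ refl] betas_cocycle[OF B] by (auto simp: b simp del: local_mor.simps mat_apply.simps)
qed

lemma lifts_iff: "C \<in> lifts \<A> br pr A \<longleftrightarrow> lie_data.truncate C = A \<and> twisting (bfield C) \<and>
    (\<forall>i\<in>I. \<forall>j\<in>I. beta C i j = betas (bfield C) i j)"
  using courant_data_iff by (auto simp: lifts_def)

section \<open>Lifts from families of 2-forms, and the global 3-form of a lift\<close>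

definition lift_of :: "('i \<Rightarrow> ('m, 'e, real) tensor) \<Rightarrow> ('i, 'm, 'e, 'g) courant_data" where
  "lift_of B = lie_data.extend A (courant_data.fields B (betas B))"

lemma lift_of_in: "twisting B \<Longrightarrow> lift_of B \<in> lifts \<A> br pr A"
proof -
  assume "twisting B"
  moreover have "bfield (lift_of B) = B" "beta (lift_of B) = betas B"
    by (simp_all add: lift_of_def lie_data.defs courant_data.defs)
  moreover have "lie_data.truncate (lift_of B) = A"
    by (simp add: lift_of_def lie_data.defs courant_data.defs)
  ultimately show ?thesis by (simp add: lifts_iff)
qed

definition Hform :: "('i \<Rightarrow> ('m, 'e, real) tensor) \<Rightarrow> ('m, 'e, real) tensor" where
  "Hform B p = hform B (SOME i. i \<in> I \<and> p \<in> U i) p"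

lemma Hform_eq:
  assumes "twisting B" "i \<in> I" "p \<in> U i"
  shows "Hform B p = hform B i p"
proof -
  define j where "j = (SOME i. i \<in> I \<and> p \<in> U i)"
  have "j \<in> I \<and> p \<in> U j" unfolding j_def by (rule someI_ex[OF U_cover])
  then show ?thesis using assms unfolding Hform_def j_def[symmetric] twisting_def by blast
qed

lemma hform_form:
  assumes "twisting B" "i \<in> I"
  shows "res (U i) (hform B i) \<in> forms \<A> 3 (U i)"
proof -
  have "res (U i) (hform B i) = res (U i) (cs3 \<A> br pr (\<Theta> i)) - res (U i) (ext_d \<A> (B i))"
    by (auto simp: res_def hform_def fun_eq_iff)
  then show ?thesis
    using forms_diff[OF cs3_form[OF forms_tensors[OF conn_form]] ext_d_form3 open_U] assms open_U
    by (simp add: twisting_def)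
qed

lemma forms3_glue:
  assumes "\<And>i. i \<in> I \<Longrightarrow> res (U i) \<omega> \<in> forms \<A> 3 (U i)"
  shows "\<omega> \<in> forms \<A> 3 UNIV"
proof (rule forms3I)
  fix c assume "c \<in> \<A>"
  then have c: "adm c" by (rule adm_atlas)
  show "lform3 (snd c ` (fst c \<inter> UNIV)) (cmp3 c \<omega>)"
  proof (rule lform3_local)
    fix x assume "x \<in> snd c ` (fst c \<inter> UNIV)"
    then obtain p where p: "p \<in> fst c" "x = snd c p" by blast
    obtain i where i: "i \<in> I" "p \<in> U i" using U_cover by blast
    have "lform3 (snd c ` (fst c \<inter> U i)) (cmp3 c \<omega>)"
      by (rule lform3_cong[OF open_img[OF c open_U[OF i(1)]] _ forms3_lform[OF assms[OF i(1)] open_U[OF i(1)] c]])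
        (simp add: components_res[OF c])
    then show "\<exists>N. open N \<and> x \<in> N \<and> lform3 N (cmp3 c \<omega>)"
      using open_img[OF c open_U[OF i(1)]] p i by blast
  qed
next
  show "supp 3 UNIV \<omega>"
    unfolding supp_def
  proof (intro allI impI)
    fix p and vs :: "('m, 'e) tvec list"
    assume v: "\<not> (p \<in> UNIV \<and> length vs = 3 \<and> set vs \<subseteq> tangent_space \<A> p)"
    obtain i where i: "i \<in> I" "p \<in> U i" using U_cover by blast
    have "res (U i) \<omega> p vs = 0" using v by (intro suppD[OF forms_supp[OF assms[OF i(1)]]]) auto
    then show "\<omega> p vs = 0" using i by (simp add: res_def)
  qed
qed

lemma Hform_form:
  assumes "twisting B"
  shows "Hform B \<in> forms \<A> 3 UNIV"
proof (rule forms3_glue)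
  fix i assume i: "i \<in> I"
  have "res (U i) (Hform B) = res (U i) (hform B i)"
    using Hform_eq[OF assms i] by (auto simp: res_def fun_eq_iff)
  then show "res (U i) (Hform B) \<in> forms \<A> 3 (U i)" using hform_form[OF assms i] by simp
qed

text \<open>\<open>first_pontryagin\<close> picks an unspecified index at each point. Gauge
  invariance of \<open>(R, R)\<close> on the overlap replaces it by any \<open>i\<close> with
  \<open>p \<in> U i\<close>, and then \<open>ext_d_cs3\<close> applies.\<close>

lemma pontryagin_chart:
  assumes i: "i \<in> I" and pU: "p \<in> U i"
  shows "first_pontryagin \<A> br pr A p vs = ext_d \<A> (res (U i) (cs3 \<A> br pr (\<Theta> i))) p vs"
proof -
  define j where "j = (SOME i. i \<in> I \<and> p \<in> U i)"
  have j: "j \<in> I" "p \<in> U j" unfolding j_def using someI_ex[OF U_cover[of p]] by auto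
  define W where "W = U i \<inter> U j"
  have oW: "open W" "p \<in> W" using i j pU open_U by (auto simp: W_def)
  interpret gauge_at \<A> br pr W "res W (\<Theta> i)" "res W (\<Theta> j)" "phi A i j" "tau A i j" p
    using gauge_overlap[OF i j(1)] oW by (simp add: gauge_at_def gauge_at_axioms_def W_def)
  have R: "wedge pr 2 2 (curvature \<A> br (res W \<eta>)) (curvature \<A> br (res W \<eta>)) p vs
      = wedge pr 2 2 (curvature \<A> br \<eta>) (curvature \<A> br \<eta>) p vs" for \<eta> :: "('m, 'e, 'g) tensor"
  proof -
    have "res W \<eta> p = \<eta> p" using oW by (simp add: res_def fun_eq_iff)
    then have "curvature \<A> br (res W \<eta>) p = curvature \<A> br \<eta> p"
      by (simp add: fun_eq_iff curvature_def ext_d_res[OF oW] wedge_def)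
    then show ?thesis by (simp add: wedge_def)
  qed
  have "first_pontryagin \<A> br pr A p vs = wedge pr 2 2 (curvature \<A> br (\<Theta> j)) (curvature \<A> br (\<Theta> j)) p vs"
    by (simp add: first_pontryagin_def Let_def j_def)
  also have "\<dots> = wedge pr 2 2 (curvature \<A> br (\<Theta> i)) (curvature \<A> br (\<Theta> i)) p vs"
    using pontryagin_gauge[of vs] unfolding R by simp
  also have "\<dots> = ext_d \<A> (res (U i) (cs3 \<A> br pr (\<Theta> i))) p vs"
    by (rule ext_d_cs3[OF forms_tensors[OF conn_form[OF i]] open_U[OF i] pU, symmetric])
  finally show ?thesis .
qed

lemma ext_d_Hform:
  assumes B: "twisting B"
  shows "ext_d \<A> (Hform B) = first_pontryagin \<A> br pr A"
proof (intro ext)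
  fix p vs
  obtain i where i: "i \<in> I" "p \<in> U i" using U_cover by blast
  note o = open_U[OF i(1)]
  have Bi: "B i \<in> forms \<A> 2 (U i)" using B i by (simp add: twisting_def)
  have "ext_d \<A> (Hform B) p = ext_d \<A> (res (U i) (cs3 \<A> br pr (\<Theta> i)) - res (U i) (ext_d \<A> (B i))) p"
    by (rule ext_d_local[OF o i(2)]) (simp add: Hform_eq[OF B i(1)] hform_def res_def)
  then show "ext_d \<A> (Hform B) p vs = first_pontryagin \<A> br pr A p vs"
    using ext_d_diff[OF forms_tensors[OF cs3_form[OF forms_tensors[OF conn_form[OF i(1)]] o]] forms_tensors[OF ext_d_form3[OF Bi o]] i(2)]
      ext_d_ext_d[OF Bi o i(2)] pontryagin_chart[OF i] by simp
qed

lemma primitives: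
  assumes "\<And>i. i \<in> I \<Longrightarrow> \<omega> i \<in> forms \<A> 3 (U i)" "\<And>i p vs. i \<in> I \<Longrightarrow> p \<in> U i \<Longrightarrow> ext_d \<A> (\<omega> i) p vs = 0"
  obtains B :: "'i \<Rightarrow> ('m, 'e, real) tensor"
  where "\<And>i. i \<in> I \<Longrightarrow> B i \<in> forms \<A> 2 (U i)" "\<And>i p. i \<in> I \<Longrightarrow> p \<in> U i \<Longrightarrow> ext_d \<A> (B i) p = \<omega> i p"
proof -
  have "\<exists>B. B \<in> forms \<A> 2 (U i) \<and> (\<forall>p\<in>U i. ext_d \<A> B p = \<omega> i p)" if i: "i \<in> I" for i
  \<comment> \<open>\<open>good_cover\<close> provides charts only for nonempty
    intersections.\<close>
  proof (cases "U i = {}")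
    case True
    then show ?thesis using forms_zero by auto
  next
    case False
    then obtain \<psi> where \<psi>: "adm \<psi>" "fst \<psi> = U i" "snd \<psi> ` fst \<psi> = UNIV" using good_chart[OF i i] by auto
    have "\<omega> i \<in> forms \<A> 3 (fst \<psi>)" "\<And>p vs. p \<in> fst \<psi> \<Longrightarrow> ext_d \<A> (\<omega> i) p vs = 0"
      using assms i \<psi>(2) by simp_all
    then obtain B where "B \<in> forms \<A> 2 (fst \<psi>)" "\<And>p. p \<in> fst \<psi> \<Longrightarrow> ext_d \<A> B p = \<omega> i p"
      using poincare_chart[OF \<psi>(1,3)] by blast
    then show ?thesis using \<psi>(2) by auto
  qed
  then show thesis using that by metis
qed

lemma lift_exists_iff: "(\<exists>C. C \<in> lifts \<A> br pr A) \<longleftrightarrow> p1_vanishes \<A> br pr A"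
proof
  assume "\<exists>C. C \<in> lifts \<A> br pr A"
  then obtain C where "C \<in> lifts \<A> br pr A" ..
  then have "twisting (bfield C)" by (simp add: lifts_iff)
  then show "p1_vanishes \<A> br pr A"
    unfolding p1_vanishes_def using Hform_form ext_d_Hform by metis
next
  assume "p1_vanishes \<A> br pr A"
  then obtain H where H: "H \<in> forms \<A> 3 UNIV" "first_pontryagin \<A> br pr A = ext_d \<A> H"
    by (auto simp: p1_vanishes_def)
  define \<omega> where "\<omega> i = res (U i) (cs3 \<A> br pr (\<Theta> i)) - res (U i) H" for i
  have f: "res (U i) (cs3 \<A> br pr (\<Theta> i)) \<in> forms \<A> 3 (U i)" "res (U i) H \<in> forms \<A> 3 (U i)" if "i \<in> I" for i
    using that open_U cs3_form[OF forms_tensors[OF conn_form]] res_forms[OF H(1)] by auto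
  have "\<omega> i \<in> forms \<A> 3 (U i)" if "i \<in> I" for i
    unfolding \<omega>_def using f[OF that] open_U[OF that] by (rule forms_diff)
  moreover have "ext_d \<A> (\<omega> i) p vs = 0" if i: "i \<in> I" "p \<in> U i" for i p vs
    unfolding \<omega>_def ext_d_diff[OF forms_tensors[OF f(1)[OF i(1)]] forms_tensors[OF f(2)[OF i(1)]] i(2)]
    using pontryagin_chart[OF i, of vs] H(2) ext_d_res[OF open_U[OF i(1)] i(2), of H] by simp
  ultimately obtain B where B: "\<And>i. i \<in> I \<Longrightarrow> B i \<in> forms \<A> 2 (U i)"
    "\<And>i p. i \<in> I \<Longrightarrow> p \<in> U i \<Longrightarrow> ext_d \<A> (B i) p = \<omega> i p" using primitives[of \<omega>] by blast
  have "hform B i p = H p" if "i \<in> I" "p \<in> U i" for i p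
    using B(2)[OF that] that by (simp add: hform_def \<omega>_def res_def fun_eq_iff)
  then have "twisting B" using B(1) by (simp add: twisting_def)
  then show "\<exists>C. C \<in> lifts \<A> br pr A" using lift_of_in by blast
qed

subsection \<open>Isomorphism of lifts\<close>

text \<open>Both lifts carry the same connection forms, so the Chern-Simons condition of a local
  1-morphism says that the difference of the 2-forms is closed. This is a pointwise statement, and
  around each point one member of the refinement is enough to read it off.\<close>

lemma fibre_iso_imp:
  assumes C': "C' \<in> lifts \<A> br pr A" and C: "C \<in> lifts \<A> br pr A" and iso: "fibre_iso \<A> br pr C' C"
  shows "Hform (bfield C') = Hform (bfield C)"
proof
  fix p
  have t: "twisting (bfield C')" "twisting (bfield C)" and e: "lie_data.truncate C' = A" "lie_data.truncate C = A"
    using C C' by (auto simp: lifts_iff)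
  note e = truncate_eqD[OF e(1)] truncate_eqD[OF e(2)]
  from iso obtain K :: "('i \<times> 'm set) set" and V \<rho> L where K: "open_cover K V" "\<forall>a\<in>K. \<rho> a \<in> idx C \<and> V a \<subseteq> cov C (\<rho> a)"
    "courant_data_mor \<A> br pr (refine_data K V \<rho> C') L (refine_data K V \<rho> C)"
    by (auto simp: fibre_iso_def)
  obtain a where a: "a \<in> K" "p \<in> V a" using K(1) unfolding open_cover_def by blast
  define i where "i = \<rho> a"
  define W where "W = V a"
  have W: "open W" "p \<in> W" "W \<subseteq> U i" and i: "i \<in> I" "p \<in> U i"
    using K(1,2) a by (auto simp: open_cover_def W_def i_def e)
  have "local_mor \<A> br pr W (res W (\<Theta> i), res W (bfield C' i)) (L a) (res W (\<Theta> i), res W (bfield C i))"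
    using K(3) a(1) unfolding courant_data_mor_def refine_data_def by (simp add: e W_def i_def)
  then have "ext_d \<A> (res W (bfield C' i) - res W (bfield C i)) p vs = 0" for vs
    using W(2) by (cases "L a") simp
  moreover have "res W (bfield C' i) \<in> tensors \<A> 2 W" "res W (bfield C i) \<in> tensors \<A> 2 W"
    using t W i by (auto simp: twisting_def intro!: res_tensors[OF forms_tensors])
  ultimately have "ext_d \<A> (bfield C' i) p vs = ext_d \<A> (bfield C i) p vs" for vs
    using ext_d_diff[OF _ _ W(2)] ext_d_res[OF W(1,2)] by (metis eq_iff_diff_eq_0)
  then show "Hform (bfield C') p = Hform (bfield C) p"
    by (simp add: Hform_eq[OF t(1) i] Hform_eq[OF t(2) i] hform_def fun_eq_iff)
qed

lemma res_self: "\<omega> \<in> forms \<A> k W \<Longrightarrow> res W \<omega> = \<omega>"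
  using suppD[OF forms_supp] by (fastforce simp: res_def fun_eq_iff)

lemma Hform_eq_imp_fibre_iso:
  assumes C': "C' \<in> lifts \<A> br pr A" and C: "C \<in> lifts \<A> br pr A" and H: "Hform (bfield C') = Hform (bfield C)"
  shows "fibre_iso \<A> br pr C' C"
proof -
  have t: "twisting (bfield C')" "twisting (bfield C)" and e: "lie_data.truncate C' = A" "lie_data.truncate C = A"
    and bt: "\<forall>i\<in>I. \<forall>j\<in>I. beta C' i j = betas (bfield C') i j" "\<forall>i\<in>I. \<forall>j\<in>I. beta C i j = betas (bfield C) i j"
    using C C' by (auto simp: lifts_iff)
  note e = truncate_eqD[OF e(1)] truncate_eqD[OF e(2)]
  have B: "bfield C' i \<in> forms \<A> 2 (U i)" "bfield C i \<in> forms \<A> 2 (U i)" if "i \<in> I" for i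
    using t that by (auto simp: twisting_def)
  \<comment> \<open>The cover serves as its own refinement, indexed in the type that
    \<open>fibre_iso\<close> prescribes.\<close>
  define K where "K = (\<lambda>i. (i, U i)) ` I"
  define b where "b i = gauge.beta_of \<A> pr (U i) (\<Theta> i) (\<Theta> i) 0 (\<lambda>_. id) (bfield C' i - bfield C i)" for i
  define L :: "'i \<times> 'm set \<Rightarrow> ('m, 'e, 'g) courant_mat" where "L a = (0, \<lambda>_. id, b (fst a))" for a
  have b_eq: "b i p [v, w] = (if v \<in> tangent_space \<A> p \<and> w \<in> tangent_space \<A> p then bfield C' i p [v, w] - bfield C i p [v, w] else 0)"
    if "i \<in> I" "p \<in> U i" for i p v w
    using that by (simp add: b_def gauge.beta_of_def[OF gauge_id] pr_simps)
  have mor: "local_mor \<A> br pr (U i) (\<Theta> i, bfield C' i) (0, \<lambda>_. id, b i) (\<Theta> i, bfield C i)" if i: "i \<in> I" for i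
    unfolding b_def
  proof (rule gauge.local_mor_beta_of[OF gauge_id[OF i] B(2,1)[OF i]])
    fix p assume p: "p \<in> U i"
    have "hform (bfield C') i p = hform (bfield C) i p"
      using H Hform_eq[OF t(1) i p] Hform_eq[OF t(2) i p] by simp
    then have "ext_d \<A> (bfield C' i) p vs = ext_d \<A> (bfield C i) p vs" for vs
      by (simp add: hform_def fun_eq_iff)
    then show "(cs3 \<A> br pr (\<Theta> i) - cs3 \<A> br pr (\<Theta> i)) p = ext_d \<A> (bfield C' i - bfield C i) p"
      by (simp add: fun_eq_iff ext_d_diff[OF forms_tensors[OF B(1)[OF i]] forms_tensors[OF B(2)[OF i]] p])
  qed
  \<comment> \<open>The matrices of the isomorphism have \<phi> = 0 and \<tau> = id, so only the
    entries \<beta> have to match; there the differences of the 2-forms telescope.\<close>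
  have mat: "mat_apply pr (phi A i j, tau A i j, betas (bfield C) i j) p \<circ> mat_apply pr (0, \<lambda>_. id, b j) p =
     mat_apply pr (0, \<lambda>_. id, b i) p \<circ> mat_apply pr (phi A i j, tau A i j, betas (bfield C') i j) p"
    if ij: "i \<in> I" "j \<in> I" and p: "p \<in> U i" "p \<in> U j" for i j p
  proof -
    have "linear (tau A i j p)"
      using lie_dataD(2)[OF ij] p by (auto simp: aut_field_def quad_aut_def)
    note t0 = linear_0[OF this]
    have "betas (bfield C) i j p [v, w] + b j p [v, w] = b i p [v, w] + betas (bfield C') i j p [v, w]" for v w
      using p by (simp add: b_eq ij betas_eq)
    note b = this
    show ?thesis
    proof
      fix y :: "('m, 'e) tvec \<times> 'g \<times> (('m, 'e) tvec \<Rightarrow> real)"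
      obtain v a \<xi> where y: "y = (v, a, \<xi>)" by (cases y)
      have "betas (bfield C) i j p [v, w] + (b j p [v, w] + r) = b i p [v, w] + (betas (bfield C') i j p [v, w] + r)" for w r
        using b[of v w] by simp
      then show "(mat_apply pr (phi A i j, tau A i j, betas (bfield C) i j) p \<circ> mat_apply pr (0, \<lambda>_. id, b j) p) y =
          (mat_apply pr (0, \<lambda>_. id, b i) p \<circ> mat_apply pr (phi A i j, tau A i j, betas (bfield C') i j) p) y"
        by (simp add: y t0 pr_simps fun_eq_iff algebra_simps)
    qed
  qed
  have mor': "courant_data_mor \<A> br pr (refine_data K snd fst C') L (refine_data K snd fst C)"
    unfolding courant_data_mor_def
  proof (intro conjI ballI)
    fix a assume "a \<in> idx (refine_data K snd fst C)"
    then obtain i where i: "i \<in> I" "a = (i, U i)" by (auto simp: refine_data_def K_def)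
    show "local_mor \<A> br pr (cov (refine_data K snd fst C) a)
        (conn (refine_data K snd fst C') a, bfield (refine_data K snd fst C') a) (L a)
        (conn (refine_data K snd fst C) a, bfield (refine_data K snd fst C) a)"
      using mor[OF i(1)] unfolding L_def refine_data_def
      by (simp add: i e res_self[OF conn_form] res_self[OF B(1)] res_self[OF B(2)] del: local_mor.simps)
  next
    fix a a' p assume "a \<in> idx (refine_data K snd fst C)" "a' \<in> idx (refine_data K snd fst C)"
      and p: "p \<in> cov (refine_data K snd fst C) a \<inter> cov (refine_data K snd fst C) a'"
    then obtain i j where i: "i \<in> I" "a = (i, U i)" and j: "j \<in> I" "a' = (j, U j)" and p: "p \<in> U i" "p \<in> U j"
      by (auto simp: refine_data_def K_def)
    have r: "mat_apply pr (res (U i \<inter> U j) \<phi>, \<tau>, res (U i \<inter> U j) \<beta>) p = mat_apply pr (\<phi>, \<tau>, \<beta>) p" for \<phi> \<tau> \<beta>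
      using p by (intro ext) (auto simp: res_def)
    show "mat_apply pr (trans_mat (refine_data K snd fst C) a a') p \<circ> mat_apply pr (L a') p =
        mat_apply pr (L a) p \<circ> mat_apply pr (trans_mat (refine_data K snd fst C') a a') p"
      using mat[OF i(1) j(1) p] bt i j
      by (simp add: L_def trans_mat_def refine_data_def e r del: mat_apply.simps)
  qed (simp_all add: refine_data_def)
  have "open_cover K snd"
    using good by (auto simp: good_cover_def open_cover_def K_def)
  moreover have "\<forall>a\<in>K. fst a \<in> idx C \<and> snd a \<subseteq> cov C (fst a)" by (auto simp: K_def e)
  ultimately show ?thesis
    unfolding fibre_iso_def using mor' by (intro exI[of _ K] exI[of _ snd] exI[of _ fst] exI[of _ L]) (simp add: L_def)
qed

text \<open>The relation is the kernel of the map from lifts to 3-forms and therefore an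
  equivalence, with no composition of morphisms over common refinements.\<close>

lemma iso_rel_iff: "(C', C) \<in> iso_rel \<A> br pr A \<longleftrightarrow>
    C' \<in> lifts \<A> br pr A \<and> C \<in> lifts \<A> br pr A \<and> Hform (bfield C') = Hform (bfield C)"
  unfolding iso_rel_def using fibre_iso_imp Hform_eq_imp_fibre_iso by auto

subsection \<open>The torsor\<close>

definition primitive :: "('m, 'e, real) tensor \<Rightarrow> ('i \<Rightarrow> ('m, 'e, real) tensor) \<Rightarrow> bool" where
  "primitive h b \<longleftrightarrow> (\<forall>i\<in>I. b i \<in> forms \<A> 2 (U i) \<and> (\<forall>p\<in>U i. ext_d \<A> (b i) p = h p))"

lemma primitive_exists:
  assumes "h \<in> forms \<A> 3 UNIV" "ext_d \<A> h = 0"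
  shows "\<exists>b. primitive h b"
proof -
  have "res (U i) h \<in> forms \<A> 3 (U i)" if "i \<in> I" for i
    using res_forms[OF assms(1) subset_UNIV open_U[OF that]] .
  moreover have "ext_d \<A> (res (U i) h) p vs = 0" if "i \<in> I" "p \<in> U i" for i p vs
    using ext_d_res[OF open_U[OF that(1)] that(2), of h] assms(2) by simp
  ultimately obtain b where "\<And>i. i \<in> I \<Longrightarrow> b i \<in> forms \<A> 2 (U i)"
    "\<And>i p. i \<in> I \<Longrightarrow> p \<in> U i \<Longrightarrow> ext_d \<A> (b i) p = res (U i) h p" using primitives[of "\<lambda>i. res (U i) h"] by blast
  then show ?thesis by (intro exI[of _ b]) (simp add: primitive_def res_def)
qed

text \<open>\<open>betas\<close> is affine in \<open>B j - B i\<close>, so the change of \<beta>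
  prescribed by \<open>shift\<close> is the one forced by the new 2-forms. The sign of
  \<open>h\<close> comes from the minus sign in \<open>hform\<close>.\<close>

lemma shift_lift:
  assumes C: "C \<in> lifts \<A> br pr A" and b: "primitive h b"
  shows "shift b C \<in> lifts \<A> br pr A" "Hform (bfield (shift b C)) = Hform (bfield C) - h"
proof -
  have t: "twisting (bfield C)" and tr: "lie_data.truncate C = A"
    and bt: "\<forall>i\<in>I. \<forall>j\<in>I. beta C i j = betas (bfield C) i j"
    using C by (auto simp: lifts_iff)
  note e = truncate_eqD[OF tr]
  have B: "bfield C i \<in> forms \<A> 2 (U i)" "b i \<in> forms \<A> 2 (U i)" if "i \<in> I" for i
    using t b that by (auto simp: twisting_def primitive_def)
  have bf: "bfield (shift b C) i = bfield C i + b i" for i by (simp add: shift_def)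
  have h: "hform (bfield (shift b C)) i p = hform (bfield C) i p - h p" if "i \<in> I" "p \<in> U i" for i p
    using ext_d_add[OF forms_tensors[OF B(1)[OF that(1)]] forms_tensors[OF B(2)[OF that(1)]] that(2)] b that
    by (simp add: hform_def bf fun_eq_iff primitive_def)
  have tw: "twisting (bfield (shift b C))"
    unfolding twisting_def
  proof (intro conjI ballI)
    show "bfield (shift b C) i \<in> forms \<A> 2 (U i)" if "i \<in> I" for i
      unfolding bf by (rule forms_add[OF B(1)[OF that] B(2)[OF that] open_U[OF that]])
    show "hform (bfield (shift b C)) i p = hform (bfield (shift b C)) j p"
      if "i \<in> I" "j \<in> I" "p \<in> U i \<inter> U j" for i j p
    proof -
      have "hform (bfield C) i p = hform (bfield C) j p" using t that unfolding twisting_def by blast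
      then show ?thesis using h that by simp
    qed
  qed
  have "beta (shift b C) i j = betas (bfield (shift b C)) i j" if ij: "i \<in> I" "j \<in> I" for i j
  proof (intro ext)
    fix p and vs :: "('m, 'e) tvec list"
    \<comment> \<open>On these arguments \<open>betas\<close> vanishes for the old and the new
      2-forms, so the shift has to vanish as well.\<close>
    have z: "b i p vs = 0" "b j p vs = 0" if "\<not> (length vs = 2 \<and> set vs \<subseteq> tangent_space \<A> p)"
      using suppD[OF forms_supp[OF B(2)[OF ij(1)]], of p vs] suppD[OF forms_supp[OF B(2)[OF ij(2)]], of p vs] that by blast+
    have "beta (shift b C) i j p vs = betas (bfield C) i j p vs + res (U i \<inter> U j) (b j - b i) p vs"
      using bt ij by (simp add: shift_def e)
    then show "beta (shift b C) i j p vs = betas (bfield (shift b C)) i j p vs"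
      unfolding betas_eq[OF ij] bf using z by (auto simp: res_def)
  qed
  moreover have "lie_data.truncate (shift b C) = A"
    using tr by (simp add: shift_def lie_data.truncate_def)
  ultimately show "shift b C \<in> lifts \<A> br pr A" using tw by (simp add: lifts_iff)
  show "Hform (bfield (shift b C)) = Hform (bfield C) - h"
  proof
    fix p
    obtain i where i: "i \<in> I" "p \<in> U i" using U_cover by blast
    show "Hform (bfield (shift b C)) p = (Hform (bfield C) - h) p"
      using h[OF i] by (simp add: Hform_eq[OF tw i] Hform_eq[OF t i] fun_eq_iff)
  qed
qed

text \<open>A fibre of the map from lifts to 3-forms. It is empty unless \<eta> comes from a lift,
  whence the side conditions below.\<close>

definition lclass :: "('m, 'e, real) tensor \<Rightarrow> ('i, 'm, 'e, 'g) courant_data set" where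
  "lclass \<eta> = {C \<in> lifts \<A> br pr A. Hform (bfield C) = \<eta>}"

lemma lift_classes_eq: "lift_classes \<A> br pr A = {lclass \<eta> | \<eta>. lclass \<eta> \<noteq> {}}"
proof -
  have "iso_rel \<A> br pr A `` {C} = lclass (Hform (bfield C))" if "C \<in> lifts \<A> br pr A" for C
    using that by (auto simp: iso_rel_iff lclass_def)
  then have "lift_classes \<A> br pr A = (\<lambda>C. lclass (Hform (bfield C))) ` lifts \<A> br pr A"
    unfolding lift_classes_def quotient_def by auto
  also have "\<dots> = {lclass \<eta> | \<eta>. lclass \<eta> \<noteq> {}}"
  proof (intro equalityI subsetI)
    fix X assume "X \<in> {lclass \<eta> | \<eta>. lclass \<eta> \<noteq> {}}"
    then obtain \<eta> C where "X = lclass \<eta>" "C \<in> lclass \<eta>" by blast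
    then show "X \<in> (\<lambda>C. lclass (Hform (bfield C))) ` lifts \<A> br pr A" by (auto simp: lclass_def)
  qed (auto simp: lclass_def)
  finally show ?thesis .
qed

lemma lclass_inj: "C \<in> lclass \<eta> \<Longrightarrow> lclass \<eta> = lclass \<eta>' \<Longrightarrow> \<eta> = \<eta>'"
  by (auto simp: lclass_def)

lemma lclass_form:
  assumes "lclass \<eta> \<noteq> {}"
  shows "\<eta> \<in> forms \<A> 3 UNIV" "ext_d \<A> \<eta> = first_pontryagin \<A> br pr A"
  using assms Hform_form ext_d_Hform by (auto simp: lclass_def lifts_iff)

lemma closed_carrier: "h \<in> carrier (closed_3_forms \<A>) \<longleftrightarrow> h \<in> forms \<A> 3 UNIV \<and> ext_d \<A> h = 0"
  by (simp add: closed_3_forms_def)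

text \<open>Every choice of representative and primitive lands in the fibre over
  \<open>\<eta> - h\<close>, and all members of that fibre are isomorphic, so one shifted lift
  already reaches all of them.\<close>

lemma act_lclass:
  assumes h: "h \<in> carrier (closed_3_forms \<A>)" and ne: "lclass \<eta> \<noteq> {}"
  shows "act \<A> br pr A h (lclass \<eta>) = lclass (\<eta> - h)" "lclass (\<eta> - h) \<noteq> {}"
proof -
  obtain b where b: "primitive h b" using primitive_exists h by (auto simp: closed_carrier)
  obtain C where C: "C \<in> lclass \<eta>" using ne by blast
  have "shift b C \<in> lclass (\<eta> - h)" using shift_lift[OF _ b, of C] C by (simp add: lclass_def)
  then show "lclass (\<eta> - h) \<noteq> {}" by blast
  have "lclass \<eta> \<in> lift_classes \<A> br pr A" using ne by (auto simp: lift_classes_eq)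
  then have "act \<A> br pr A h (lclass \<eta>) =
      {C'. \<exists>C\<in>lclass \<eta>. \<exists>b. primitive h b \<and> (shift b C, C') \<in> iso_rel \<A> br pr A}"
    by (simp add: act_def primitive_def)
  also have "\<dots> = lclass (\<eta> - h)"
  proof (intro equalityI subsetI)
    fix C' assume "C' \<in> {C'. \<exists>C\<in>lclass \<eta>. \<exists>b. primitive h b \<and> (shift b C, C') \<in> iso_rel \<A> br pr A}"
    then obtain C b where "C \<in> lclass \<eta>" "primitive h b" "(shift b C, C') \<in> iso_rel \<A> br pr A" by blast
    then show "C' \<in> lclass (\<eta> - h)" using shift_lift[of C h b] by (auto simp: lclass_def iso_rel_iff)
  next
    fix C' assume "C' \<in> lclass (\<eta> - h)"
    then have "(shift b C, C') \<in> iso_rel \<A> br pr A"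
      using shift_lift[OF _ b, of C] C by (auto simp: lclass_def iso_rel_iff)
    then show "C' \<in> {C'. \<exists>C\<in>lclass \<eta>. \<exists>b. primitive h b \<and> (shift b C, C') \<in> iso_rel \<A> br pr A}"
      using C b by blast
  qed
  finally show "act \<A> br pr A h (lclass \<eta>) = lclass (\<eta> - h)" .
qed

lemma ext_d_zero: "ext_d \<A> (0 :: ('m, 'e, real) tensor) = 0"
  by (simp add: fun_eq_iff ext_d_def Let_def components_def)

lemma ext_d_UNIV:
  fixes \<omega> \<omega>' :: "('m, 'e, real) tensor"
  assumes "\<omega> \<in> forms \<A> 3 UNIV" "\<omega>' \<in> forms \<A> 3 UNIV"
  shows "ext_d \<A> (\<omega> + \<omega>') = ext_d \<A> \<omega> + ext_d \<A> \<omega>'" "ext_d \<A> (\<omega> - \<omega>') = ext_d \<A> \<omega> - ext_d \<A> \<omega>'"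
  using ext_d_add[OF forms_tensors[OF assms(1)] forms_tensors[OF assms(2)]]
    ext_d_diff[OF forms_tensors[OF assms(1)] forms_tensors[OF assms(2)]] by (simp_all add: fun_eq_iff)

lemma group_closed_3_forms: "group (closed_3_forms \<A>)"
proof (rule groupI)
  fix x y assume "x \<in> carrier (closed_3_forms \<A>)" "y \<in> carrier (closed_3_forms \<A>)"
  then show "x \<otimes>\<^bsub>closed_3_forms \<A>\<^esub> y \<in> carrier (closed_3_forms \<A>)"
    by (simp add: closed_3_forms_def ext_d_UNIV forms_add)
next
  fix x assume "x \<in> carrier (closed_3_forms \<A>)"
  then have x: "x \<in> forms \<A> 3 UNIV" "ext_d \<A> x = 0" by (simp_all add: closed_carrier)
  have "ext_d \<A> (0 - x) = 0" unfolding ext_d_UNIV(2)[OF forms_zero x(1)] ext_d_zero x(2) by simp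
  moreover have "0 - x \<in> forms \<A> 3 UNIV" by (rule forms_diff[OF forms_zero x(1) open_UNIV])
  ultimately show "\<exists>y\<in>carrier (closed_3_forms \<A>). y \<otimes>\<^bsub>closed_3_forms \<A>\<^esub> x = \<one>\<^bsub>closed_3_forms \<A>\<^esub>"
    by (intro bexI[of _ "0 - x"]) (simp_all add: closed_3_forms_def)
qed (auto simp: closed_3_forms_def add.assoc forms_zero ext_d_zero)

lemma lift_torsor:
  assumes "\<exists>C. C \<in> lifts \<A> br pr A"
  shows "torsor (closed_3_forms \<A>) (lift_classes \<A> br pr A) (act \<A> br pr A)"
proof -
  let ?G = "closed_3_forms \<A>" and ?E = "lift_classes \<A> br pr A" and ?act = "act \<A> br pr A"
  have closed_act: "?act h X \<in> ?E" if h: "h \<in> carrier ?G" and E: "X \<in> ?E" for h X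
  proof -
    obtain \<eta> where X: "X = lclass \<eta>" "lclass \<eta> \<noteq> {}" using E unfolding lift_classes_eq by blast
    show ?thesis using act_lclass[OF h X(2)] unfolding X(1) lift_classes_eq by blast
  qed
  interpret group ?G by (rule group_closed_3_forms)
  have mult: "?act (h \<otimes>\<^bsub>?G\<^esub> h') X = ?act h (?act h' X)" if h: "h \<in> carrier ?G" "h' \<in> carrier ?G" and E: "X \<in> ?E" for h h' X
  proof -
    obtain \<eta> where X: "X = lclass \<eta>" "lclass \<eta> \<noteq> {}" using E unfolding lift_classes_eq by blast
    \<comment> \<open>The action of \<open>h'\<close> comes first and subtracts \<open>h'\<close>
      first; the commuted sum matches the iterated difference.\<close>
    have "h \<otimes>\<^bsub>?G\<^esub> h' = h' + h" by (simp add: closed_3_forms_def add.commute)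
    moreover have "h \<otimes>\<^bsub>?G\<^esub> h' \<in> carrier ?G" using h by simp
    ultimately show ?thesis unfolding X
      using act_lclass[OF h(2) X(2)] act_lclass[OF h(1), of "\<eta> - h'"] act_lclass[of "h' + h", OF _ X(2)]
      by (simp add: diff_diff_eq)
  qed
  have one: "?act \<one>\<^bsub>?G\<^esub> X = X" if "X \<in> ?E" for X
    using that act_lclass(1)[OF one_closed] by (auto simp: lift_classes_eq closed_3_forms_def)
  have bij: "?act h \<in> carrier (BijGroup ?E)" if h: "h \<in> carrier ?G" for h
  proof -
    have "bij_betw (?act h) ?E ?E"
      by (rule bij_betw_byWitness[of _ "?act (inv\<^bsub>?G\<^esub> h)"])
        (use h mult[of h "inv\<^bsub>?G\<^esub> h"] mult[of "inv\<^bsub>?G\<^esub> h" h] one closed_act in auto)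
    moreover have "?act h \<in> extensional ?E" by (simp add: act_def)
    ultimately show ?thesis by (simp add: BijGroup_def Bij_def)
  qed
  have "group_action ?G ?E ?act"
    unfolding group_action_def group_hom_def group_hom_axioms_def
  proof (intro conjI is_group group_BijGroup homI bij)
    fix h h' assume h: "h \<in> carrier ?G" "h' \<in> carrier ?G"
    show "?act (h \<otimes>\<^bsub>?G\<^esub> h') = ?act h \<otimes>\<^bsub>BijGroup ?E\<^esub> ?act h'"
    proof
      fix X
      show "?act (h \<otimes>\<^bsub>?G\<^esub> h') X = (?act h \<otimes>\<^bsub>BijGroup ?E\<^esub> ?act h') X"
        using bij h mult[OF h] by (cases "X \<in> ?E") (auto simp: BijGroup_def compose_def act_def)
    qed
  qed
  moreover have "?E \<noteq> {}"
    using assms by (auto simp: lift_classes_eq lclass_def)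
  moreover have "\<exists>!g. g \<in> carrier ?G \<and> ?act g X = Y" if XY: "X \<in> ?E" "Y \<in> ?E" for X Y
  proof -
    obtain \<eta> \<eta>' where X: "X = lclass \<eta>" "lclass \<eta> \<noteq> {}" and Y: "Y = lclass \<eta>'" "lclass \<eta>' \<noteq> {}"
      using XY unfolding lift_classes_eq by blast
    \<comment> \<open>Both 3-forms have exterior derivative \<open>(R, R)\<close>, so their
      difference is closed.\<close>
    have g: "\<eta> - \<eta>' \<in> carrier ?G"
      using lclass_form[OF X(2)] lclass_form[OF Y(2)] forms_diff[OF _ _ open_UNIV]
      by (simp add: closed_carrier ext_d_UNIV)
    show ?thesis
    proof (rule ex1I[of _ "\<eta> - \<eta>'"])
      show "\<eta> - \<eta>' \<in> carrier ?G \<and> ?act (\<eta> - \<eta>') X = Y"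
        using g act_lclass(1)[OF g X(2)] by (simp add: X Y)
      fix g assume g: "g \<in> carrier ?G \<and> ?act g X = Y"
      then have "lclass (\<eta> - g) = lclass \<eta>'" "lclass (\<eta> - g) \<noteq> {}" using act_lclass[OF _ X(2), of g] by (auto simp: X Y)
      then have "\<eta> - g = \<eta>'" using lclass_inj by blast
      then show "g = \<eta> - \<eta>'" by (simp add: algebra_simps)
    qed
  qed
  ultimately show ?thesis unfolding torsor_def by blast
qed

end

theorem theorem4p9:
  fixes \<A> :: "('m::{t2_space,second_countable_topology}, 'e::banach) chart set"
    and br :: "'g::banach \<Rightarrow> 'g \<Rightarrow> 'g"
    and pr :: "'g \<Rightarrow> 'g \<Rightarrow> real"
    and A :: "('i, 'm, 'e, 'g) lie_data"
  assumes "quadratic_lie_algebra br pr"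
    and "smooth_manifold \<A>"
    and "good_cover \<A> (idx A) (cov A)"
    and "is_lie_data \<A> br pr A"
  shows "((\<exists>C. C \<in> lifts \<A> br pr A) \<longleftrightarrow> p1_vanishes \<A> br pr A) \<and>
    ((\<exists>C. C \<in> lifts \<A> br pr A) \<longrightarrow>
       torsor (closed_3_forms \<A>) (lift_classes \<A> br pr A) (act \<A> br pr A))"
proof -
  interpret lie_setup \<A> br pr A
    using assms by unfold_locales
  show ?thesis using lift_exists_iff lift_torsor by blast
qed

end
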